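(* Let $K\subset\Omega$ be a compact subset with zero $C_{\Delta^{L\ln L}}$-capacity. Suppose $u\in C(\overline\Omega\setminus K)\cap C^2(\Omega\setminus K)$ is a nonnegative solution of $$-\Delta u+e^u-1=0\quad\text{in }\Omega\setminus K$$ which vanishes on $\partial\Omega$. Then $u$ is identically zero.
   Context: $\Omega$ is a bounded domain in $\mathbb R^N$ with smooth boundary. Let $Q_0$ be a fixed cube containing $\overline\Omega$ with sides parallel to the axes. For $f\in L^1(\Omega)$, extended by $0$ to $Q_0\setminus\Omega$, the Hardy–Littlewood maximal function is $M[f](x)=\sup\frac1{|Q|}\int_Q|f(y)|\,dy$, the supremum being over all cubes $Q\subset Q_0$ containing $x$ with sides parallel to the axes. For compact $K\subset\Omega$, $$C_{\Delta^{L\ln L}}(K)=\inf\{\|M[\Delta\eta]\|_{L^1(Q_0)}:\eta\in C^2_0(\Omega),\ 0\le\eta\le1,\ \eta=1\text{ in a neighborhood of }K\},$$ where $C^2_0(\Omega)$ is the space of compactly supported $C^2$ functions in $\Omega$. *)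

theory Defs
  imports "HOL-Analysis.Analysis"
begin

definition partial :: "'n::finite \<Rightarrow> (real^'n \<Rightarrow> real) \<Rightarrow> real^'n \<Rightarrow> real" where
  "partial i f x = frechet_derivative f (at x) (axis i 1)"

definition laplacian :: "(real^'n::finite \<Rightarrow> real) \<Rightarrow> real^'n \<Rightarrow> real" where
  "laplacian f x = (\<Sum>i\<in>UNIV. partial i (partial i f) x)"

(* Only meaningful for open S: derivatives are taken in the full space, not within S. *)
primrec Ck_on :: "nat \<Rightarrow> (real^'n::finite \<Rightarrow> real) \<Rightarrow> (real^'n) set \<Rightarrow> bool" where
  "Ck_on 0 f S \<longleftrightarrow> continuous_on S f"
| "Ck_on (Suc k) f S \<longleftrightarrow>
     (\<forall>x\<in>S. f differentiable (at x)) \<and> (\<forall>i. Ck_on k (partial i f) S)"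

(* Near every boundary point, D is the negative side of a C-infinity function with
   nowhere vanishing gradient, and the boundary is its zero set. In particular D lies
   on one side of its boundary. *)
definition smooth_boundary :: "(real^'n::finite) set \<Rightarrow> bool" where
  "smooth_boundary D \<longleftrightarrow>
     (\<forall>p\<in>frontier D. \<exists>U \<phi>. open U \<and> p \<in> U \<and> (\<forall>k. Ck_on k \<phi> U) \<and>
        (\<forall>x\<in>U. \<exists>i. partial i \<phi> x \<noteq> 0) \<and>
        D \<inter> U = {x\<in>U. \<phi> x < 0} \<and> frontier D \<inter> U = {x\<in>U. \<phi> x = 0})"

definition axis_cube :: "(real^'n::finite) set \<Rightarrow> bool" where
  "axis_cube Q \<longleftrightarrow> (\<exists>a l. l > 0 \<and> Q = cbox a (\<chi> i. a $ i + l))"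

(* The argument f is a function on the cube Q0; functions on a subset of Q0 have to be
   extended by zero first. Values are extended nonnegative reals, so no integrability
   is needed for the supremum to make sense. *)
definition maximal_fn :: "(real^'n::finite) set \<Rightarrow> (real^'n \<Rightarrow> real) \<Rightarrow> real^'n \<Rightarrow> ennreal" where
  "maximal_fn Q0 f x =
     (SUP Q\<in>{Q. axis_cube Q \<and> Q \<subseteq> Q0 \<and> x \<in> Q}.
        (\<integral>\<^sup>+y\<in>Q. ennreal \<bar>f y\<bar> \<partial>lebesgue) / emeasure lebesgue Q)"

(* A compactly supported function on D is represented by its extension by zero to the
   whole space. *)
definition C2_compact_support :: "(real^'n::finite) set \<Rightarrow> (real^'n \<Rightarrow> real) set" where
  "C2_compact_support D =
     {\<eta>. Ck_on 2 \<eta> D \<and> compact (closure {x. \<eta> x \<noteq> 0}) \<and> closure {x. \<eta> x \<noteq> 0} \<subseteq> D}"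

definition cap_LlnL :: "(real^'n::finite) set \<Rightarrow> (real^'n) set \<Rightarrow> (real^'n) set \<Rightarrow> ennreal" where
  "cap_LlnL Q0 D K =
     (INF \<eta>\<in>{\<eta>\<in>C2_compact_support D. (\<forall>x. 0 \<le> \<eta> x \<and> \<eta> x \<le> 1) \<and>
                 (\<exists>U. open U \<and> K \<subseteq> U \<and> (\<forall>x\<in>U. \<eta> x = 1))}.
        \<integral>\<^sup>+x\<in>Q0. maximal_fn Q0 (\<lambda>y. if y \<in> D then laplacian \<eta> y else 0) x \<partial>lebesgue)"

end

theory Submission
  imports Defs
begin

text \<open>
  Let \<open>\<eta>\<close> be a test function for \<open>K\<close>, \<open>\<zeta> = 1 - \<eta>\<close>, and \<open>J\<close> a smoothed positive part of \<open>u - \<epsilon>\<close>.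
  Testing the equation with \<open>\<zeta>\<^sup>3\<close> gives \<open>\<integral> \<zeta>\<^sup>3 J'(u) (e\<^sup>u - 1) \<le> \<integral> J \<Delta>\<zeta>\<^sup>3 \<le> 9 \<integral> J \<zeta> F\<close> with
  \<open>F = \<bar>\<Delta>\<eta>\<bar> + \<bar>\<nabla>\<eta>\<bar>\<^sup>2\<close>. The duality between the exponential and \<open>L ln L\<close> absorbs half of the left-hand
  side and leaves \<open>\<integral> F (1 + ln D)\<close>, for any \<open>D \<ge> 1\<close> with \<open>F \<le> 2 D\<close>. Choosing for \<open>D\<close> a dyadic maximal
  function of \<open>F\<close>, a telescoping argument bounds this by the \<open>L\<^sup>1\<close> norm of the maximal function of \<open>F\<close>.
  The gradient term does no harm: since \<open>0 \<le> \<eta> \<le> 1\<close>, every average of \<open>\<bar>\<nabla>\<eta>\<bar>\<^sup>2\<close> over a cube containing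
  \<open>x\<close> is at most a constant times \<open>M[\<Delta>\<eta>] x\<close>. So the left-hand side tends to zero along a minimizing
  sequence of test functions, while \<open>\<integral> \<eta>\<close> tends to zero too, which is impossible if \<open>u > \<epsilon>\<close> somewhere.
\<close>

text \<open>The exponent 3 comes from the absorption. The Laplacian of \<zeta>^3 combines \<zeta>^2
  \<Delta>\<zeta> and \<zeta> |\<nabla>\<zeta>|^2, so each term keeps a factor \<zeta>. Only
  \<zeta>^3 exp u is available on the left, so the duality produces a term ln (1/\<zeta>), and that
  factor makes it bounded. With \<zeta>^2 the gradient term would carry no such factor. The main
  obstacle is |\<nabla>\<eta>|^2. A pointwise bound by M[\<Delta>\<eta>] would not be enough:
  \<open>D\<close> is itself a maximal function, so averaging that bound would iterate M, and the L1
  norm of M[\<Delta>\<eta>] does not control the iterate. Hence the averages of |\<nabla>\<eta>|^2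
  are estimated directly, with critical scale r = 1 / sqrt a when \<open>a\<close> bounds the
  averages of |\<Delta>\<eta>|. Below it, all integrations by parts are arranged so that a change of
  scale costs an average of the Laplacian and never a mixed second derivative. The maximal function
  \<open>D\<close> stops at a finite dyadic depth. Since F is continuous, this already reaches F up
  to a factor 2, and no limit is taken.\<close>

section \<open>Derivatives along coordinate lines\<close>

text \<open>Only derivatives along coordinate lines are used, because they pass through integrals by the
  one-dimensional Leibniz rule.\<close>

definition has_pd :: "'n::finite \<Rightarrow> (real^'n \<Rightarrow> real) \<Rightarrow> real \<Rightarrow> real^'n \<Rightarrow> bool" where
  "has_pd i f d x \<longleftrightarrow> ((\<lambda>t. f (x + t *\<^sub>R axis i 1)) has_real_derivative d) (at 0)"

lemma has_pd_const: "has_pd i (\<lambda>x. c) 0 x"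
  by (simp add: has_pd_def)

lemma has_pd_component: "has_pd i (\<lambda>x. x $ j) (if i = j then 1 else 0) x"
  unfolding has_pd_def by (auto intro!: derivative_eq_intros simp: axis_def)

lemma has_pd_diff: "has_pd i f d x \<Longrightarrow> has_pd i g e x \<Longrightarrow> has_pd i (\<lambda>x. f x - g x) (d - e) x"
  unfolding has_pd_def by (intro DERIV_diff)

lemma has_pd_mult:
  "has_pd i f d x \<Longrightarrow> has_pd i g e x \<Longrightarrow> has_pd i (\<lambda>x. f x * g x) (d * g x + e * f x) x"
  unfolding has_pd_def using DERIV_mult[of "\<lambda>t. f (x + t *\<^sub>R axis i 1)" d 0 UNIV "\<lambda>t. g (x + t *\<^sub>R axis i 1)" e]
  by simp

lemma has_pd_cmult: "has_pd i f d x \<Longrightarrow> has_pd i (\<lambda>x. c * f x) (c * d) x"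
  unfolding has_pd_def by (rule DERIV_cmult)

lemma has_pd_compose:
  assumes "has_pd i f d x" and "(h has_real_derivative h') (at (f x))"
  shows "has_pd i (\<lambda>x. h (f x)) (h' * d) x"
  unfolding has_pd_def
  using assms(2) DERIV_chain2[where f = h and Da = h', OF _ assms(1)[unfolded has_pd_def]] by simp

lemma has_pd_affine:
  assumes "has_pd i f d (y + r *\<^sub>R z)"
  shows "has_pd i (\<lambda>z. f (y + r *\<^sub>R z)) (r * d) z"
proof -
  have "((\<lambda>t. f (y + r *\<^sub>R z + (r * t) *\<^sub>R axis i 1)) has_real_derivative d * r) (at 0)"
    by (rule DERIV_chain2[where f = "\<lambda>t. f (y + r *\<^sub>R z + t *\<^sub>R axis i 1)"])
       (use assms in \<open>auto simp: has_pd_def intro!: derivative_eq_intros\<close>)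
  then show ?thesis by (simp add: has_pd_def algebra_simps)
qed

lemma has_pd_line:
  assumes "has_pd i f d (x + t *\<^sub>R axis i 1)"
  shows "((\<lambda>t. f (x + t *\<^sub>R axis i 1)) has_real_derivative d) (at t)"
  using assms DERIV_at_within_shift[of "\<lambda>t. f (x + t *\<^sub>R axis i 1)" d t 0 UNIV]
  by (simp add: has_pd_def algebra_simps)

lemma has_pd_unique: "has_pd i f d x \<Longrightarrow> has_pd i f d' x \<Longrightarrow> d = d'"
  unfolding has_pd_def by (rule DERIV_unique)

lemma has_pd_cong_open:
  assumes "open S" "x \<in> S" "\<And>y. y \<in> S \<Longrightarrow> f y = g y" "has_pd i f d x"
  shows "has_pd i g d x"
proof -
  have "open ((\<lambda>t::real. x + t *\<^sub>R axis i 1) -` S)"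
    by (intro open_vimage assms(1) continuous_intros)
  then have "\<forall>\<^sub>F t in nhds 0. x + t *\<^sub>R axis i 1 \<in> S"
    using eventually_nhds_in_open[of "(\<lambda>t::real. x + t *\<^sub>R axis i 1) -` S" 0] assms(2) by simp
  then have "\<forall>\<^sub>F t in nhds 0. f (x + t *\<^sub>R axis i 1) = g (x + t *\<^sub>R axis i 1)"
    by (auto elim: eventually_mono simp: assms(3))
  then show ?thesis
    using assms(4) unfolding has_pd_def by (subst DERIV_cong_ev[symmetric]) auto
qed

text \<open>By translation invariance \<open>t \<mapsto> \<integral> G (x + t e\<^sub>i)\<close> is constant.\<close>

lemma integral_pd_eq_0:
  fixes G G' :: "real^'n::finite \<Rightarrow> real"
  assumes pd: "\<And>x. has_pd i G (G' x) x"
    and cont: "continuous_on UNIV G" "continuous_on UNIV G'"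
    and zero: "\<And>x. x \<notin> cbox a b \<Longrightarrow> G x = 0"
  shows "integral (cbox a b) G' = 0"
proof -
  \<comment> \<open>A margin of 1 keeps the support of every shift with |t| < 1 inside one fixed
    box, so the integral is constant in t.\<close>
  let ?P = "cbox (a - 1) (b + 1)"
  define e :: "real^'n" where "e = axis i 1"
  have sub: "cbox a b \<subseteq> ?P" by (auto simp: mem_box_cart) (smt (verit))+
  have cG: "continuous_on S (\<lambda>x. G (x + c))" for S c
    by (intro continuous_on_compose2[OF cont(1)] continuous_intros) auto
  have "integral ?P (\<lambda>x. G (x + t *\<^sub>R e)) = integral (cbox a b) G" if "t \<in> {-1<..<1}" for t
  proof -
    let ?c = "t *\<^sub>R e"
    have "(G has_integral integral (cbox a b) G) (cbox a b)"
      using cG[of _ 0] by (simp add: integrable_continuous integrable_integral)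
    then have "(G \<circ> (+) ?c has_integral integral (cbox a b) G) (cbox (a - ?c) (b - ?c))"
      by (simp add: has_integral_shift_cbox_iff)
    then have "(G \<circ> (+) ?c has_integral integral (cbox a b) G) ?P"
    proof (rule has_integral_on_superset)
      fix x assume "x \<notin> cbox (a - ?c) (b - ?c)"
      then have "?c + x \<notin> cbox a b" by (auto simp: mem_box_cart algebra_simps)
      then show "(G \<circ> (+) ?c) x = 0" using zero by auto
    next
      have "\<bar>t * e $ j\<bar> \<le> 1" for j using that by (auto simp: e_def axis_def)
      then show "cbox (a - ?c) (b - ?c) \<subseteq> ?P"
        by (auto simp: mem_box_cart) (smt (verit))+
    qed
    then show ?thesis by (simp add: integral_unique o_def add.commute)
  qed
  then have ev: "\<forall>\<^sub>F t in nhds 0. integral ?P (\<lambda>x. G (x + t *\<^sub>R e)) = integral (cbox a b) G"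
    by (intro eventually_nhds_in_open[of "{-1<..<1}" 0, THEN eventually_mono]) auto
  have "((\<lambda>t. integral ?P (\<lambda>x. G (x + t *\<^sub>R e))) has_real_derivative
          integral ?P (\<lambda>x. G' (x + 0 *\<^sub>R e))) (at 0 within UNIV)"
  proof (rule leibniz_rule_field_derivative)
    show "((\<lambda>t. G (x + t *\<^sub>R e)) has_real_derivative G' (x + t *\<^sub>R e)) (at t within UNIV)" for t x
      unfolding e_def by (rule has_pd_line[OF pd])
    show "continuous_on (UNIV \<times> ?P) (\<lambda>(t, x). G' (x + t *\<^sub>R e))"
      unfolding split_def
      by (intro continuous_on_compose2[OF cont(2)] continuous_intros) auto
  qed (auto intro!: integrable_continuous cG)
  then have "((\<lambda>t. integral (cbox a b) G) has_real_derivative integral ?P G') (at 0)"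
    using ev by (subst DERIV_cong_ev[symmetric]) auto
  then have 0: "integral ?P G' = 0"
    using DERIV_unique DERIV_const by blast
  have "(G' has_integral integral (cbox a b) G') (cbox a b)"
    by (intro integrable_integral integrable_continuous continuous_on_subset[OF cont(2)]) auto
  \<comment> \<open>\<open>G\<close> vanishes on the open complement of the box, hence so does
    \<open>G'\<close>, and the margin contributes nothing.\<close>
  then have "(G' has_integral integral (cbox a b) G') ?P"
  proof (rule has_integral_on_superset)
    fix x assume x: "x \<notin> cbox a b"
    have "has_pd i G 0 x"
      by (rule has_pd_cong_open[OF _ _ _ has_pd_const[of i 0]])
         (use x zero in \<open>auto intro!: open_Compl closed_cbox[unfolded closed_def]\<close>)
    then show "G' x = 0" using has_pd_unique pd by blast
  qed fact
  with 0 show ?thesis by (simp add: integral_unique)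
qed

section \<open>Polynomial cutoff functions on the unit ball\<close>

definition bump :: "nat \<Rightarrow> real^'n::finite \<Rightarrow> real" where
  "bump k z = max 0 (1 - z \<bullet> z) ^ k"

lemma continuous_on_bump [continuous_intros]: "continuous_on S (bump k)"
  unfolding bump_def by (intro continuous_intros)

lemma bump_nonneg: "0 \<le> bump k z"
  by (simp add: bump_def)

lemma bump_le_1: "bump k z \<le> 1"
  by (simp add: bump_def power_le_one)

lemma bump_zero:
  assumes "z \<notin> cbox (-1) 1" "0 < k"
  shows "bump k z = 0"
proof -
  obtain i where "1 < \<bar>z $ i\<bar>"
    using assms(1) by (auto simp: mem_box_cart abs_le_iff not_le[symmetric])
  then have "1 < norm z" using component_le_norm_cart[of z i] by simp
  then have "1 < z \<bullet> z" using power_strict_mono[of 1 "norm z" 2] by (simp add: power2_norm_eq_inner)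
  with assms show ?thesis by (simp add: bump_def)
qed

text \<open>Value and slope of \<open>h\<close> both vanish at 0, so gluing with 0 on the left is
  differentiable there too. It serves the bump powers as well as the ramp functions.\<close>

lemma DERIV_max_0:
  fixes h h' :: "real \<Rightarrow> real"
  assumes d: "\<And>s. 0 \<le> s \<Longrightarrow> (h has_real_derivative h' s) (at s)" and "h 0 = 0" "h' 0 = 0"
  shows "((\<lambda>t. h (max 0 t)) has_real_derivative h' (max 0 t)) (at t)"
proof -
  consider "t > 0" | "t < 0" | "t = 0" by linarith
  then show ?thesis
  proof cases
    case 1
    have "\<forall>\<^sub>F s in nhds t. h (max 0 s) = h s"
      using eventually_nhds_in_open[of "{0<..}" t] 1 by (auto elim!: eventually_mono simp: max_def)
    moreover have "(h has_real_derivative h' (max 0 t)) (at t)" using d[of t] 1 by simp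
    ultimately show ?thesis by (subst DERIV_cong_ev) auto
  next
    case 2
    have "\<forall>\<^sub>F s in nhds t. h (max 0 s) = 0"
      using eventually_nhds_in_open[of "{..<0}" t] 2 assms(2) by (auto elim!: eventually_mono simp: max_def)
    moreover have "((\<lambda>_. 0) has_real_derivative h' (max 0 t)) (at t)" using 2 assms(3) by simp
    ultimately show ?thesis by (subst DERIV_cong_ev) auto
  next
    case 3
    have "(\<lambda>k. h k / k) \<midarrow>0\<rightarrow> 0" using d[of 0] assms by (simp add: DERIV_def)
    then have "(\<lambda>k. h (max 0 k) / k) \<midarrow>0\<rightarrow> 0"
      by (rule Lim_null_comparison[rotated, OF tendsto_norm_zero])
         (auto simp: assms(2) max_def divide_le_0_iff intro!: always_eventually)
    then show ?thesis using 3 assms by (simp add: DERIV_def)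
  qed
qed

text \<open>Differentiation lowers the power by one and brings out a factor \<open>z $ i\<close>.
  Read backwards, \<open>z $ i * bump k z\<close> is a gradient, which drives every integration by
  parts below.\<close>

lemma has_pd_bump:
  assumes "0 < k"
  shows "has_pd i (bump (Suc k)) (- (2 * real (Suc k)) * (z $ i * bump k z)) z"
proof -
  have "has_pd i (\<lambda>z. 1 - z \<bullet> z) (- 2 * z $ i) z"
    unfolding has_pd_def
    by (auto intro!: derivative_eq_intros simp: inner_add_left inner_add_right inner_axis inner_commute)
  note inner = this
  have "((\<lambda>t. max 0 t ^ Suc k) has_real_derivative real (Suc k) * max 0 t ^ k) (at t)" for t :: real
    by (rule DERIV_max_0[where h = "\<lambda>s. s ^ Suc k" and h' = "\<lambda>s. real (Suc k) * s ^ k"])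
       (use DERIV_pow[of "Suc k"] assms in \<open>auto simp: zero_power\<close>)
  from has_pd_compose[OF inner this] show ?thesis
    by (simp add: bump_def[abs_def] algebra_simps)
qed

section \<open>Averages of the gradient\<close>

abbreviation ucube :: "(real^'n::finite) set" where
  "ucube \<equiv> cbox (-1) 1"

lemma integral_ucube_const: "integral (ucube :: (real^'n::finite) set) (\<lambda>_. c :: real) = 2 ^ CARD('n) * c"
proof -
  have "(-1 :: real^'n) \<in> cbox (-1) 1" by (simp add: mem_box_cart)
  then have "measure lborel (cbox (-1) 1 :: (real^'n) set) = 2 ^ CARD('n)"
    by (subst content_cbox_cart) auto
  then show ?thesis by simp
qed

lemma integrable_ucube: "continuous_on UNIV h \<Longrightarrow> h integrable_on (cbox a b)"
  for h :: "real^'n::finite \<Rightarrow> real"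
  by (rule integrable_continuous, rule continuous_on_subset) auto

lemma continuous_on_affine_arg:
  fixes h :: "real^'n::finite \<Rightarrow> real"
  assumes "continuous_on UNIV h" "continuous_on S p" "continuous_on S r" "continuous_on S q"
  shows "continuous_on S (\<lambda>z. h (p z + r z *\<^sub>R q z))"
  by (rule continuous_on_compose2[OF assms(1)
      continuous_on_add[OF assms(2) continuous_on_scaleR[OF assms(3,4)]]]) simp

lemma integral_ucube_scale:
  fixes h :: "real^'n::finite \<Rightarrow> real"
  assumes "continuous_on UNIV h" "0 < r"
  shows "integral ucube (\<lambda>w. h (c + r *\<^sub>R w)) =
         integral (cbox (c - r *\<^sub>R 1) (c + r *\<^sub>R 1)) h / r ^ CARD('n)"
proof -
  have "(h has_integral integral (cbox (c - r *\<^sub>R 1) (c + r *\<^sub>R 1)) h) (cbox (c - r *\<^sub>R 1) (c + r *\<^sub>R 1))"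
    by (intro integrable_integral integrable_ucube assms)
  from has_integral_affinity'[OF this assms(2), of c]
  have "((\<lambda>w. h (c + r *\<^sub>R w)) has_integral
      integral (cbox (c - r *\<^sub>R 1) (c + r *\<^sub>R 1)) h /\<^sub>R r ^ CARD('n)) ucube"
    using assms(2) by (simp add: add.commute[of _ c])
  then show ?thesis by (simp add: integral_unique divide_inverse mult.commute)
qed

lemma abs_component_ucube:
  assumes "z \<in> ucube"
  shows "\<bar>z $ i\<bar> \<le> (1::real)"
proof -
  have "-1 \<le> z $ i \<and> z $ i \<le> 1" using assms by (simp add: mem_box_cart)
  then show ?thesis by linarith
qed

text \<open>A cube of half side r whose centre moves by at most r per coordinate stays in the cube
  of half side 2 r about \<open>x\<close>; the volume ratio is the constant.\<close>

lemma integral_ucube_shift_le: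
  fixes h :: "real^'n::finite \<Rightarrow> real"
  assumes "continuous_on UNIV h" "\<And>x. 0 \<le> h x" "z \<in> ucube" "0 \<le> s" "s \<le> r" "0 < r"
  shows "integral ucube (\<lambda>w. h (x + s *\<^sub>R z + r *\<^sub>R w)) \<le>
         2 ^ CARD('n) * integral ucube (\<lambda>w. h (x + (2 * r) *\<^sub>R w))"
proof -
  let ?c = "x + s *\<^sub>R z"
  have "\<bar>s * z $ i\<bar> \<le> r" for i
  proof -
    have "\<bar>z $ i\<bar> \<le> 1" by (rule abs_component_ucube[OF assms(3)])
    then have "\<bar>s * z $ i\<bar> \<le> s * 1" using assms(4) by (simp add: abs_mult mult_left_le)
    then show ?thesis using assms(5) by simp
  qed
  then have bd: "- r \<le> s * z $ i \<and> s * z $ i \<le> r" for i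
    by (simp add: abs_le_iff) (meson minus_le_iff)
  have "cbox (?c - r *\<^sub>R 1) (?c + r *\<^sub>R 1) \<subseteq> cbox (x - (2*r) *\<^sub>R 1) (x + (2*r) *\<^sub>R 1)"
  proof
    fix y assume y: "y \<in> cbox (?c - r *\<^sub>R 1) (?c + r *\<^sub>R 1)"
    have "x $ i - 2 * r \<le> y $ i \<and> y $ i \<le> x $ i + 2 * r" for i
    proof -
      have "x $ i + s * z $ i - r \<le> y $ i \<and> y $ i \<le> x $ i + s * z $ i + r"
        using y by (simp add: mem_box_cart)
      with bd[of i] show ?thesis by linarith
    qed
    then show "y \<in> cbox (x - (2*r) *\<^sub>R 1) (x + (2*r) *\<^sub>R 1)"
      by (simp add: mem_box_cart)
  qed
  then have "integral (cbox (?c - r *\<^sub>R 1) (?c + r *\<^sub>R 1)) h \<le>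
             integral (cbox (x - (2*r) *\<^sub>R 1) (x + (2*r) *\<^sub>R 1)) h"
    by (intro integral_subset_le integrable_ucube assms(1)) (use assms(2) in auto)
  then show ?thesis
    using assms(1,6) by (simp add: integral_ucube_scale power_mult_distrib divide_right_mono)
qed

lemma bump_sq: "bump 2 z = (bump 1 z)\<^sup>2"
  by (simp add: bump_def)

text \<open>The field \<open>bump 2\<close> times q \<nabla>q has compact support, so its divergence
  integrates to zero. Half of the gradient term absorbs the cross term from the cutoff. It is
  applied to \<eta> itself at large scales and to \<eta> minus an average at small ones.\<close>

lemma caccioppoli:
  fixes q :: "real^'n::finite \<Rightarrow> real" and q1 q2 :: "'n \<Rightarrow> real^'n \<Rightarrow> real"
  assumes pd: "\<And>i x. has_pd i q (q1 i x) x" "\<And>i x. has_pd i (q1 i) (q2 i x) x"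
    and cont: "continuous_on UNIV q" "\<And>i. continuous_on UNIV (q1 i)" "\<And>i. continuous_on UNIV (q2 i)"
    and r: "0 < r"
  shows "integral ucube (\<lambda>z. bump 2 z * (\<Sum>i\<in>UNIV. (q1 i (x + r *\<^sub>R z))\<^sup>2)) \<le>
     16 * CARD('n) / r\<^sup>2 * integral ucube (\<lambda>z. (q (x + r *\<^sub>R z))\<^sup>2)
     + 2 * integral ucube (\<lambda>z. \<bar>q (x + r *\<^sub>R z)\<bar> * \<bar>\<Sum>i\<in>UNIV. q2 i (x + r *\<^sub>R z)\<bar>)"
proof -
  note ci = continuous_on_affine_arg[OF cont(1)] continuous_on_affine_arg[OF cont(2)]
    continuous_on_affine_arg[OF cont(3)]
  let ?q = "\<lambda>z. q (x + r *\<^sub>R z)" and ?q1 = "\<lambda>i z. q1 i (x + r *\<^sub>R z)" and ?q2 = "\<lambda>i z. q2 i (x + r *\<^sub>R z)"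
  define G' where "G' i z = (- (2 * real (Suc 1)) * (z $ i * bump 1 z)) * (?q z * ?q1 i z)
     + (r * ?q1 i z * ?q1 i z + r * ?q2 i z * ?q z) * bump (Suc 1) z" for i z
  have pdG: "has_pd i (\<lambda>z. bump (Suc 1) z * (?q z * ?q1 i z)) (G' i z) z" for i z
    unfolding G'_def by (intro has_pd_mult has_pd_affine pd has_pd_bump) simp
  have cG': "continuous_on UNIV (G' i)" for i
    unfolding G'_def by (intro continuous_intros ci)
  have "integral ucube (G' i) = 0" for i
    by (rule integral_pd_eq_0[OF pdG]) (auto intro!: continuous_intros ci cG' simp: bump_zero)
  then have I0: "integral ucube (\<lambda>z. \<Sum>i\<in>UNIV. G' i z) = 0"
    by (simp add: integral_sum integrable_ucube cG')
  define E where "E z = \<bar>?q z\<bar> * \<bar>\<Sum>i\<in>UNIV. ?q2 i z\<bar>" for z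
  have "integral ucube (\<lambda>z. r / 2 * (bump 2 z * (\<Sum>i\<in>UNIV. (?q1 i z)\<^sup>2))) \<le>
     integral ucube (\<lambda>z. (\<Sum>i\<in>UNIV. G' i z) + (8 * CARD('n) / r * (?q z)\<^sup>2 + r * E z))"
  proof (rule integral_le)
    fix z :: "real^'n" assume z: "z \<in> ucube"
    have t: "r / 2 * (bump 2 z * (?q1 i z)\<^sup>2) \<le> G' i z + 8 / r * (?q z)\<^sup>2 - r * bump 2 z * ?q z * ?q2 i z" for i
    proof -
      let ?b = "bump 1 z"
      have "(z $ i)\<^sup>2 \<le> 1" using abs_component_ucube[OF z, of i] by (simp add: abs_square_le_1)
      then have "8 / r * (z $ i)\<^sup>2 * (?q z)\<^sup>2 \<le> 8 / r * 1 * (?q z)\<^sup>2"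
        using r by (intro mult_right_mono mult_left_mono) auto
      \<comment> \<open>The square is completed so that its mixed term is exactly the cross term 4
        z_i b q q_i of \<open>G'\<close>; this produces the weight 8 / r.\<close>
      moreover have "0 \<le> (r / 2) * (?b * ?q1 i z - 4 / r * z $ i * ?q z)\<^sup>2"
        using r by simp
      moreover have "(r / 2) * (?b * ?q1 i z - 4 / r * z $ i * ?q z)\<^sup>2 =
          r / 2 * (?b\<^sup>2 * (?q1 i z)\<^sup>2) + 8 / r * (z $ i)\<^sup>2 * (?q z)\<^sup>2 - 4 * z $ i * ?b * ?q z * ?q1 i z"
        using r by (simp add: field_simps power2_eq_square)
      ultimately show ?thesis
        unfolding G'_def bump_sq[symmetric]
        by (simp add: algebra_simps power2_eq_square numeral_2_eq_2[symmetric])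
    qed
    have "- (r * bump 2 z * ?q z * (\<Sum>i\<in>UNIV. ?q2 i z)) \<le> r * E z"
    proof -
      have "- (r * bump 2 z * ?q z * (\<Sum>i\<in>UNIV. ?q2 i z)) \<le> r * (bump 2 z * E z)"
        using abs_ge_minus_self[of "r * bump 2 z * ?q z * (\<Sum>i\<in>UNIV. ?q2 i z)"] r bump_nonneg[of 2 z]
        by (simp add: E_def abs_mult)
      also have "\<dots> \<le> r * (1 * E z)"
        using r by (intro mult_left_mono mult_right_mono bump_le_1) (auto simp: E_def)
      finally show ?thesis by simp
    qed
    moreover have "r / 2 * (bump 2 z * (\<Sum>i\<in>UNIV. (?q1 i z)\<^sup>2)) \<le>
       (\<Sum>i\<in>UNIV. G' i z + 8 / r * (?q z)\<^sup>2 - r * bump 2 z * ?q z * ?q2 i z)"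
      unfolding sum_distrib_left by (intro sum_mono t)
    ultimately show "r / 2 * (bump 2 z * (\<Sum>i\<in>UNIV. (?q1 i z)\<^sup>2)) \<le>
       (\<Sum>i\<in>UNIV. G' i z) + (8 * CARD('n) / r * (?q z)\<^sup>2 + r * E z)"
      by (simp add: sum.distrib sum_subtractf sum_distrib_left algebra_simps)
  qed (use r in \<open>auto simp: E_def intro!: integrable_ucube continuous_intros ci cG'\<close>)
  also have "\<dots> = integral ucube (\<lambda>z. \<Sum>i\<in>UNIV. G' i z) +
      (integral ucube (\<lambda>z. 8 * CARD('n) / r * (?q z)\<^sup>2) + integral ucube (\<lambda>z. r * E z))"
  proof -
    have c: "continuous_on UNIV (\<lambda>z. \<Sum>i\<in>UNIV. G' i z)" "continuous_on UNIV (\<lambda>z. 8 * CARD('n) / r * (?q z)\<^sup>2)"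
      "continuous_on UNIV (\<lambda>z. r * E z)"
      unfolding E_def by (intro continuous_intros ci cG')+
    show ?thesis
      unfolding integral_add[OF integrable_ucube[OF c(1)] integrable_ucube[OF continuous_on_add[OF c(2,3)]]]
        integral_add[OF c(2,3)[THEN integrable_ucube]] ..
  qed
  finally have "r / 2 * integral ucube (\<lambda>z. bump 2 z * (\<Sum>i\<in>UNIV. (?q1 i z)\<^sup>2)) \<le>
      8 * CARD('n) / r * integral ucube (\<lambda>z. (?q z)\<^sup>2) + r * integral ucube E"
    unfolding I0 integral_mult_right by simp
  then show ?thesis using r unfolding E_def[abs_def] by (simp add: field_simps power2_eq_square)
qed

section \<open>Averages of a test function as functions of position and scale\<close>

lemma has_pd_integral:
  fixes h h' k :: "real^'n::finite \<Rightarrow> real"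
  assumes "\<And>x. has_pd i h (h' x) x" "continuous_on UNIV h" "continuous_on UNIV h'" "continuous_on UNIV k"
  shows "has_pd i (\<lambda>y. integral (cbox a b) (\<lambda>z. k z * h (y + r *\<^sub>R z)))
     (integral (cbox a b) (\<lambda>z. k z * h' (y + r *\<^sub>R z))) y"
proof -
  note ci = continuous_on_affine_arg[OF assms(2)] continuous_on_affine_arg[OF assms(3)]
    continuous_on_compose2[OF assms(4)]
  have "((\<lambda>t. integral (cbox a b) (\<lambda>z. k z * h ((y + t *\<^sub>R axis i 1) + r *\<^sub>R z))) has_real_derivative
      integral (cbox a b) (\<lambda>z. k z * h' ((y + 0 *\<^sub>R axis i 1) + r *\<^sub>R z))) (at 0 within UNIV)"
  proof (rule leibniz_rule_field_derivative)
    show "((\<lambda>t. k z * h ((y + t *\<^sub>R axis i 1) + r *\<^sub>R z)) has_real_derivative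
        k z * h' ((y + t *\<^sub>R axis i 1) + r *\<^sub>R z)) (at t within UNIV)" for t z
      using has_pd_line[OF assms(1), of "y + r *\<^sub>R z" t, THEN DERIV_cmult, of "k z"]
      by (simp add: algebra_simps)
    show "continuous_on (UNIV \<times> cbox a b) (\<lambda>(t, z). k z * h' ((y + t *\<^sub>R axis i 1) + r *\<^sub>R z))"
      unfolding split_def by (intro continuous_intros ci) auto
  qed (auto intro!: integrable_ucube continuous_intros ci)
  then show ?thesis by (simp add: has_pd_def)
qed

text \<open>Second derivatives enter through the Laplacian, hence the pure ones \<open>d i\<close>.
  Total differentiability is asked of \<eta> because its averages are differentiated in the scale,
  that is, along arbitrary directions \<open>z\<close>.\<close>

locale C2_function =
  fixes \<eta> :: "real^'n::finite \<Rightarrow> real" and e d :: "'n \<Rightarrow> real^'n \<Rightarrow> real"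
  assumes der: "\<And>x. (\<eta> has_derivative (\<lambda>h. \<Sum>i\<in>UNIV. h $ i * e i x)) (at x)"
    and pd_e: "\<And>i x. has_pd i (e i) (d i x) x"
    and cont_e: "\<And>i. continuous_on UNIV (e i)" and cont_d: "\<And>i. continuous_on UNIV (d i)"
begin

abbreviation "lap x \<equiv> \<Sum>i\<in>UNIV. d i x"

lemma cont_\<eta>: "continuous_on UNIV \<eta>"
  by (rule has_derivative_continuous_on[OF has_derivative_at_withinI[OF der]])

lemma cont_lap: "continuous_on UNIV (\<lambda>x. lap x)"
  by (intro continuous_intros cont_d)

lemma deriv_line: "((\<lambda>s. \<eta> (y + s *\<^sub>R z)) has_real_derivative (\<Sum>i\<in>UNIV. z $ i * e i (y + s *\<^sub>R z))) (at s)"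
proof -
  have "((\<lambda>s. \<eta> (y + s *\<^sub>R z)) has_derivative
      (\<lambda>t. \<Sum>i\<in>UNIV. (t *\<^sub>R z) $ i * e i (y + s *\<^sub>R z))) (at s)"
    by (rule has_derivative_compose[OF _ der]) (auto intro!: derivative_eq_intros)
  moreover have "(\<lambda>t. \<Sum>i\<in>UNIV. (t *\<^sub>R z) $ i * e i (y + s *\<^sub>R z)) = (*) (\<Sum>i\<in>UNIV. z $ i * e i (y + s *\<^sub>R z))"
    by (rule ext) (simp add: sum_distrib_left mult_ac)
  ultimately show ?thesis
    by (simp only: has_field_derivative_def)
qed

lemma pd_\<eta>: "has_pd i \<eta> (e i x) x"
proof -
  have "(\<Sum>j\<in>UNIV. axis i 1 $ j * e j x) = (\<Sum>j\<in>UNIV. if j = i then e j x else 0)"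
    by (rule sum.cong) (auto simp: axis_def)
  then show ?thesis using deriv_line[of x "axis i 1" 0] by (simp add: has_pd_def)
qed

lemmas ci = continuous_on_affine_arg[OF cont_\<eta>] continuous_on_affine_arg[OF cont_e]
  continuous_on_affine_arg[OF cont_d] continuous_on_affine_arg[OF cont_lap]

lemma deriv_scale:
  assumes "continuous_on UNIV k"
  shows "((\<lambda>s. integral ucube (\<lambda>z. k z * \<eta> (y + s *\<^sub>R z))) has_real_derivative
     integral ucube (\<lambda>z. k z * (\<Sum>i\<in>UNIV. z $ i * e i (y + s *\<^sub>R z)))) (at s)"
proof -
  note ck = continuous_on_compose2[OF assms]
  have "((\<lambda>s. integral ucube (\<lambda>z. k z * \<eta> (y + s *\<^sub>R z))) has_real_derivative
     integral ucube (\<lambda>z. k z * (\<Sum>i\<in>UNIV. z $ i * e i (y + s *\<^sub>R z)))) (at s within UNIV)"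
  proof (rule leibniz_rule_field_derivative)
    show "((\<lambda>s. k z * \<eta> (y + s *\<^sub>R z)) has_real_derivative
        k z * (\<Sum>i\<in>UNIV. z $ i * e i (y + s *\<^sub>R z))) (at s within UNIV)" for s z
      using DERIV_cmult[OF deriv_line] by simp
    show "continuous_on (UNIV \<times> ucube) (\<lambda>(s, z). k z * (\<Sum>i\<in>UNIV. z $ i * e i (y + s *\<^sub>R z)))"
      unfolding split_def by (intro continuous_intros ci ck) auto
  qed (auto intro!: integrable_ucube continuous_intros ci ck)
  then show ?thesis by simp
qed

text \<open>Differentiating in the scale gives z \<bullet> \<nabla>\<eta> against
  \<open>bump 2\<close>. Since z times \<open>bump 2\<close> is -1/6 of the gradient of
  \<open>bump 3\<close>, one integration by parts turns this into the Laplacian, with an extra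
  factor \<open>s\<close>.\<close>

lemma deriv_mollified:
  "((\<lambda>s. integral ucube (\<lambda>z. bump 2 z * \<eta> (y + s *\<^sub>R z))) has_real_derivative
     s / 6 * integral ucube (\<lambda>z. bump 3 z * lap (y + s *\<^sub>R z))) (at s)"
proof -
  let ?G' = "\<lambda>i z. (- (2 * real (Suc 2)) * (z $ i * bump 2 z)) * e i (y + s *\<^sub>R z)
      + (s * d i (y + s *\<^sub>R z)) * bump (Suc 2) z"
  have "integral ucube (?G' i) = 0" for i
    by (rule integral_pd_eq_0[where i = i and G = "\<lambda>z. bump (Suc 2) z * e i (y + s *\<^sub>R z)"],
        intro has_pd_mult has_pd_affine pd_e has_pd_bump)
       (auto intro!: continuous_intros ci simp: bump_zero)
  then have "(\<Sum>i\<in>UNIV. integral ucube (?G' i)) = 0" by simp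
  then have "integral ucube (\<lambda>z. \<Sum>i\<in>UNIV. ?G' i z) = 0"
    by (subst integral_sum) (auto intro!: integrable_ucube continuous_intros ci)
  also have "(\<lambda>z. \<Sum>i\<in>UNIV. ?G' i z) = (\<lambda>z. s * (bump 3 z * lap (y + s *\<^sub>R z))
      - 6 * (bump 2 z * (\<Sum>i\<in>UNIV. z $ i * e i (y + s *\<^sub>R z))))"
    by (auto simp: sum.distrib sum_distrib_left sum_negf algebra_simps numeral_3_eq_3 numeral_2_eq_2
        sum_subtractf)
  finally have "s * integral ucube (\<lambda>z. bump 3 z * lap (y + s *\<^sub>R z))
      = 6 * integral ucube (\<lambda>z. bump 2 z * (\<Sum>i\<in>UNIV. z $ i * e i (y + s *\<^sub>R z)))"
    by (subst (asm) integral_diff) (auto intro!: integrable_ucube continuous_intros ci)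
  with deriv_scale[of "bump 2" y s] show ?thesis by (simp add: continuous_on_bump)
qed

text \<open>Identifies the averaged gradient with 4 / s times an integral of \<eta> itself. The
  latter is bounded because \<eta> is, which gives the size 1 / s at scale s.\<close>

lemma integral_bump_e:
  "s * integral ucube (\<lambda>z. bump 2 z * e i (y + s *\<^sub>R z)) =
     4 * integral ucube (\<lambda>z. z $ i * bump 1 z * \<eta> (y + s *\<^sub>R z))"
proof -
  let ?G' = "\<lambda>z. (- (2 * real (Suc 1)) * (z $ i * bump 1 z)) * \<eta> (y + s *\<^sub>R z)
      + (s * e i (y + s *\<^sub>R z)) * bump (Suc 1) z"
  have "integral ucube ?G' = 0"
    by (rule integral_pd_eq_0[where i = i and G = "\<lambda>z. bump (Suc 1) z * \<eta> (y + s *\<^sub>R z)"],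
        intro has_pd_mult has_pd_affine pd_\<eta> has_pd_bump)
       (auto intro!: continuous_intros ci simp: bump_zero)
  also have "?G' = (\<lambda>z. s * (bump 2 z * e i (y + s *\<^sub>R z)) - 4 * (z $ i * bump 1 z * \<eta> (y + s *\<^sub>R z)))"
    by (auto simp: algebra_simps numeral_2_eq_2)
  finally show ?thesis
    by (subst (asm) integral_diff) (auto intro!: integrable_ucube continuous_intros ci)
qed

text \<open>Up to a factor 4 the quotient is the averaged gradient, whose scale derivative would
  naively contain mixed second derivatives. Testing the field \<nabla>\<eta> with
  \<open>z $ i * bump 2 z\<close> instead leaves the Laplacian and one term in \<open>e i\<close>;
  by \<open>integral_bump_e\<close> the latter cancels against the derivative of 1 / s.\<close>

lemma deriv_mollified_gradient:
  assumes "s \<noteq> 0"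
  shows "((\<lambda>s. integral ucube (\<lambda>z. z $ i * bump 1 z * \<eta> (y + s *\<^sub>R z)) / s) has_real_derivative
     integral ucube (\<lambda>z. z $ i * bump 2 z * lap (y + s *\<^sub>R z)) / 4) (at s)"
proof -
  let ?N = "\<lambda>s. integral ucube (\<lambda>z. z $ i * bump 1 z * \<eta> (y + s *\<^sub>R z))"
  let ?N' = "integral ucube (\<lambda>z. z $ i * bump 1 z * (\<Sum>j\<in>UNIV. z $ j * e j (y + s *\<^sub>R z)))"
  let ?D = "\<lambda>j z. ((if j = i then 1 else 0) * bump (Suc 1) z + (- (2 * real (Suc 1)) * (z $ j * bump 1 z)) * z $ i)"
  let ?G' = "\<lambda>j z. ?D j z * e j (y + s *\<^sub>R z) + (s * d j (y + s *\<^sub>R z)) * (z $ i * bump (Suc 1) z)"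
  have "integral ucube (?G' j) = 0" for j
    by (rule integral_pd_eq_0[where i = j and G = "\<lambda>z. (z $ i * bump (Suc 1) z) * e j (y + s *\<^sub>R z)"],
        intro has_pd_mult has_pd_affine pd_e has_pd_bump has_pd_component)
       (auto intro!: continuous_intros ci simp: bump_zero)
  then have "(\<Sum>j\<in>UNIV. integral ucube (?G' j)) = 0" by simp
  then have "integral ucube (\<lambda>z. \<Sum>j\<in>UNIV. ?G' j z) = 0"
    by (subst integral_sum) (auto intro!: integrable_ucube continuous_intros ci)
  also have "(\<lambda>z. \<Sum>j\<in>UNIV. ?G' j z) = (\<lambda>z. (s * (z $ i * bump 2 z * lap (y + s *\<^sub>R z)) + bump 2 z * e i (y + s *\<^sub>R z))
      - 4 * (z $ i * bump 1 z * (\<Sum>j\<in>UNIV. z $ j * e j (y + s *\<^sub>R z))))"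
  proof
    fix z
    have "(\<Sum>j\<in>UNIV. (if j = i then 1 else 0) * bump (Suc 1) z * e j (y + s *\<^sub>R z)) = bump 2 z * e i (y + s *\<^sub>R z)"
    proof -
      have "(\<Sum>j\<in>UNIV. (if j = i then 1 else 0) * bump (Suc 1) z * e j (y + s *\<^sub>R z)) =
          (\<Sum>j\<in>UNIV. if j = i then bump 2 z * e j (y + s *\<^sub>R z) else 0)"
        by (rule sum.cong) (auto simp: numeral_2_eq_2)
      then show ?thesis by simp
    qed
    moreover have "?G' j z = (if j = i then 1 else 0) * bump (Suc 1) z * e j (y + s *\<^sub>R z)
        + (s * z $ i * bump 2 z) * d j (y + s *\<^sub>R z) - (4 * z $ i * bump 1 z) * (z $ j * e j (y + s *\<^sub>R z))" for j
      by (simp add: algebra_simps numeral_2_eq_2)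
    ultimately show "(\<Sum>j\<in>UNIV. ?G' j z) = (s * (z $ i * bump 2 z * lap (y + s *\<^sub>R z)) + bump 2 z * e i (y + s *\<^sub>R z))
      - 4 * (z $ i * bump 1 z * (\<Sum>j\<in>UNIV. z $ j * e j (y + s *\<^sub>R z)))"
      by (simp only: sum.distrib sum_subtractf sum_distrib_left[symmetric])
  qed
  finally have "s * integral ucube (\<lambda>z. z $ i * bump 2 z * lap (y + s *\<^sub>R z))
      + integral ucube (\<lambda>z. bump 2 z * e i (y + s *\<^sub>R z)) = 4 * ?N'"
  proof -
    assume *: "integral ucube (\<lambda>z. (s * (z $ i * bump 2 z * lap (y + s *\<^sub>R z)) + bump 2 z * e i (y + s *\<^sub>R z))
      - 4 * (z $ i * bump 1 z * (\<Sum>j\<in>UNIV. z $ j * e j (y + s *\<^sub>R z)))) = 0"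
    have c: "continuous_on UNIV (\<lambda>z. s * (z $ i * bump 2 z * lap (y + s *\<^sub>R z)))"
      "continuous_on UNIV (\<lambda>z. bump 2 z * e i (y + s *\<^sub>R z))"
      "continuous_on UNIV (\<lambda>z. 4 * (z $ i * bump 1 z * (\<Sum>j\<in>UNIV. z $ j * e j (y + s *\<^sub>R z))))"
      by (intro continuous_intros ci)+
    show ?thesis
      using * unfolding integral_diff[OF integrable_ucube[OF continuous_on_add[OF c(1,2)]] integrable_ucube[OF c(3)]]
        integral_add[OF c(1,2)[THEN integrable_ucube]] integral_mult_right by linarith
  qed
  note 1 = this
  have 2: "integral ucube (\<lambda>z. bump 2 z * e i (y + s *\<^sub>R z)) = 4 * ?N s / s"
    by (rule eq_divide_imp[OF assms], subst mult.commute, rule integral_bump_e)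
  have "C = (A + D) / 4" if "A + B = 4 * C" "B = D" for A B C D :: real
    using that by simp
  from this[OF 1 2]
  have N': "?N' = (s * integral ucube (\<lambda>z. z $ i * bump 2 z * lap (y + s *\<^sub>R z)) + 4 * ?N s / s) / 4" .
  have "(?N has_real_derivative ?N') (at s)"
    by (rule deriv_scale) (intro continuous_intros)
  then have "((\<lambda>s. ?N s / s) has_real_derivative (?N' * s - ?N s * 1) / (s * s)) (at s)"
    using assms by (intro DERIV_divide DERIV_ident)
  moreover have "((s * X + 4 * N / s) / 4 * s - N * 1) / (s * s) = X / 4" for X N :: real
    using assms by (simp add: field_simps)
  ultimately show ?thesis unfolding N' by (simp only:)
qed

end

lemma abs_integral_le:
  fixes f g :: "'a::euclidean_space \<Rightarrow> real"
  assumes "f integrable_on S" "g integrable_on S" "\<And>x. x \<in> S \<Longrightarrow> \<bar>f x\<bar> \<le> g x"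
  shows "\<bar>integral S f\<bar> \<le> integral S g"
  using Henstock_Kurzweil_Integration.integral_norm_bound_integral[OF assms(1,2)] assms(3)
  by simp

lemma bump_mass_pos: "0 < integral (ucube :: (real^'n::finite) set) (bump 2)"
proof -
  have i: "(bump 2 :: real^'n \<Rightarrow> real) integrable_on ucube"
    by (intro integrable_ucube continuous_intros)
  have "integral (ucube :: (real^'n) set) (bump 2) \<noteq> 0"
  proof
    assume "integral (ucube :: (real^'n) set) (bump 2) = 0"
    then have 0: "(bump 2 has_integral 0) (ucube :: (real^'n) set)"
      using integrable_integral[OF i] by simp
    have "(0 :: real^'n) \<in> box (-1) 1" by (simp add: mem_box_cart)
    then have "box (-1) (1 :: real^'n) \<noteq> {}" "(0 :: real^'n) \<in> cbox (-1) 1"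
      using box_subset_cbox by auto
    then have "bump 2 (0 :: real^'n) = 0"
      by (intro has_integral_0_cbox_imp_0[OF _ _ 0]) (auto intro: continuous_intros bump_nonneg)
    then show False by (simp add: bump_def)
  qed
  moreover have "0 \<le> integral (ucube :: (real^'n) set) (bump 2)"
    by (intro integral_nonneg i) (simp add: bump_nonneg)
  ultimately show ?thesis by simp
qed

section \<open>Gradient averages bounded by Laplacian averages\<close>

context C2_function
begin

lemma continuous_on_ucube_integral:
  fixes h k :: "real^'n \<Rightarrow> real"
  assumes "continuous_on UNIV k" "continuous_on UNIV h"
  shows "continuous_on S (\<lambda>y. integral ucube (\<lambda>z. k z * h (y + r *\<^sub>R z)))"
  by (rule integral_continuous_on_param, unfold split_def)
     (intro continuous_on_mult continuous_on_compose2[OF assms(1)] continuous_on_affine_arg[OF assms(2)]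
        continuous_intros subset_UNIV)

text \<open>Here \<open>a\<close> is a finite positive stand-in, up to a dimensional factor, for the
  maximal function of the Laplacian at the fixed point \<open>x\<close>. Positivity makes the
  critical scale 1 / sqrt a meaningful.\<close>

context
  fixes a :: real and x :: "real^'n"
  assumes \<eta>: "\<And>x. 0 \<le> \<eta> x" "\<And>x. \<eta> x \<le> 1"
    and a: "0 < a" "\<And>s. 0 < s \<Longrightarrow> integral ucube (\<lambda>z. \<bar>lap (x + s *\<^sub>R z)\<bar>) \<le> a"
begin

lemma cont_abs_lap: "continuous_on UNIV (\<lambda>y. \<bar>lap y\<bar>)"
  by (intro continuous_intros cont_lap)

lemma abs_lap_shift_le:
  assumes "z \<in> ucube" "0 \<le> s" "s \<le> r" "0 < r"
  shows "integral ucube (\<lambda>w. \<bar>lap (x + s *\<^sub>R z + r *\<^sub>R w)\<bar>) \<le> 2 ^ CARD('n) * a"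
proof -
  have "integral ucube (\<lambda>w. \<bar>lap (x + s *\<^sub>R z + r *\<^sub>R w)\<bar>) \<le>
      2 ^ CARD('n) * integral ucube (\<lambda>w. \<bar>lap (x + (2 * r) *\<^sub>R w)\<bar>)"
    by (rule integral_ucube_shift_le[OF cont_abs_lap]) (use assms in auto)
  also have "\<dots> \<le> 2 ^ CARD('n) * a"
    using a(2)[of "2 * r"] assms(4) by simp
  finally show ?thesis .
qed

text \<open>The inner scale \<open>s\<close> may be far smaller than the distance from
  \<open>x\<close> to the inner centre, so a single inner integral is not controlled by
  \<open>a\<close>. After exchanging the integrals, \<open>r\<close> becomes the averaging scale and
  the shift by \<open>s *\<^sub>R z\<close> is harmless.\<close>

lemma abs_lap_double_le:
  assumes "0 \<le> s" "s \<le> r" "0 < r"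
  shows "integral ucube (\<lambda>w. integral ucube (\<lambda>z. \<bar>lap (x + r *\<^sub>R w + s *\<^sub>R z)\<bar>)) \<le> (2 ^ CARD('n))\<^sup>2 * a"
proof -
  have "integral ucube (\<lambda>w. integral ucube (\<lambda>z. \<bar>lap (x + r *\<^sub>R w + s *\<^sub>R z)\<bar>)) =
      integral ucube (\<lambda>z. integral ucube (\<lambda>w. \<bar>lap (x + r *\<^sub>R w + s *\<^sub>R z)\<bar>))"
    by (rule integral_swap_continuous, unfold split_def)
       (intro continuous_on_affine_arg[OF cont_abs_lap] continuous_intros)
  also have "\<dots> \<le> integral ucube (\<lambda>z :: real^'n. 2 ^ CARD('n) * a)"
  proof (rule integral_le)
    have "continuous_on UNIV (\<lambda>z. integral ucube (\<lambda>w. 1 * \<bar>lap (x + r *\<^sub>R w + s *\<^sub>R z)\<bar>))"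
      by (rule integral_continuous_on_param, unfold split_def)
         (intro continuous_on_affine_arg[OF cont_abs_lap] continuous_intros)
    then show "(\<lambda>z. integral ucube (\<lambda>w. \<bar>lap (x + r *\<^sub>R w + s *\<^sub>R z)\<bar>)) integrable_on ucube"
      by (intro integrable_ucube) simp
    show "integral ucube (\<lambda>w. \<bar>lap (x + r *\<^sub>R w + s *\<^sub>R z)\<bar>) \<le> 2 ^ CARD('n) * a" if "z \<in> ucube" for z
      using abs_lap_shift_le[OF that assms] by (simp add: algebra_simps)
  qed (intro integrable_ucube continuous_intros)
  also have "\<dots> = (2 ^ CARD('n))\<^sup>2 * a"
    by (subst integral_ucube_const) (simp add: power2_eq_square)
  finally show ?thesis .
qed

text \<open>Up to the factor \<open>4 / \<kappa>\<close>, the quotient \<open>Q s\<close> is the \<open>i\<close>-th derivative of the average of \<open>\<eta>\<close> at scale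
  \<open>s\<close>. It is at most a constant times \<open>1 / R\<close> at the scale \<open>R = 1 / sqrt a\<close>, and between the scales
  \<open>r\<close> and \<open>R\<close> it moves at speed at most a constant times \<open>a\<close>.\<close>

lemma mollified_gradient_le:
  assumes w: "w \<in> ucube" and r: "0 < r" "r\<^sup>2 * a < 1"
  shows "\<bar>integral ucube (\<lambda>z. bump 2 z * e i (x + r *\<^sub>R w + r *\<^sub>R z))\<bar> \<le> 8 * 2 ^ CARD('n) * sqrt a"
proof -
  let ?v = "2 ^ CARD('n) :: real"
  let ?y = "x + r *\<^sub>R w"
  \<comment> \<open>Balances the size 1 / R at the upper scale against the change R a on the way
    down to \<open>r\<close>; each contributes 2^N sqrt a.\<close>
  define R where "R = 1 / sqrt a"
  define Q where "Q s = integral ucube (\<lambda>z. z $ i * bump 1 z * \<eta> (?y + s *\<^sub>R z)) / s" for s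
  define Q' where "Q' s = integral ucube (\<lambda>z. z $ i * bump 2 z * lap (?y + s *\<^sub>R z)) / 4" for s
  have "r < R"
  proof -
    have "(r * sqrt a)\<^sup>2 < 1\<^sup>2" using r a by (simp add: power_mult_distrib)
    then have "r * sqrt a < 1" by (rule power_less_imp_less_base) simp
    then show ?thesis using a by (simp add: R_def field_simps)
  qed
  have "\<exists>\<xi>. r < \<xi> \<and> \<xi> < R \<and> Q R - Q r = (R - r) * Q' \<xi>"
    by (rule MVT2[OF \<open>r < R\<close>], unfold Q_def Q'_def, rule deriv_mollified_gradient) (use r in linarith)
  then obtain \<xi> where \<xi>: "r < \<xi>" "\<xi> < R" "Q R - Q r = (R - r) * Q' \<xi>" by blast
  have zb: "\<bar>z $ i * bump k z\<bar> \<le> 1" if "z \<in> ucube" for z :: "real^'n" and k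
    using mult_mono[OF abs_component_ucube[OF that] bump_le_1] by (simp add: abs_mult bump_nonneg)
  have "4 * \<bar>Q' \<xi>\<bar> \<le> integral ucube (\<lambda>z. \<bar>lap (?y + \<xi> *\<^sub>R z)\<bar>)"
  proof -
    have "\<bar>integral ucube (\<lambda>z. z $ i * bump 2 z * lap (?y + \<xi> *\<^sub>R z))\<bar> \<le> integral ucube (\<lambda>z. \<bar>lap (?y + \<xi> *\<^sub>R z)\<bar>)"
    proof (rule abs_integral_le)
      show "\<bar>z $ i * bump 2 z * lap (?y + \<xi> *\<^sub>R z)\<bar> \<le> \<bar>lap (?y + \<xi> *\<^sub>R z)\<bar>" if "z \<in> ucube" for z
        using mult_right_mono[OF zb[OF that, of 2]] by (simp add: abs_mult[of "_ * _" "lap _"])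
    qed (intro integrable_ucube continuous_intros ci)+
    then show ?thesis by (simp add: Q'_def)
  qed
  also have "\<dots> \<le> ?v * a"
    using abs_lap_shift_le[OF w _ less_imp_le[OF \<xi>(1)]] r \<xi>(1) by simp
  finally have Q': "4 * \<bar>Q' \<xi>\<bar> \<le> ?v * a" .
  have Rpos: "0 < R" using a by (simp add: R_def)
  have "\<bar>integral ucube (\<lambda>z. z $ i * bump 1 z * \<eta> (?y + R *\<^sub>R z))\<bar> \<le> integral ucube (\<lambda>z :: real^'n. 1)"
  proof (rule abs_integral_le)
    show "\<bar>z $ i * bump 1 z * \<eta> (?y + R *\<^sub>R z)\<bar> \<le> 1" if "z \<in> ucube" for z
    proof -
      have "\<bar>z $ i * bump 1 z\<bar> * \<bar>\<eta> (?y + R *\<^sub>R z)\<bar> \<le> 1 * 1"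
        using \<eta> by (intro mult_mono zb[OF that]) auto
      then show ?thesis by (simp add: abs_mult)
    qed
  qed (intro integrable_ucube continuous_intros ci)+
  then have "\<bar>integral ucube (\<lambda>z. z $ i * bump 1 z * \<eta> (?y + R *\<^sub>R z))\<bar> \<le> ?v"
    by (simp only: integral_ucube_const)
  then have QR: "\<bar>Q R\<bar> \<le> ?v * sqrt a"
    using a mult_right_mono[of _ "?v" "sqrt a"] unfolding Q_def R_def by (simp add: abs_mult)
  have "\<bar>(R - r) * Q' \<xi>\<bar> \<le> R * (?v * a)"
    unfolding abs_mult using \<open>r < R\<close> r Q' by (intro mult_mono) auto
  also have "\<dots> = ?v * (a / sqrt a)"
    by (simp add: R_def)
  also have "\<dots> = ?v * sqrt a"
    using a by (simp add: real_div_sqrt)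
  finally have "\<bar>Q r\<bar> \<le> 2 * (?v * sqrt a)"
    using QR \<xi>(3) by linarith
  moreover have "integral ucube (\<lambda>z. bump 2 z * e i (?y + r *\<^sub>R z)) = 4 * Q r"
    using integral_bump_e[of r i ?y] r by (simp add: Q_def field_simps)
  ultimately show ?thesis by simp
qed

text \<open>Above the critical scale 1 / r^2 is at most \<open>a\<close>, so the Caccioppoli
  inequality for \<eta> itself suffices, using |\<eta>| \<le> 1 in both of its terms.\<close>

lemma gradient_le_large:
  assumes r: "0 < r" "1 \<le> r\<^sup>2 * a"
  shows "integral ucube (\<lambda>z. bump 2 z * (\<Sum>i\<in>UNIV. (e i (x + r *\<^sub>R z))\<^sup>2)) \<le>
     (16 * real CARD('n) * 2 ^ CARD('n) + 2) * a"
proof -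
  let ?n = "real CARD('n)" and ?v = "2 ^ CARD('n) :: real"
  have "integral ucube (\<lambda>z. (\<eta> (x + r *\<^sub>R z))\<^sup>2) \<le> integral ucube (\<lambda>z :: real^'n. 1)"
    by (intro integral_le integrable_ucube continuous_intros ci)
       (use \<eta> in \<open>simp add: abs_square_le_1\<close>)
  then have "integral ucube (\<lambda>z. (\<eta> (x + r *\<^sub>R z))\<^sup>2) \<le> ?v"
    by (simp only: integral_ucube_const)
  moreover have "16 * ?n / r\<^sup>2 \<le> 16 * ?n * a"
    using mult_left_mono[OF r(2), of "16 * ?n"] r(1) by (simp add: divide_le_eq mult_ac)
  ultimately have "16 * ?n / r\<^sup>2 * integral ucube (\<lambda>z. (\<eta> (x + r *\<^sub>R z))\<^sup>2) \<le> 16 * ?n * a * ?v"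
    using a by (intro mult_mono integral_nonneg integrable_ucube continuous_intros ci) auto
  moreover have "integral ucube (\<lambda>z. \<bar>\<eta> (x + r *\<^sub>R z)\<bar> * \<bar>lap (x + r *\<^sub>R z)\<bar>) \<le>
      integral ucube (\<lambda>z. \<bar>lap (x + r *\<^sub>R z)\<bar>)"
    by (intro integral_le integrable_ucube continuous_intros ci)
       (use \<eta> in \<open>simp add: mult_left_le_one_le\<close>)
  ultimately show ?thesis
    using caccioppoli[OF pd_\<eta> pd_e cont_\<eta> cont_e cont_d r(1), of x] a(2)[OF r(1)]
    by (simp add: algebra_simps)
qed

text \<open>Split \<open>\<eta>\<close> into its average \<open>M r\<close> at scale \<open>r\<close> and the rest \<open>p\<close>. Since \<open>\<bar>p\<bar> \<le> 1\<close>, the Caccioppoli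
  inequality controls the gradient of \<open>p\<close> as soon as the mean of \<open>p\<^sup>2\<close> is at most a constant times
  \<open>r\<^sup>2 a\<close>. That mean equals \<open>\<Theta> 0 - \<Theta> r\<close>, where \<open>\<Theta> s\<close> pairs \<open>p\<close> with \<open>M s\<close>.\<close>

lemma gradient_le_small:
  assumes r: "0 < r" "r\<^sup>2 * a < 1"
  defines "n \<equiv> real CARD('n)" and "v \<equiv> 2 ^ CARD('n) :: real" and "\<kappa> \<equiv> integral (ucube :: (real^'n) set) (bump 2)"
  shows "integral ucube (\<lambda>z. bump 2 z * (\<Sum>i\<in>UNIV. (e i (x + r *\<^sub>R z))\<^sup>2)) \<le>
     (128 * n * v ^ 3 / \<kappa>\<^sup>2 + 16 * n * v\<^sup>2 / \<kappa> + 4 + 4 * v\<^sup>2 / \<kappa>) * a"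
proof -
  have \<kappa>: "0 < \<kappa>" unfolding \<kappa>_def by (rule bump_mass_pos)
  have v: "0 < v" "0 \<le> n" by (simp_all add: v_def n_def)
  \<comment> \<open>Dividing by the mass \<kappa> makes this a genuine weighted mean: its values
    stay in [0, 1], and at scale 0 it is \<eta>.\<close>
  define M where "M s y = 1 / \<kappa> * integral ucube (\<lambda>z. bump 2 z * \<eta> (y + s *\<^sub>R z))" for s y
  define m1 where "m1 i y = 1 / \<kappa> * integral ucube (\<lambda>z. bump 2 z * e i (y + r *\<^sub>R z))" for i y
  define m2 where "m2 i y = 1 / \<kappa> * integral ucube (\<lambda>z. bump 2 z * d i (y + r *\<^sub>R z))" for i y
  define p where "p y = \<eta> y - M r y" for y
  define p1 where "p1 i y = e i y - m1 i y" for i y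
  define p2 where "p2 i y = d i y - m2 i y" for i y
  have cm: "continuous_on UNIV (M s)" "continuous_on UNIV (m1 i)" "continuous_on UNIV (m2 i)" for s i
    unfolding M_def m1_def m2_def
    by (intro continuous_intros continuous_on_ucube_integral cont_\<eta> cont_e cont_d)+
  have cp: "continuous_on UNIV p" "continuous_on UNIV (p1 i)" "continuous_on UNIV (p2 i)" for i
    unfolding p_def p1_def p2_def by (intro continuous_intros cm cont_\<eta> cont_e cont_d)+
  note cc = continuous_on_affine_arg[OF cp(1)] continuous_on_affine_arg[OF cp(2)] continuous_on_affine_arg[OF cp(3)]
    continuous_on_affine_arg[OF cm(1)] continuous_on_affine_arg[OF cm(2)] continuous_on_affine_arg[OF cm(3)]
  have pdp: "has_pd i p (p1 i y) y" "has_pd i (p1 i) (p2 i y) y" for i y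
    unfolding p_def p1_def p2_def M_def m1_def m2_def
    by (intro has_pd_diff pd_\<eta> pd_e has_pd_cmult has_pd_integral cont_\<eta> cont_e cont_d continuous_intros)+
  have M01: "0 \<le> M s y" "M s y \<le> 1" for s y
  proof -
    have i: "(\<lambda>z. bump 2 z * \<eta> (y + s *\<^sub>R z)) integrable_on ucube"
      by (intro integrable_ucube continuous_intros ci)
    have "0 \<le> integral ucube (\<lambda>z. bump 2 z * \<eta> (y + s *\<^sub>R z))"
      by (intro integral_nonneg i) (simp add: bump_nonneg \<eta>)
    then show "0 \<le> M s y" using \<kappa> by (simp add: M_def)
    have "integral ucube (\<lambda>z. bump 2 z * \<eta> (y + s *\<^sub>R z)) \<le> \<kappa>"
      unfolding \<kappa>_def
      by (intro integral_le i integrable_ucube continuous_intros)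
         (simp add: mult_left_le bump_nonneg \<eta>)
    then show "M s y \<le> 1" using \<kappa> by (simp add: M_def)
  qed
  have p_le: "\<bar>p y\<bar> \<le> 1" for y
    unfolding p_def using M01[of r y] \<eta>[of y] by linarith
  have lapp: "(\<Sum>i\<in>UNIV. p2 i y) = lap y - 1 / \<kappa> * integral ucube (\<lambda>z. bump 2 z * lap (y + r *\<^sub>R z))" for y
  proof -
    have "integral ucube (\<lambda>z. bump 2 z * lap (y + r *\<^sub>R z)) =
        (\<Sum>i\<in>UNIV. integral ucube (\<lambda>z. bump 2 z * d i (y + r *\<^sub>R z)))"
      unfolding sum_distrib_left by (intro integral_sum integrable_ucube continuous_intros ci) simp
    then show ?thesis by (simp add: p2_def m2_def sum_subtractf sum_distrib_left)
  qed
  let ?L = "\<lambda>s y. integral ucube (\<lambda>z. \<bar>lap (y + s *\<^sub>R z)\<bar>)"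
  have cL: "continuous_on UNIV (\<lambda>y. ?L s y)" for s
    using continuous_on_ucube_integral[OF _ cont_abs_lap, of "\<lambda>_. 1"] by (simp add: continuous_on_const)
  have bL: "\<bar>integral ucube (\<lambda>z. bump k z * lap (y + s *\<^sub>R z))\<bar> \<le> ?L s y" for k s y
  proof (rule abs_integral_le)
    show "\<bar>bump k z * lap (y + s *\<^sub>R z)\<bar> \<le> \<bar>lap (y + s *\<^sub>R z)\<bar>" for z
      by (simp add: abs_mult mult_left_le_one_le bump_nonneg bump_le_1)
  qed (intro integrable_ucube continuous_intros ci)+
  note cLL = continuous_on_affine_arg[OF cL]

  \<comment> \<open>The Laplacian of \<open>p\<close> is that of \<eta> minus its weighted mean. The
    mean is taken around moving centres, so the double integral bound is what controls it.\<close>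
  have E: "integral ucube (\<lambda>w. \<bar>p (x + r *\<^sub>R w)\<bar> * \<bar>\<Sum>i\<in>UNIV. p2 i (x + r *\<^sub>R w)\<bar>) \<le> a + v\<^sup>2 / \<kappa> * a"
  proof -
    have "integral ucube (\<lambda>w. \<bar>p (x + r *\<^sub>R w)\<bar> * \<bar>\<Sum>i\<in>UNIV. p2 i (x + r *\<^sub>R w)\<bar>) \<le>
        integral ucube (\<lambda>w. \<bar>lap (x + r *\<^sub>R w)\<bar> + 1 / \<kappa> * ?L r (x + r *\<^sub>R w))"
    proof (rule integral_le)
      fix w
      have "\<bar>p (x + r *\<^sub>R w)\<bar> * \<bar>\<Sum>i\<in>UNIV. p2 i (x + r *\<^sub>R w)\<bar> \<le> 1 * \<bar>\<Sum>i\<in>UNIV. p2 i (x + r *\<^sub>R w)\<bar>"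
        by (intro mult_right_mono p_le) simp
      also have "\<dots> \<le> \<bar>lap (x + r *\<^sub>R w)\<bar> + \<bar>1 / \<kappa> * integral ucube (\<lambda>z. bump 2 z * lap (x + r *\<^sub>R w + r *\<^sub>R z))\<bar>"
        unfolding lapp mult_1_left by (rule abs_triangle_ineq4)
      also have "\<dots> \<le> \<bar>lap (x + r *\<^sub>R w)\<bar> + 1 / \<kappa> * ?L r (x + r *\<^sub>R w)"
        using \<kappa> bL[of 2 "x + r *\<^sub>R w" r] by (simp add: abs_mult divide_right_mono)
      finally show "\<bar>p (x + r *\<^sub>R w)\<bar> * \<bar>\<Sum>i\<in>UNIV. p2 i (x + r *\<^sub>R w)\<bar> \<le>
          \<bar>lap (x + r *\<^sub>R w)\<bar> + 1 / \<kappa> * ?L r (x + r *\<^sub>R w)" .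
    qed (intro integrable_ucube continuous_intros ci cc cLL)+
    also have "\<dots> = integral ucube (\<lambda>w. \<bar>lap (x + r *\<^sub>R w)\<bar>) + 1 / \<kappa> * integral ucube (\<lambda>w. ?L r (x + r *\<^sub>R w))"
      by (subst integral_add, (intro integrable_ucube continuous_intros ci cLL)+) (simp only: Henstock_Kurzweil_Integration.integral_mult_right)
    also have "\<dots> \<le> a + 1 / \<kappa> * (v\<^sup>2 * a)"
      using \<kappa> a(2)[OF r(1)] abs_lap_double_le[of r r] r
      by (intro add_mono mult_left_mono) (auto simp: v_def)
    finally show ?thesis by simp
  qed

  \<comment> \<open>Single averages of the Laplacian around \<open>x + r *\<^sub>R w\<close> are not
    bounded by \<open>a\<close> at scales below r; their mean over \<open>w\<close> is. So one
    factor of p^2 is written as M 0 - M r and the other is bounded by 1, which leaves exactly such a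
    mean.\<close>
  define \<Theta> where "\<Theta> s = integral ucube (\<lambda>w. p (x + r *\<^sub>R w) * M s (x + r *\<^sub>R w))" for s
  define \<Theta>' where "\<Theta>' s = integral ucube (\<lambda>w. p (x + r *\<^sub>R w) *
      (1 / \<kappa> * (s / 6 * integral ucube (\<lambda>z. bump 3 z * lap (x + r *\<^sub>R w + s *\<^sub>R z)))))" for s
  have d\<Theta>: "(\<Theta> has_real_derivative \<Theta>' s) (at s)" for s
  proof -
    have "continuous_on (UNIV \<times> ucube) (\<lambda>u. integral ucube (\<lambda>z. bump 3 z * lap (x + r *\<^sub>R snd u + fst u *\<^sub>R z)))"
      by (rule integral_continuous_on_param, unfold split_def)
         (intro continuous_on_mult continuous_on_compose2[OF continuous_on_bump[of UNIV]] ci continuous_intros subset_UNIV)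
    note c3 = this
    have "(\<Theta> has_real_derivative \<Theta>' s) (at s within UNIV)"
      unfolding \<Theta>_def \<Theta>'_def
    proof (rule leibniz_rule_field_derivative)
      show "((\<lambda>s. p (x + r *\<^sub>R w) * M s (x + r *\<^sub>R w)) has_real_derivative p (x + r *\<^sub>R w) *
        (1 / \<kappa> * (s / 6 * integral ucube (\<lambda>z. bump 3 z * lap (x + r *\<^sub>R w + s *\<^sub>R z))))) (at s within UNIV)" for s w
        unfolding M_def by (intro DERIV_cmult deriv_mollified)
      show "continuous_on (UNIV \<times> ucube) (\<lambda>(s, w). p (x + r *\<^sub>R w) *
          (1 / \<kappa> * (s / 6 * integral ucube (\<lambda>z. bump 3 z * lap (x + r *\<^sub>R w + s *\<^sub>R z)))))"
        unfolding split_def by (intro continuous_intros cc c3) simp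
    qed (auto intro!: integrable_ucube continuous_intros cc)
    then show ?thesis by simp
  qed
  have "\<exists>\<xi>. 0 < \<xi> \<and> \<xi> < r \<and> \<Theta> r - \<Theta> 0 = (r - 0) * \<Theta>' \<xi>"
    by (rule MVT2[OF r(1)]) (rule d\<Theta>)
  then obtain \<xi> where \<xi>: "0 < \<xi>" "\<xi> < r" "\<Theta> r - \<Theta> 0 = r * \<Theta>' \<xi>" by auto
  have "\<bar>\<Theta>' \<xi>\<bar> \<le> integral ucube (\<lambda>w. 1 / \<kappa> * (\<xi> / 6 * ?L \<xi> (x + r *\<^sub>R w)))"
    unfolding \<Theta>'_def
  proof (rule abs_integral_le)
    fix w
    let ?I = "integral ucube (\<lambda>z. bump 3 z * lap (x + r *\<^sub>R w + \<xi> *\<^sub>R z))"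
    have "\<bar>p (x + r *\<^sub>R w)\<bar> * \<bar>1 / \<kappa> * (\<xi> / 6 * ?I)\<bar> \<le> 1 * \<bar>1 / \<kappa> * (\<xi> / 6 * ?I)\<bar>"
      by (intro mult_right_mono p_le) simp
    also have "\<dots> = 1 / \<kappa> * (\<xi> / 6 * \<bar>?I\<bar>)"
      using \<kappa> \<xi> by (simp add: abs_mult)
    also have "\<dots> \<le> 1 / \<kappa> * (\<xi> / 6 * ?L \<xi> (x + r *\<^sub>R w))"
      using \<kappa> \<xi> by (intro mult_left_mono bL) auto
    finally show "\<bar>p (x + r *\<^sub>R w) * (1 / \<kappa> * (\<xi> / 6 * ?I))\<bar> \<le> 1 / \<kappa> * (\<xi> / 6 * ?L \<xi> (x + r *\<^sub>R w))"
      by (simp only: abs_mult)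
  next
    have "continuous_on UNIV (\<lambda>y. integral ucube (\<lambda>z. bump 3 z * lap (y + \<xi> *\<^sub>R z)))"
      by (intro continuous_on_ucube_integral cont_lap continuous_intros)
    note c3 = continuous_on_affine_arg[OF this]
    show "(\<lambda>w. p (x + r *\<^sub>R w) * (1 / \<kappa> * (\<xi> / 6 * integral ucube (\<lambda>z. bump 3 z * lap (x + r *\<^sub>R w + \<xi> *\<^sub>R z)))))
        integrable_on ucube"
      by (intro integrable_ucube continuous_intros cc c3)
  qed (intro integrable_ucube continuous_intros cLL)
  also have "\<dots> = 1 / \<kappa> * (\<xi> / 6 * integral ucube (\<lambda>w. ?L \<xi> (x + r *\<^sub>R w)))"
    by (simp only: Henstock_Kurzweil_Integration.integral_mult_right)
  also have "\<dots> \<le> 1 / \<kappa> * (r / 6 * (v\<^sup>2 * a))"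
  proof -
    have "\<xi> / 6 * integral ucube (\<lambda>w. ?L \<xi> (x + r *\<^sub>R w)) \<le> \<xi> / 6 * (v\<^sup>2 * a)"
      using abs_lap_double_le[of \<xi> r] \<xi> r by (intro mult_left_mono) (auto simp: v_def)
    also have "\<dots> \<le> r / 6 * (v\<^sup>2 * a)"
      using \<xi> a by (intro mult_right_mono) auto
    finally show ?thesis using \<kappa> by (intro mult_left_mono) auto
  qed
  \<comment> \<open>One factor \<open>r\<close> is the length of the scale interval, the other
    bounds the factor \<open>s\<close> in \<open>deriv_mollified\<close>. Together they cancel the 1
    / r^2 of the Caccioppoli inequality.\<close>
  finally have "r * \<bar>\<Theta>' \<xi>\<bar> \<le> r * (1 / \<kappa> * (r / 6 * (v\<^sup>2 * a)))"
    using r by (intro mult_left_mono) auto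
  moreover have "integral ucube (\<lambda>w. (p (x + r *\<^sub>R w))\<^sup>2) = \<Theta> 0 - \<Theta> r"
  proof -
    have "M 0 y = \<eta> y" for y
    proof -
      have "M 0 y = 1 / \<kappa> * (\<kappa> * \<eta> y)"
        by (simp add: M_def \<kappa>_def)
      then show ?thesis using \<kappa> by simp
    qed
    then have "(\<lambda>w. (p (x + r *\<^sub>R w))\<^sup>2) = (\<lambda>w. p (x + r *\<^sub>R w) * M 0 (x + r *\<^sub>R w) - p (x + r *\<^sub>R w) * M r (x + r *\<^sub>R w))"
      by (simp add: p_def power2_eq_square algebra_simps)
    then show ?thesis
      unfolding \<Theta>_def
      by (simp only:) (rule integral_diff; intro integrable_ucube continuous_intros cc)
  qed
  ultimately have P: "integral ucube (\<lambda>w. (p (x + r *\<^sub>R w))\<^sup>2) \<le> r\<^sup>2 * (v\<^sup>2 * a / (6 * \<kappa>))"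
    using \<xi>(3) r abs_ge_minus_self[of "r * \<Theta>' \<xi>"] by (simp add: abs_mult power2_eq_square)

  have "16 * n / r\<^sup>2 * integral ucube (\<lambda>w. (p (x + r *\<^sub>R w))\<^sup>2) \<le> 16 * n / r\<^sup>2 * (r\<^sup>2 * (v\<^sup>2 * a / (6 * \<kappa>)))"
    using v by (intro mult_left_mono P) auto
  also have "\<dots> \<le> 8 * n * v\<^sup>2 / \<kappa> * a"
    using r \<kappa> v a by (simp add: field_simps)
  finally have P': "16 * n / r\<^sup>2 * integral ucube (\<lambda>w. (p (x + r *\<^sub>R w))\<^sup>2) \<le> 8 * n * v\<^sup>2 / \<kappa> * a" .
  have "integral ucube (\<lambda>z. bump 2 z * (\<Sum>i\<in>UNIV. (p1 i (x + r *\<^sub>R z))\<^sup>2)) \<le>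
      8 * n * v\<^sup>2 / \<kappa> * a + 2 * (a + v\<^sup>2 / \<kappa> * a)"
    using caccioppoli[OF pdp cp r(1), of x] P' E unfolding n_def by simp
  also have "\<dots> = (8 * n * v\<^sup>2 / \<kappa> + 2 + 2 * v\<^sup>2 / \<kappa>) * a"
    by (simp add: ring_distribs)
  finally have gp: "integral ucube (\<lambda>z. bump 2 z * (\<Sum>i\<in>UNIV. (p1 i (x + r *\<^sub>R z))\<^sup>2)) \<le>
      (8 * n * v\<^sup>2 / \<kappa> + 2 + 2 * v\<^sup>2 / \<kappa>) * a" .

  have "integral ucube (\<lambda>z. bump 2 z * (\<Sum>i\<in>UNIV. (m1 i (x + r *\<^sub>R z))\<^sup>2)) \<le>
      integral ucube (\<lambda>z :: real^'n. n * (64 * v\<^sup>2 / \<kappa>\<^sup>2 * a))"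
  proof (rule integral_le)
    fix z :: "real^'n" assume z: "z \<in> ucube"
    have "(m1 i (x + r *\<^sub>R z))\<^sup>2 \<le> 64 * v\<^sup>2 / \<kappa>\<^sup>2 * a" for i
    proof -
      have "\<bar>m1 i (x + r *\<^sub>R z)\<bar> \<le> 1 / \<kappa> * (8 * v * sqrt a)"
        unfolding m1_def abs_mult using mollified_gradient_le[OF z r, of i] \<kappa>
        by (intro mult_mono) (auto simp: v_def)
      then have "\<bar>m1 i (x + r *\<^sub>R z)\<bar>\<^sup>2 \<le> (1 / \<kappa> * (8 * v * sqrt a))\<^sup>2"
        by (rule power_mono) simp
      then show ?thesis using a by (simp add: power_mult_distrib power_divide)
    qed
    then have "(\<Sum>i\<in>UNIV. (m1 i (x + r *\<^sub>R z))\<^sup>2) \<le> n * (64 * v\<^sup>2 / \<kappa>\<^sup>2 * a)"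
      unfolding n_def by (intro sum_bounded_above)
    then have "bump 2 z * (\<Sum>i\<in>UNIV. (m1 i (x + r *\<^sub>R z))\<^sup>2) \<le> 1 * (n * (64 * v\<^sup>2 / \<kappa>\<^sup>2 * a))"
      by (intro mult_mono bump_le_1) (auto intro: sum_nonneg)
    then show "bump 2 z * (\<Sum>i\<in>UNIV. (m1 i (x + r *\<^sub>R z))\<^sup>2) \<le> n * (64 * v\<^sup>2 / \<kappa>\<^sup>2 * a)" by simp
  qed (intro integrable_ucube continuous_intros cc)+
  also have "\<dots> = v * (n * (64 * v\<^sup>2 / \<kappa>\<^sup>2 * a))"
    unfolding v_def by (rule integral_ucube_const)
  also have "\<dots> = 64 * n * v ^ 3 / \<kappa>\<^sup>2 * a"
    by (simp add: power3_eq_cube power2_eq_square)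
  finally have gm: "integral ucube (\<lambda>z. bump 2 z * (\<Sum>i\<in>UNIV. (m1 i (x + r *\<^sub>R z))\<^sup>2)) \<le> 64 * n * v ^ 3 / \<kappa>\<^sup>2 * a" .

  let ?A = "\<lambda>z. bump 2 z * (\<Sum>i\<in>UNIV. (m1 i (x + r *\<^sub>R z))\<^sup>2)"
  let ?B = "\<lambda>z. bump 2 z * (\<Sum>i\<in>UNIV. (p1 i (x + r *\<^sub>R z))\<^sup>2)"
  have "integral ucube (\<lambda>z. bump 2 z * (\<Sum>i\<in>UNIV. (e i (x + r *\<^sub>R z))\<^sup>2)) \<le>
      integral ucube (\<lambda>z. 2 * ?A z + 2 * ?B z)"
  proof (rule integral_le)
    fix z
    have t: "(e i y)\<^sup>2 \<le> 2 * (m1 i y)\<^sup>2 + 2 * (p1 i y)\<^sup>2" for i y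
      using zero_le_power2[of "m1 i y - p1 i y"]
      by (simp add: p1_def power2_eq_square algebra_simps)
    have "(\<Sum>i\<in>UNIV. (e i (x + r *\<^sub>R z))\<^sup>2) \<le>
        2 * (\<Sum>i\<in>UNIV. (m1 i (x + r *\<^sub>R z))\<^sup>2) + 2 * (\<Sum>i\<in>UNIV. (p1 i (x + r *\<^sub>R z))\<^sup>2)"
      unfolding sum_distrib_left sum.distrib[symmetric] by (intro sum_mono t)
    from mult_left_mono[OF this bump_nonneg[of 2 z]]
    show "bump 2 z * (\<Sum>i\<in>UNIV. (e i (x + r *\<^sub>R z))\<^sup>2) \<le> 2 * ?A z + 2 * ?B z"
      by (simp add: algebra_simps)
  qed (intro integrable_ucube continuous_intros cc ci)+
  also have "\<dots> = 2 * integral ucube ?A + 2 * integral ucube ?B"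
    by (subst integral_add, (intro integrable_ucube continuous_intros cc)+) (simp only: Henstock_Kurzweil_Integration.integral_mult_right)
  also have "\<dots> \<le> 2 * (64 * n * v ^ 3 / \<kappa>\<^sup>2 * a) + 2 * ((8 * n * v\<^sup>2 / \<kappa> + 2 + 2 * v\<^sup>2 / \<kappa>) * a)"
    by (intro add_mono mult_left_mono gm gp) auto
  also have "\<dots> = (128 * n * v ^ 3 / \<kappa>\<^sup>2 + 16 * n * v\<^sup>2 / \<kappa> + 4 + 4 * v\<^sup>2 / \<kappa>) * a"
    by (simp add: ring_distribs)
  finally show ?thesis .
qed

end

end

text \<open>The constant is quantified before all functions, points and scales, so it depends on the
  dimension alone. The two regimes meet at r^2 a = 1.\<close>

lemma gradient_maximal:
  "\<exists>C>0. \<forall>\<eta> e d (a::real) x (r::real). C2_function \<eta> e d \<longrightarrow> (\<forall>y. 0 \<le> \<eta> y \<and> \<eta> y \<le> 1) \<longrightarrow> 0 < a \<longrightarrow> 0 < r \<longrightarrow>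
     (\<forall>s>0. integral ucube (\<lambda>z. \<bar>\<Sum>i\<in>UNIV. d i (x + s *\<^sub>R z)\<bar>) \<le> a) \<longrightarrow>
     integral ucube (\<lambda>z. bump 2 z * (\<Sum>i\<in>UNIV. (e i (x + r *\<^sub>R (z :: real^'n::finite)))\<^sup>2)) \<le> C * a"
proof -
  let ?n = "real CARD('n)" and ?v = "2 ^ CARD('n) :: real"
  let ?\<kappa> = "integral (ucube :: (real^'n) set) (bump 2)"
  let ?C1 = "16 * ?n * ?v + 2"
  let ?C2 = "128 * ?n * ?v ^ 3 / ?\<kappa>\<^sup>2 + 16 * ?n * ?v\<^sup>2 / ?\<kappa> + 4 + 4 * ?v\<^sup>2 / ?\<kappa>"
  show ?thesis
  proof (intro exI[of _ "max ?C1 ?C2"] conjI allI impI)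
    have "0 < ?C1" by (intro add_nonneg_pos) auto
    then show "0 < max ?C1 ?C2" by linarith
    fix \<eta> :: "real^'n \<Rightarrow> real" and e d x and a r :: real
    assume C2: "C2_function \<eta> e d" and \<eta>: "\<forall>y. 0 \<le> \<eta> y \<and> \<eta> y \<le> 1" and a: "0 < a" and r: "0 < r"
      and b: "\<forall>s>0. integral ucube (\<lambda>z. \<bar>\<Sum>i\<in>UNIV. d i (x + s *\<^sub>R z)\<bar>) \<le> a"
    let ?G = "integral ucube (\<lambda>z. bump 2 z * (\<Sum>i\<in>UNIV. (e i (x + r *\<^sub>R z))\<^sup>2))"
    have \<eta>': "\<And>y. 0 \<le> \<eta> y" "\<And>y. \<eta> y \<le> 1" using \<eta> by auto
    have b': "integral ucube (\<lambda>z. \<bar>\<Sum>i\<in>UNIV. d i (x + s *\<^sub>R z)\<bar>) \<le> a" if "0 < s" for s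
      using b that by blast
    have "?G \<le> ?C1 * a \<or> ?G \<le> ?C2 * a"
    proof (cases "1 \<le> r\<^sup>2 * a")
      case True
      show ?thesis
        by (rule disjI1, rule C2_function.gradient_le_large[OF C2 \<eta>' a b' r True])
    next
      case False
      then have "r\<^sup>2 * a < 1" by simp
      show ?thesis
        by (rule disjI2, rule C2_function.gradient_le_small[OF C2 \<eta>' a b' r \<open>r\<^sup>2 * a < 1\<close>])
    qed
    moreover have "?C1 * a \<le> max ?C1 ?C2 * a" "?C2 * a \<le> max ?C1 ?C2 * a"
      using a by (intro mult_right_mono; simp)+
    ultimately show "integral ucube (\<lambda>z. bump 2 z * (\<Sum>i\<in>UNIV. (e i (x + r *\<^sub>R z))\<^sup>2)) \<le> max ?C1 ?C2 * a"
      by linarith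
  qed
qed

section \<open>A dyadic maximal function\<close>

text \<open>Half-open, so that the 2^N dyadic children partition their parent exactly.\<close>

definition halfcube :: "real^'n::finite \<Rightarrow> real \<Rightarrow> (real^'n) set" where
  "halfcube a l = {x. \<forall>i. a $ i \<le> x $ i \<and> x $ i < a $ i + l}"

lemma halfcube_borel [measurable]: "halfcube a l \<in> sets borel"
  unfolding halfcube_def by measurable

lemma halfcube_subset_cbox: "halfcube a l \<subseteq> cbox a (\<chi> i. a $ i + l)"
  by (auto simp: halfcube_def mem_box_cart) (meson order.strict_implies_order)

lemma emeasure_cube:
  assumes "0 < l"
  shows "emeasure lborel (cbox a (\<chi> i. a $ i + l) :: (real^'n::finite) set) = ennreal (l ^ CARD('n))"
proof -
  have "a \<in> cbox a (\<chi> i. a $ i + l)" using assms by (simp add: mem_box_cart)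
  then have "cbox a (\<chi> i. a $ i + l) \<noteq> {}" by blast
  then have "measure lborel (cbox a (\<chi> i. a $ i + l)) = l ^ CARD('n)"
    by (simp add: content_cbox_cart)
  moreover have "emeasure lborel (cbox a (\<chi> i. a $ i + l)) \<noteq> top"
    using emeasure_lborel_cbox_finite[of a "\<chi> i. a $ i + l"] by (simp add: less_top)
  ultimately show ?thesis using emeasure_eq_ennreal_measure[of lborel] by metis
qed

lemma emeasure_halfcube:
  assumes "0 < l"
  shows "emeasure lborel (halfcube a l :: (real^'n::finite) set) = ennreal (l ^ CARD('n))"
proof (rule antisym)
  show "emeasure lborel (halfcube a l) \<le> ennreal (l ^ CARD('n))"
    unfolding emeasure_cube[OF assms, of a, symmetric]
    by (rule emeasure_mono[OF halfcube_subset_cbox]) simp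
  have "box a (\<chi> i. a $ i + l) \<subseteq> halfcube a l"
    by (auto simp: halfcube_def mem_box_cart) (meson order.strict_implies_order)
  then have "emeasure lborel (box a (\<chi> i. a $ i + l)) \<le> emeasure lborel (halfcube a l)"
    by (rule emeasure_mono) simp
  moreover have "emeasure lborel (box a (\<chi> i. a $ i + l)) = emeasure lborel (cbox a (\<chi> i. a $ i + l))"
    by (simp add: emeasure_lborel_box_eq emeasure_lborel_cbox_eq)
  ultimately show "ennreal (l ^ CARD('n)) \<le> emeasure lborel (halfcube a l)"
    by (simp add: emeasure_cube[OF assms])
qed

lemma measure_halfcube: "0 < l \<Longrightarrow> measure lborel (halfcube a l :: (real^'n::finite) set) = l ^ CARD('n)"
  by (simp add: measure_def emeasure_halfcube)

lemma set_integrable_halfcube: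
  fixes g :: "real^'n::finite \<Rightarrow> real"
  assumes "0 < l" "g \<in> borel_measurable borel" "\<And>x. x \<in> halfcube a l \<Longrightarrow> \<bar>g x\<bar> \<le> M"
  shows "set_integrable lborel (halfcube a l) g"
  unfolding set_integrable_def
proof (rule integrableI_bounded_set[where A = "halfcube a l" and B = M])
  show "emeasure lborel (halfcube a l) < \<infinity>" using assms(1) by (simp add: emeasure_halfcube)
qed (use assms in auto)

lemma set_integral_halfcube_const:
  "0 < l \<Longrightarrow> (LINT x:(halfcube a l :: (real^'n::finite) set)|lborel. c) = c * l ^ CARD('n)" for c :: real
  unfolding set_lebesgue_integral_def
  by (subst Bochner_Integration.integral_scaleR_left)
     (simp_all add: measure_halfcube emeasure_halfcube mult.commute)

section \<open>Subdivision of a cube into its dyadic children\<close>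

definition corners :: "(real^'n::finite) set" where
  "corners = {b. \<forall>i. b $ i \<in> {0, 1}}"

lemma finite_corners: "finite (corners :: (real^'n::finite) set)"
proof -
  have "(corners :: (real^'n) set) \<subseteq> (\<lambda>f. \<chi> i. f i) ` (UNIV \<rightarrow>\<^sub>E {0, 1 :: real})"
  proof
    fix b :: "real^'n" assume "b \<in> corners"
    then have "(\<lambda>i. b $ i) \<in> UNIV \<rightarrow>\<^sub>E {0, 1}" by (auto simp: corners_def)
    moreover have "b = (\<chi> i. b $ i)" by (simp add: vec_eq_iff)
    ultimately show "b \<in> (\<lambda>f. \<chi> i. f i) ` (UNIV \<rightarrow>\<^sub>E {0, 1 :: real})" by blast
  qed
  then show ?thesis
    by (rule finite_subset) (intro finite_imageI finite_PiE; simp)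
qed

definition corner_of :: "real^'n::finite \<Rightarrow> real \<Rightarrow> real^'n \<Rightarrow> real^'n" where
  "corner_of a l x = (\<chi> i. if x $ i < a $ i + l / 2 then 0 else 1)"

lemma corner_of_mem: "corner_of a l x \<in> corners"
  by (simp add: corner_of_def corners_def)

text \<open>The children are the fibres of \<open>corner_of\<close> over the corners, so
  disjointness and covering both come from \<open>corner_of\<close> being a function.\<close>

lemma child_iff:
  assumes "0 < l" "b \<in> corners"
  shows "x \<in> halfcube (a + (l/2) *\<^sub>R b) (l/2) \<longleftrightarrow> x \<in> halfcube a l \<and> corner_of a l x = b"
proof -
  have *: "(a $ i + l / 2 * b $ i \<le> x $ i \<and> x $ i < a $ i + l / 2 * b $ i + l / 2) \<longleftrightarrow>
      (a $ i \<le> x $ i \<and> x $ i < a $ i + l) \<and> (if x $ i < a $ i + l / 2 then 0 else 1) = b $ i" for i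
  proof -
    have "b $ i = 0 \<or> b $ i = 1" using assms(2) by (auto simp: corners_def)
    then show ?thesis using assms(1) by auto
  qed
  have "x \<in> halfcube (a + (l/2) *\<^sub>R b) (l/2) \<longleftrightarrow>
      (\<forall>i. a $ i + l / 2 * b $ i \<le> x $ i \<and> x $ i < a $ i + l / 2 * b $ i + l / 2)"
    by (simp add: halfcube_def)
  also have "\<dots> \<longleftrightarrow> (\<forall>i. (a $ i \<le> x $ i \<and> x $ i < a $ i + l) \<and> (if x $ i < a $ i + l / 2 then 0 else 1) = b $ i)"
    by (simp only: *)
  also have "\<dots> \<longleftrightarrow> x \<in> halfcube a l \<and> corner_of a l x = b"
    by (simp only: halfcube_def corner_of_def vec_eq_iff mem_Collect_eq vec_lambda_beta all_conj_distrib)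
  finally show ?thesis .
qed

lemma corner_of_borel: "{x. corner_of a l x = b} \<in> sets borel"
proof -
  have "{x. corner_of a l x = b} = {x. \<forall>i. (if x $ i < a $ i + l / 2 then 0 else 1) = b $ i}"
    by (simp add: corner_of_def vec_eq_iff)
  also have "\<dots> \<in> sets borel" by measurable
  finally show ?thesis .
qed

lemma set_integral_split_children:
  fixes g :: "real^'n::finite \<Rightarrow> real"
  assumes "0 < l" "set_integrable lborel (halfcube a l) g"
  shows "(LINT x:halfcube a l|lborel. g x) =
    (\<Sum>b\<in>corners. LINT x:halfcube (a + (l/2) *\<^sub>R b) (l/2)|lborel. g x)"
proof -
  have "indicat_real (halfcube a l) x = (\<Sum>b\<in>corners. indicat_real (halfcube (a + (l/2) *\<^sub>R b) (l/2)) x)" for x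
  proof -
    have "(\<Sum>b\<in>corners. indicat_real (halfcube (a + (l/2) *\<^sub>R b) (l/2)) x) =
        (\<Sum>b\<in>corners. if b = corner_of a l x then indicat_real (halfcube a l) x else 0)"
      by (rule sum.cong) (auto simp: indicator_def child_iff[OF assms(1)])
    then show ?thesis by (simp add: finite_corners corner_of_mem)
  qed
  then have "(LINT x:halfcube a l|lborel. g x) =
    (LINT x|lborel. (\<Sum>b\<in>corners. indicat_real (halfcube (a + (l/2) *\<^sub>R b) (l/2)) x *\<^sub>R g x))"
    by (simp add: set_lebesgue_integral_def sum_distrib_right)
  also have "\<dots> = (\<Sum>b\<in>corners. LINT x:halfcube (a + (l/2) *\<^sub>R b) (l/2)|lborel. g x)"
    unfolding set_lebesgue_integral_def
  proof (rule Bochner_Integration.integral_sum)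
    fix b :: "real^'n" assume b: "b \<in> corners"
    have "set_integrable lborel (halfcube (a + (l/2) *\<^sub>R b) (l/2)) g"
      by (rule set_integrable_subset[OF assms(2)]) (use child_iff[OF assms(1) b] in auto)
    then show "integrable lborel (\<lambda>x. indicat_real (halfcube (a + (l/2) *\<^sub>R b) (l/2)) x *\<^sub>R g x)"
      by (simp add: set_integrable_def)
  qed
  finally show ?thesis .
qed

context
  fixes F :: "real^'n::finite \<Rightarrow> real"
begin

definition average_le :: "real^'n \<Rightarrow> real \<Rightarrow> real \<Rightarrow> bool" where
  "average_le a l c \<longleftrightarrow> (LINT x:halfcube a l|lborel. F x) \<le> c * l ^ CARD('n)"

text \<open>Expresses that an uncentred maximal function over subcubes is at most \<open>c\<close>
  at \<open>x\<close> without forming a supremum.\<close>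

definition subaverages_le :: "real^'n \<Rightarrow> real \<Rightarrow> real^'n \<Rightarrow> real \<Rightarrow> bool" where
  "subaverages_le a l x c \<longleftrightarrow>
     (\<forall>a' l'. 0 < l' \<longrightarrow> halfcube a' l' \<subseteq> halfcube a l \<longrightarrow> x \<in> halfcube a' l' \<longrightarrow> average_le a' l' c)"

text \<open>The invariant of the induction on the depth \<open>k\<close>. Clause four keeps
  \<open>D\<close> below the larger of \<open>m\<close> and the maximal function; clause five keeps
  it above the average over some cube of the finest size around \<open>x\<close>; the last is the
  logarithmic estimate. The upper bound on \<open>D\<close> serves integrability.\<close>

definition dyadic_maximal :: "real^'n \<Rightarrow> real \<Rightarrow> real \<Rightarrow> nat \<Rightarrow> (real^'n \<Rightarrow> real) \<Rightarrow> bool" where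
  "dyadic_maximal a l m k D \<longleftrightarrow> D \<in> borel_measurable borel \<and> (\<exists>M. \<forall>x. D x \<le> M) \<and> (\<forall>x. m \<le> D x) \<and>
    (\<forall>x\<in>halfcube a l. \<forall>c\<ge>m. subaverages_le a l x c \<longrightarrow> D x \<le> c) \<and>
    (\<forall>x\<in>halfcube a l. \<exists>a'. x \<in> halfcube a' (l / 2 ^ k) \<and> average_le a' (l / 2 ^ k) (D x)) \<and>
    (LINT x:halfcube a l|lborel. F x * ln (D x / m)) \<le> 2 ^ CARD('n) * (LINT x:halfcube a l|lborel. D x - m)"

lemma dyadic_maximalD:
  assumes "dyadic_maximal a l m k D"
  shows "D \<in> borel_measurable borel" "\<exists>M. \<forall>x. D x \<le> M" "m \<le> D x"
    "x \<in> halfcube a l \<Longrightarrow> m \<le> c \<Longrightarrow> subaverages_le a l x c \<Longrightarrow> D x \<le> c"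
    "x \<in> halfcube a l \<Longrightarrow> \<exists>a'. x \<in> halfcube a' (l / 2 ^ k) \<and> average_le a' (l / 2 ^ k) (D x)"
    "(LINT x:halfcube a l|lborel. F x * ln (D x / m)) \<le> 2 ^ CARD('n) * (LINT x:halfcube a l|lborel. D x - m)"
  using assms by (auto simp: dyadic_maximal_def)

context
  assumes contF: "continuous_on UNIV F" and F0: "\<And>x. 0 \<le> F x"
begin
lemma F_bounded_halfcube: "\<exists>B. \<forall>x\<in>halfcube a l. \<bar>F x\<bar> \<le> B"
proof -
  have "compact (F ` cbox a (\<chi> i. a $ i + l))"
    by (intro compact_continuous_image continuous_on_subset[OF contF]) auto
  then obtain B where "\<forall>y\<in>F ` cbox a (\<chi> i. a $ i + l). \<bar>y\<bar> \<le> B"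
    by (auto dest!: compact_imp_bounded simp: bounded_iff)
  then show ?thesis using halfcube_subset_cbox by blast
qed

lemma F_borel [measurable]: "F \<in> borel_measurable borel"
  by (rule borel_measurable_continuous_onI[OF contF])

lemma F_set_integrable: "0 < l \<Longrightarrow> set_integrable lborel (halfcube a l) F"
  using F_bounded_halfcube set_integrable_halfcube[OF _ F_borel] by blast

text \<open>Doob-type telescoping: \<open>D\<close> is the running maximum of the dyadic averages down to depth
  \<open>k\<close>, started at \<open>m\<close>. Passing to a subcube multiplies averages by at most \<open>2 ^ N\<close>, which is
  why the increments of the logarithm cost only a constant.\<close>

lemma dyadic_maximal_exists:
  assumes "0 < l" "0 < m" "average_le a l m"
  shows "\<exists>D. dyadic_maximal a l m k D"
  using assms
proof (induction k arbitrary: a l m)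
  case 0
  then show ?case
    by (intro exI[of _ "\<lambda>_. m"]) (auto simp: dyadic_maximal_def set_lebesgue_integral_def)
next
  case (Suc k)
  let ?N = "CARD('n)"
  let ?Q = "\<lambda>b. halfcube (a + (l/2) *\<^sub>R b) (l/2)"
  let ?A = "\<lambda>b. LINT x:?Q b|lborel. F x"
  \<comment> \<open>The running maximum after one more generation: it is the starting level for the
    child and dominates the average there, as the induction hypothesis demands.\<close>
  define mb where "mb b = max m (?A b / (l/2) ^ ?N)" for b
  have l2: "0 < l / 2" using Suc.prems by simp
  have mb: "m \<le> mb b" "0 < mb b" "?A b \<le> mb b * (l/2) ^ ?N" for b
  proof -
    show "m \<le> mb b" by (simp add: mb_def)
    then show "0 < mb b" using Suc.prems(2) by linarith
    have "?A b / (l/2) ^ ?N \<le> mb b" by (simp add: mb_def)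
    then show "?A b \<le> mb b * (l/2) ^ ?N"
      by (subst (asm) pos_divide_le_eq) (use l2 in auto)
  qed
  have "\<forall>b. \<exists>D. dyadic_maximal (a + (l/2) *\<^sub>R b) (l/2) (mb b) k D"
    using Suc.IH[OF l2 mb(2) mb(3)[folded average_le_def]] by blast
  then obtain Db where Db: "\<And>b. dyadic_maximal (a + (l/2) *\<^sub>R b) (l/2) (mb b) k (Db b)" by metis
  note Db_borel = dyadic_maximalD(1)[OF Db] and Db_ge = dyadic_maximalD(3)[OF Db]
  have "\<forall>b. \<exists>M. \<forall>x. Db b x \<le> M" using dyadic_maximalD(2)[OF Db] by blast
  then obtain Mb where Mb: "\<And>b x. Db b x \<le> Mb b" by metis
  define D where "D x = Db (corner_of a l x) x" for x
  have D_eq: "D x = (\<Sum>b\<in>corners. if corner_of a l x = b then Db b x else 0)" for x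
    by (simp add: D_def finite_corners corner_of_mem)
  have D_borel [measurable]: "D \<in> borel_measurable borel"
    unfolding D_eq[abs_def]
    using corner_of_borel[of a l]
    by (intro borel_measurable_sum measurable_If Db_borel) simp_all
  have D_ge: "m \<le> D x" for x
    unfolding D_def by (rule order_trans[OF mb(1) Db_ge])
  have D_le: "D x \<le> (\<Sum>b\<in>corners. \<bar>Mb b\<bar>)" for x
  proof -
    have "D x \<le> \<bar>Mb (corner_of a l x)\<bar>" unfolding D_def using Mb[of "corner_of a l x" x] by linarith
    also have "\<dots> \<le> (\<Sum>b\<in>corners. \<bar>Mb b\<bar>)"
      by (rule member_le_sum) (auto simp: finite_corners corner_of_mem)
    finally show ?thesis .
  qed
  have child: "x \<in> ?Q (corner_of a l x)" "?Q (corner_of a l x) \<subseteq> halfcube a l" if "x \<in> halfcube a l" for x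
    using that by (auto simp: child_iff[OF Suc.prems(1) corner_of_mem])
  have D_Q: "D x = Db b x" if "b \<in> corners" "x \<in> ?Q b" for b x
    using that(2) unfolding child_iff[OF Suc.prems(1) that(1)] by (simp add: D_def)
  have c4: "D x \<le> c" if x: "x \<in> halfcube a l" and c: "m \<le> c" and av: "subaverages_le a l x c" for x c
  proof -
    let ?b = "corner_of a l x"
    have "average_le (a + (l/2) *\<^sub>R ?b) (l/2) c"
      using av l2 child[OF x] unfolding subaverages_le_def by blast
    then have "mb ?b \<le> c" using l2 c by (simp add: mb_def average_le_def pos_divide_le_eq)
    moreover have "subaverages_le (a + (l/2) *\<^sub>R ?b) (l/2) x c"
      using av child(2)[OF x] unfolding subaverages_le_def by (meson order_trans)
    ultimately show ?thesis
      unfolding D_def by (rule dyadic_maximalD(4)[OF Db child(1)[OF x]])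
  qed
  have c5: "\<exists>a'. x \<in> halfcube a' (l / 2 ^ Suc k) \<and> average_le a' (l / 2 ^ Suc k) (D x)"
    if x: "x \<in> halfcube a l" for x
  proof -
    have "l / 2 / 2 ^ k = l / 2 ^ Suc k" by simp
    with dyadic_maximalD(5)[OF Db child(1)[OF x]] show ?thesis unfolding D_def by simp
  qed
  obtain B where B: "\<And>x. x \<in> halfcube a l \<Longrightarrow> \<bar>F x\<bar> \<le> B"
    using F_bounded_halfcube by blast
  have bounded_ln: "\<bar>F x * ln (E / m')\<bar> \<le> B * (M / m')"
    if "x \<in> halfcube a l" "0 < m'" "m' \<le> E" "E \<le> M" for x E m' M
  proof -
    have "0 \<le> ln (E / m')" using that by (intro ln_ge_zero) simp
    moreover have "ln (E / m') \<le> E / m'" using that by (intro ln_bound) simp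
    moreover have "E / m' \<le> M / m'" using that by (simp add: divide_right_mono)
    ultimately show ?thesis
      unfolding abs_mult using B[OF that(1)] by (intro mult_mono) auto
  qed
  have int_ln: "set_integrable lborel (halfcube a l) (\<lambda>x. F x * ln (D x / m))"
    by (rule set_integrable_halfcube[OF Suc.prems(1)], measurable)
       (rule bounded_ln[OF _ Suc.prems(2) D_ge D_le])
  have int_D: "set_integrable lborel (halfcube a l) (\<lambda>x. D x - m)"
    by (rule set_integrable_halfcube[OF Suc.prems(1), where M = "\<Sum>b\<in>corners. \<bar>Mb b\<bar>"], measurable)
       (use D_ge D_le Suc.prems(2) in \<open>smt (verit)\<close>)
  have step: "(LINT x:?Q b|lborel. F x * ln (D x / m)) \<le> 2 ^ ?N * (LINT x:?Q b|lborel. D x - m)"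
    if b: "b \<in> corners" for b
  proof -
    have Q: "?Q b \<subseteq> halfcube a l" using child_iff[OF Suc.prems(1) b] by auto
    have i1: "set_integrable lborel (?Q b) (\<lambda>x. F x * ln (Db b x / mb b))"
      by (rule set_integrable_halfcube[OF l2], use Db_borel[of b] in measurable)
         (use Q bounded_ln[OF _ mb(2) Db_ge Mb] in blast)
    have i2: "set_integrable lborel (?Q b) (\<lambda>x. F x * ln (mb b / m))"
      using F_set_integrable[OF l2] by simp
    have i3: "set_integrable lborel (?Q b) (\<lambda>x. Db b x - mb b)"
      by (rule set_integrable_halfcube[OF l2, where M = "\<bar>Mb b\<bar>"], use Db_borel[of b] in measurable)
         (use Db_ge[of b] Mb[of b] mb(2)[of b] in \<open>smt (verit)\<close>)
    have i4: "set_integrable lborel (?Q b) (\<lambda>x. mb b - m)"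
      by (rule set_integrable_halfcube[OF l2]) auto
    \<comment> \<open>Telescoping: on a child, ln (D / m) splits into the part covered by the
      induction hypothesis and the single increment ln (mb / m).\<close>
    have "(LINT x:?Q b|lborel. F x * ln (D x / m)) =
        (LINT x:?Q b|lborel. F x * ln (Db b x / mb b) + F x * ln (mb b / m))"
    proof (rule set_lebesgue_integral_cong)
      show "\<forall>x. x \<in> ?Q b \<longrightarrow> F x * ln (D x / m) = F x * ln (Db b x / mb b) + F x * ln (mb b / m)"
      proof (intro allI impI)
        fix x assume "x \<in> ?Q b"
        then have "D x = Db b x" by (rule D_Q[OF b])
        moreover have "0 < Db b x" using Db_ge[of b x] mb(2)[of b] by linarith
        ultimately show "F x * ln (D x / m) = F x * ln (Db b x / mb b) + F x * ln (mb b / m)"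
          using mb(2)[of b] Suc.prems(2) by (simp add: ln_div algebra_simps)
      qed
    qed simp
    also have "\<dots> = (LINT x:?Q b|lborel. F x * ln (Db b x / mb b)) + ?A b * ln (mb b / m)"
      by (subst set_integral_add(2)[OF i1 i2]) simp
    also have "\<dots> \<le> 2 ^ ?N * (LINT x:?Q b|lborel. Db b x - mb b) + 2 ^ ?N * ((mb b - m) * (l/2) ^ ?N)"
    proof (rule add_mono)
      show "(LINT x:?Q b|lborel. F x * ln (Db b x / mb b)) \<le> 2 ^ ?N * (LINT x:?Q b|lborel. Db b x - mb b)"
        by (rule dyadic_maximalD(6)[OF Db])
      \<comment> \<open>The child's integral is at most the parent's, so at most 2^N m times the
        child's volume. With ln t \<le> t - 1, the factor m cancels and the increment costs 2^N (mb
        - m) times that volume.\<close>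
      have "?A b \<le> (LINT x:halfcube a l|lborel. F x)"
        unfolding set_lebesgue_integral_def
        by (rule Bochner_Integration.integral_mono)
           (use F_set_integrable[OF l2] F_set_integrable[OF Suc.prems(1)] Q F0 in
             \<open>auto simp: set_integrable_def indicator_def\<close>)
      then have A: "?A b \<le> m * l ^ ?N" using Suc.prems(3) unfolding average_le_def by linarith
      have "0 \<le> ln (mb b / m)" using mb(1)[of b] Suc.prems(2) by (intro ln_ge_zero) simp
      moreover have "ln (mb b / m) \<le> mb b / m - 1"
        using mb(2)[of b] Suc.prems(2) by (intro ln_le_minus_one) simp
      ultimately have "?A b * ln (mb b / m) \<le> (m * l ^ ?N) * (mb b / m - 1)"
        using A Suc.prems by (intro mult_mono) auto
      also have "\<dots> = 2 ^ ?N * ((mb b - m) * (l/2) ^ ?N)"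
        using Suc.prems(2) by (simp add: field_simps)
      finally show "?A b * ln (mb b / m) \<le> 2 ^ ?N * ((mb b - m) * (l/2) ^ ?N)" .
    qed
    also have "\<dots> = 2 ^ ?N * (LINT x:?Q b|lborel. (Db b x - mb b) + (mb b - m))"
      by (subst set_integral_add(2)[OF i3 i4])
         (simp only: set_integral_halfcube_const[OF l2] distrib_left)
    also have "(LINT x:?Q b|lborel. (Db b x - mb b) + (mb b - m)) = (LINT x:?Q b|lborel. D x - m)"
      by (rule set_lebesgue_integral_cong) (auto simp: D_Q[OF b])
    finally show ?thesis .
  qed
  have "(LINT x:halfcube a l|lborel. F x * ln (D x / m)) \<le> 2 ^ ?N * (LINT x:halfcube a l|lborel. D x - m)"
    unfolding set_integral_split_children[OF Suc.prems(1) int_ln] set_integral_split_children[OF Suc.prems(1) int_D]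
      sum_distrib_left
    by (intro sum_mono step)
  with D_borel D_ge D_le c4 c5 show ?case
    unfolding dyadic_maximal_def by (intro exI[of _ D]) auto
qed

text \<open>Starting at level 1 gives D \<ge> 1. At a depth where F oscillates by less than 1 on the
  finest cubes, F \<le> D + 1, and this is at most 2 D.\<close>

lemma LlnL_bound:
  assumes l: "0 < l" and av: "average_le a l 1"
  obtains D where "D \<in> borel_measurable borel" "\<exists>M. \<forall>x. D x \<le> M" "\<And>x. 1 \<le> D x"
    "\<And>x c. x \<in> halfcube a l \<Longrightarrow> 1 \<le> c \<Longrightarrow> subaverages_le a l x c \<Longrightarrow> D x \<le> c"
    "\<And>x. x \<in> halfcube a l \<Longrightarrow> F x \<le> 2 * D x"
    "(LINT x:halfcube a l|lborel. F x * ln (D x)) \<le> 2 ^ CARD('n) * (LINT x:halfcube a l|lborel. D x - 1)"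
proof -
  let ?n = "real CARD('n)"
  \<comment> \<open>The finest cube around \<open>x\<close> is not known to lie in
    \<open>halfcube a l\<close>; since its side is at most \<open>l\<close>, it lies in this
    threefold enlargement.\<close>
  let ?K = "cbox (\<chi> i. a $ i - l) (\<chi> i. a $ i + 2 * l)"
  have "uniformly_continuous_on ?K F"
    by (intro compact_uniformly_continuous continuous_on_subset[OF contF]) auto
  then obtain \<delta> where \<delta>: "\<delta> > 0"
    "\<And>x y. x \<in> ?K \<Longrightarrow> y \<in> ?K \<Longrightarrow> dist y x < \<delta> \<Longrightarrow> dist (F y) (F x) < 1"
    unfolding uniformly_continuous_on_def by (metis zero_less_one)
  obtain k :: nat where k: "?n * l / \<delta> < 2 ^ k"
    using real_arch_pow[of 2 "?n * l / \<delta>"] by auto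
  let ?l = "l / 2 ^ k"
  have lk: "?n * ?l < \<delta>" using k \<delta>(1) by (simp add: field_simps)
  have l0: "0 < ?l" using l by simp
  have ll: "?l \<le> l" using l by (simp add: divide_le_eq mult_le_cancel_left1)
  obtain D where D: "dyadic_maximal a l 1 k D"
    using dyadic_maximal_exists[OF l zero_less_one av] by blast
  note D = dyadic_maximalD[OF D]
  have "F x \<le> 2 * D x" if x: "x \<in> halfcube a l" for x
  proof -
    obtain a' where a': "x \<in> halfcube a' ?l" "(LINT x:halfcube a' ?l|lborel. F x) \<le> D x * ?l ^ CARD('n)"
      using D(5)[OF x] unfolding average_le_def by blast
    have "F x - 1 \<le> F y" if "y \<in> halfcube a' ?l" for y
    proof -
      have xy: "\<bar>x $ i - y $ i\<bar> \<le> ?l" for i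
      proof -
        have "a' $ i \<le> x $ i \<and> x $ i < a' $ i + ?l" "a' $ i \<le> y $ i \<and> y $ i < a' $ i + ?l"
          using a'(1) that by (simp_all add: halfcube_def)
        then show ?thesis by linarith
      qed
      have "a $ i - l \<le> y $ i \<and> y $ i \<le> a $ i + 2 * l \<and> a $ i - l \<le> x $ i \<and> x $ i \<le> a $ i + 2 * l" for i
      proof -
        have "a $ i \<le> x $ i \<and> x $ i < a $ i + l" using x by (simp add: halfcube_def)
        then show ?thesis using xy[of i] ll l by linarith
      qed
      then have K: "x \<in> ?K" "y \<in> ?K" by (simp_all add: mem_box_cart)
      have "\<bar>(x - y) $ i\<bar> \<le> ?l" for i using xy by simp
      then have "(\<Sum>i\<in>UNIV. \<bar>(x - y) $ i\<bar>) \<le> ?n * ?l"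
        by (intro sum_bounded_above) auto
      then have "dist x y < \<delta>"
        using norm_le_l1_cart[of "x - y"] lk by (simp add: dist_norm)
      then have "dist (F x) (F y) < 1" by (rule \<delta>(2)[OF K(2,1)])
      then show ?thesis by (simp add: dist_real_def)
    qed
    then have "(LINT y:halfcube a' ?l|lborel. F x - 1) \<le> (LINT y:halfcube a' ?l|lborel. F y)"
      by (intro set_integral_mono F_set_integrable l0)
         (auto intro!: set_integrable_halfcube[OF l0])
    then have "(F x - 1) * ?l ^ CARD('n) \<le> D x * ?l ^ CARD('n)"
      using a'(2) by (simp only: set_integral_halfcube_const[OF l0])
    then have "F x - 1 \<le> D x" using l0 by (subst (asm) mult_le_cancel_right_pos) simp
    then show ?thesis using D(3)[of x] by linarith
  qed
  with D(1-4) D(6) show ?thesis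
    by (intro that[of D]) auto
qed

end

end

section \<open>Estimates for test functions\<close>

lemma nn_integral_cbox:
  fixes f :: "real^'n::finite \<Rightarrow> real"
  assumes "continuous_on UNIV f" "\<And>x. 0 \<le> f x"
  shows "(\<integral>\<^sup>+y\<in>cbox a b. ennreal (f y) \<partial>lebesgue) = ennreal (integral (cbox a b) f)"
  unfolding nn_integral_completion
  by (rule nn_integral_has_integral_lebesgue')
     (use assms in \<open>auto intro!: integrable_integral integrable_ucube\<close>)

text \<open>A cube centred at \<open>x\<close> may stick out of \<open>Q0\<close>, where it is not
  admissible. As \<open>f\<close> vanishes outside, a cube inside \<open>Q0\<close> that contains
  \<open>x\<close> and the inner part of the centred cube captures the same integral. Its side is no
  larger, so the average can only grow.\<close>

lemma centred_average_le_maximal_fn: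
  fixes f :: "real^'n::finite \<Rightarrow> real"
  assumes cont: "continuous_on UNIV f" and Q0: "axis_cube Q0" and zero: "\<And>x. x \<notin> Q0 \<Longrightarrow> f x = 0"
    and x: "x \<in> Q0" and s: "0 < s"
  shows "ennreal (integral ucube (\<lambda>z. \<bar>f (x + s *\<^sub>R z)\<bar>) / 2 ^ CARD('n)) \<le> maximal_fn Q0 f x"
proof -
  let ?N = "CARD('n)"
  obtain q L where L: "0 < L" and Q0_eq: "Q0 = cbox q (\<chi> i. q $ i + L)"
    using Q0 unfolding axis_cube_def by blast
  have cabs: "continuous_on UNIV (\<lambda>x. \<bar>f x\<bar>)" by (intro continuous_intros cont)
  \<comment> \<open>The side is cut to that of \<open>Q0\<close> if necessary, and then the lower
    corner is clamped coordinatewise so that the cube slides into \<open>Q0\<close>.\<close>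
  define t where "t = min (2 * s) L"
  define c where "c = (\<chi> i. max (q $ i) (min (x $ i - s) (q $ i + L - t)))"
  define Q where "Q = cbox c (\<chi> i. c $ i + t)"
  have t: "0 < t" "t \<le> 2 * s" using s L by (auto simp: t_def)
  have xi: "q $ i \<le> x $ i \<and> x $ i \<le> q $ i + L" for i using x by (simp add: Q0_eq mem_box_cart)
  have ci: "c $ i = max (q $ i) (min (x $ i - s) (q $ i + L - t))" for i by (simp add: c_def)
  have "q $ i \<le> c $ i \<and> c $ i + t \<le> q $ i + L" for i
    unfolding ci t_def by linarith
  then have "q $ i \<le> y $ i \<and> y $ i \<le> q $ i + L" if "y \<in> Q" for y i
    using that order_trans unfolding Q_def mem_box_cart vec_lambda_beta by blast
  then have "Q \<subseteq> Q0" unfolding Q0_eq by (auto simp: mem_box_cart)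
  have "c $ i \<le> x $ i \<and> x $ i \<le> c $ i + t" for i
    using xi[of i] s unfolding ci t_def by linarith
  then have xQ: "x \<in> Q" by (simp add: Q_def mem_box_cart)
  have sub: "y \<in> Q" if "y \<in> cbox (x - s *\<^sub>R 1) (x + s *\<^sub>R 1)" "y \<in> Q0" for y
  proof -
    have "c $ i \<le> y $ i \<and> y $ i \<le> c $ i + t" for i
    proof -
      have "x $ i - s \<le> y $ i \<and> y $ i \<le> x $ i + s" "q $ i \<le> y $ i \<and> y $ i \<le> q $ i + L"
        using that by (simp_all add: Q0_eq mem_box_cart)
      then show ?thesis using xi[of i] s unfolding ci t_def by linarith
    qed
    then show ?thesis by (simp add: Q_def mem_box_cart)
  qed
  let ?J = "integral (cbox (x - s *\<^sub>R 1) (x + s *\<^sub>R 1)) (\<lambda>y. \<bar>f y\<bar>)"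
  let ?I = "integral Q (\<lambda>y. \<bar>f y\<bar>)"
  have "ennreal ?J \<le> ennreal ?I"
    unfolding Q_def nn_integral_cbox[OF cabs abs_ge_zero, symmetric]
    by (rule nn_integral_mono) (use sub zero in \<open>auto simp: indicator_def Q_def\<close>)
  moreover have I0: "0 \<le> ?I" unfolding Q_def by (intro integral_nonneg integrable_ucube cabs) simp
  ultimately have JI: "?J \<le> ?I" by (simp add: ennreal_le_iff)
  have "integral ucube (\<lambda>z. \<bar>f (x + s *\<^sub>R z)\<bar>) / 2 ^ ?N = ?J / (2 * s) ^ ?N"
    using integral_ucube_scale[OF cabs s, of x] by (simp add: power_mult_distrib mult.commute)
  also have "\<dots> \<le> ?I / t ^ ?N"
    using t s JI I0 by (intro frac_le power_mono) auto
  finally have "ennreal (integral ucube (\<lambda>z. \<bar>f (x + s *\<^sub>R z)\<bar>) / 2 ^ ?N) \<le> ennreal (?I / t ^ ?N)"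
    by (rule ennreal_leI)
  also have "\<dots> = (\<integral>\<^sup>+y\<in>Q. ennreal \<bar>f y\<bar> \<partial>lebesgue) / emeasure lebesgue Q"
    unfolding Q_def nn_integral_cbox[OF cabs abs_ge_zero]
    using t I0 by (simp add: emeasure_cube divide_ennreal Q_def)
  also have "\<dots> \<le> maximal_fn Q0 f x"
    unfolding maximal_fn_def
    by (rule SUP_upper) (use \<open>Q \<subseteq> Q0\<close> xQ t in \<open>auto simp: axis_cube_def Q_def\<close>)
  finally show ?thesis .
qed

text \<open>Passes from positive real bounds \<open>a\<close> to the extended real maximal function.
  An infinite value is trivial; a finite one, possibly 0, is approached by positive \<open>a\<close>
  from above.\<close>

lemma le_maximal_fn:
  fixes f :: "real^'n::finite \<Rightarrow> real"
  assumes cont: "continuous_on UNIV f" and Q0: "axis_cube Q0" and zero: "\<And>x. x \<notin> Q0 \<Longrightarrow> f x = 0"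
    and x: "x \<in> Q0" and K: "0 < K"
    and c: "\<And>a. 0 < a \<Longrightarrow> (\<And>s. 0 < s \<Longrightarrow> integral ucube (\<lambda>z. \<bar>f (x + s *\<^sub>R z)\<bar>) \<le> a) \<Longrightarrow> c \<le> K * a"
  shows "ennreal (c / (K * 2 ^ CARD('n))) \<le> maximal_fn Q0 f x"
proof (cases "maximal_fn Q0 f x")
  case (real M)
  let ?v = "2 ^ CARD('n) :: real"
  have "c \<le> K * (?v * M) + \<epsilon>" if "0 < \<epsilon>" for \<epsilon>
  proof -
    have "c \<le> K * (?v * M + \<epsilon> / K)"
    proof (rule c)
      show "0 < ?v * M + \<epsilon> / K" using real(1) that K by (intro add_nonneg_pos) auto
      fix s :: real assume s: "0 < s"
      have "integral ucube (\<lambda>z. \<bar>f (x + s *\<^sub>R z)\<bar>) / ?v \<le> M"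
        using centred_average_le_maximal_fn[OF cont Q0 zero x s] real by (simp add: ennreal_le_iff)
      then have "integral ucube (\<lambda>z. \<bar>f (x + s *\<^sub>R z)\<bar>) \<le> ?v * M"
        by (simp add: divide_le_eq mult.commute)
      then show "integral ucube (\<lambda>z. \<bar>f (x + s *\<^sub>R z)\<bar>) \<le> ?v * M + \<epsilon> / K"
        using that K by (simp add: add_increasing2)
    qed
    then show ?thesis using K by (simp add: distrib_left)
  qed
  then have "c \<le> K * (?v * M)" by (rule field_le_epsilon)
  then have "c / (K * ?v) \<le> M" using K by (simp add: divide_le_eq mult_ac)
  then show ?thesis using real by (simp add: ennreal_leI)
qed simp

section \<open>Averages and L ln L size of the test density\<close>

definition test_density :: "('n::finite \<Rightarrow> real^'n \<Rightarrow> real) \<Rightarrow> ('n \<Rightarrow> real^'n \<Rightarrow> real) \<Rightarrow> real^'n \<Rightarrow> real" where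
  "test_density e d x = \<bar>\<Sum>i\<in>UNIV. d i x\<bar> + (\<Sum>i\<in>UNIV. (e i x)\<^sup>2)"

text \<open>A half-open cube containing \<open>x\<close> lies in the centred cube of half side
  \<open>l'\<close>. There the Laplacian is bounded by assumption and the gradient by
  \<open>gradient_maximal\<close> at a comparable scale, once the weight \<open>bump 2\<close> is
  bounded below.\<close>

lemma test_density_average:
  "\<exists>K>0. \<forall>(\<eta> :: real^'n::finite \<Rightarrow> real) e d (a::real) x a' l'. C2_function \<eta> e d \<longrightarrow> (\<forall>y. 0 \<le> \<eta> y \<and> \<eta> y \<le> 1) \<longrightarrow> 0 < a \<longrightarrow>
     (\<forall>s>0. integral ucube (\<lambda>z. \<bar>\<Sum>i\<in>UNIV. d i (x + s *\<^sub>R z)\<bar>) \<le> a) \<longrightarrow>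
     0 < l' \<longrightarrow> x \<in> halfcube a' l' \<longrightarrow> average_le (test_density e d) a' l' (K * a)"
  (is "\<exists>K>0. \<forall>\<eta> e d a x a' l'. ?P K \<eta> e d a x a' l'")
proof -
  obtain C where C: "0 < C" and grad: "\<And>\<eta> e d (a::real) (x::real^'n) (r::real). C2_function \<eta> e d \<Longrightarrow> (\<forall>y. 0 \<le> \<eta> y \<and> \<eta> y \<le> 1) \<Longrightarrow>
     0 < a \<Longrightarrow> 0 < r \<Longrightarrow> (\<forall>s>0. integral ucube (\<lambda>z. \<bar>\<Sum>i\<in>UNIV. d i (x + s *\<^sub>R z)\<bar>) \<le> a) \<Longrightarrow>
     integral ucube (\<lambda>z. bump 2 z * (\<Sum>i\<in>UNIV. (e i (x + r *\<^sub>R z))\<^sup>2)) \<le> C * a"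
    using gradient_maximal[where 'n = 'n] by blast
  let ?n = "real CARD('n)" and ?N = "CARD('n)"
  define K where "K = 1 + 2 * (2 * ?n) ^ ?N * C"
  have "0 < K" unfolding K_def using C by (intro add_pos_nonneg) auto
  moreover have "?P K \<eta> e d a x a' l'" for \<eta> :: "real^'n \<Rightarrow> real" and e d and a :: real and x a' l'
  proof (intro impI)
    assume C2: "C2_function \<eta> e d" and \<eta>: "\<forall>y. 0 \<le> \<eta> y \<and> \<eta> y \<le> 1" and a: "0 < a"
      and b: "\<forall>s>0. integral ucube (\<lambda>z. \<bar>\<Sum>i\<in>UNIV. d i (x + s *\<^sub>R z)\<bar>) \<le> a"
      and l': "0 < l'" and x: "x \<in> halfcube a' l'"
    interpret C2_function \<eta> e d by fact
    let ?f = "\<lambda>y. \<bar>lap y\<bar>" and ?g = "\<lambda>y. \<Sum>i\<in>UNIV. (e i y)\<^sup>2"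
    have cf: "continuous_on UNIV ?f" by (intro continuous_intros cont_lap)
    have cg: "continuous_on UNIV ?g" by (intro continuous_intros cont_e)
    have cd: "continuous_on UNIV (test_density e d)" unfolding test_density_def[abs_def] by (intro continuous_intros cf cg)
    have d0: "0 \<le> test_density e d y" for y by (simp add: test_density_def sum_nonneg)
    let ?S = "cbox (x - l' *\<^sub>R 1) (x + l' *\<^sub>R 1)"
    \<comment> \<open>At this radius every rescaled coordinate is at most 1 / (2 N), so the squared
      norm is at most 1/4 and \<open>bump 2\<close> is at least 9/16, hence 1/2, on the smaller
      cube. Here N = \<open>?n\<close>.\<close>
    define r where "r = 2 * ?n * l'"
    have n1: "1 \<le> ?n" using zero_less_card_finite[where 'a = 'n] by (simp add: Suc_leI)
    have r: "0 < r" using l' n1 by (simp add: r_def)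
    have "1 \<le> 2 * ?n" using n1 by linarith
    from mult_right_mono[OF this, of l'] have lr: "l' \<le> r" using l' by (simp add: r_def)

    have "integral ?S ?f = l' ^ ?N * integral ucube (\<lambda>z. ?f (x + l' *\<^sub>R z))"
      using integral_ucube_scale[OF cf l', of x] l' by simp
    also have "\<dots> \<le> l' ^ ?N * a" using b l' by (intro mult_left_mono) auto
    finally have If: "integral ?S ?f \<le> l' ^ ?N * a" .

    let ?h = "\<lambda>y. bump 2 ((1 / r) *\<^sub>R (y - x)) * ?g y"
    let ?R = "cbox (x - r *\<^sub>R 1) (x + r *\<^sub>R 1)"
    have cb: "continuous_on UNIV (\<lambda>y. bump 2 ((1 / r) *\<^sub>R (y - x)))"
      by (intro continuous_on_compose2[OF continuous_on_bump[of UNIV]] continuous_intros) simp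
    have ch: "continuous_on UNIV ?h" by (intro continuous_intros cb cg)
    have h0: "0 \<le> ?h y" for y by (simp add: bump_nonneg sum_nonneg)
    have SR: "?S \<subseteq> ?R"
    proof
      fix y assume y: "y \<in> ?S"
      have "x $ i - r \<le> y $ i \<and> y $ i \<le> x $ i + r" for i
      proof -
        have "x $ i - l' \<le> y $ i \<and> y $ i \<le> x $ i + l'" using y by (simp add: mem_box_cart)
        then show ?thesis using lr by linarith
      qed
      then show "y \<in> ?R" by (simp add: mem_box_cart)
    qed
    have "integral ?S ?g \<le> integral ?S (\<lambda>y. 2 * ?h y)"
    proof (intro integral_le integrable_ucube cg continuous_on_mult_left ch)
      fix y assume y: "y \<in> ?S"
      let ?z = "(1 / r) *\<^sub>R (y - x)"
      have "?z $ i * ?z $ i \<le> 1 / (4 * ?n\<^sup>2)" for i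
      proof -
        have "x $ i - l' \<le> y $ i \<and> y $ i \<le> x $ i + l'" using y by (simp add: mem_box_cart)
        then have "\<bar>y $ i - x $ i\<bar> \<le> l'" by linarith
        then have "\<bar>?z $ i\<bar> \<le> 1 / (2 * ?n)"
          using l' n1 by (simp add: r_def abs_mult field_simps)
        then have "\<bar>?z $ i\<bar>\<^sup>2 \<le> (1 / (2 * ?n))\<^sup>2" by (rule power_mono) simp
        then show ?thesis by (simp add: power2_eq_square)
      qed
      then have "?z \<bullet> ?z \<le> ?n * (1 / (4 * ?n\<^sup>2))"
        unfolding inner_vec_def inner_real_def by (intro sum_bounded_above)
      also have "\<dots> \<le> 1 / 4" using n1 by (simp add: power2_eq_square field_simps)
      finally have "3 / 4 \<le> 1 - ?z \<bullet> ?z" by linarith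
      then have "3 / 4 \<le> max 0 (1 - ?z \<bullet> ?z)" by (rule max.coboundedI2)
      then have "(3 / 4)\<^sup>2 \<le> bump 2 ?z" unfolding bump_def by (rule power_mono) simp
      then have "1 / 2 \<le> bump 2 ?z" by (simp add: power2_eq_square)
      then have "(1 / 2) * ?g y \<le> ?h y" by (intro mult_right_mono) (auto intro: sum_nonneg)
      then show "?g y \<le> 2 * ?h y" by simp
    qed
    also have "\<dots> = 2 * integral ?S ?h" by simp
    also have "integral ?S ?h \<le> integral ?R ?h"
      by (intro integral_subset_le SR integrable_ucube ch) (use h0 in blast)
    also have "integral ?R ?h = r ^ ?N * integral ucube (\<lambda>z. ?h (x + r *\<^sub>R z))"
      using integral_ucube_scale[OF ch r, of x] r by simp
    also have "(\<lambda>z. ?h (x + r *\<^sub>R z)) = (\<lambda>z. bump 2 z * (\<Sum>i\<in>UNIV. (e i (x + r *\<^sub>R z))\<^sup>2))"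
      using r by simp
    also have "r ^ ?N * integral ucube \<dots> \<le> r ^ ?N * (C * a)"
      using grad[OF C2 \<eta> a r b] r by (intro mult_left_mono) auto
    finally have Ig: "integral ?S ?g \<le> 2 * (r ^ ?N * (C * a))" by simp

    have "ennreal (LINT y:halfcube a' l'|lborel. test_density e d y) =
        (\<integral>\<^sup>+y\<in>halfcube a' l'. ennreal (test_density e d y) \<partial>lborel)"
      unfolding set_lebesgue_integral_def
      by (subst nn_integral_eq_integral[symmetric])
         (use F_set_integrable[OF cd d0 l'] d0 in \<open>auto simp: set_integrable_def indicator_def intro!: nn_integral_cong\<close>)
    also have "\<dots> \<le> (\<integral>\<^sup>+y\<in>?S. ennreal (test_density e d y) \<partial>lborel)"
    proof (rule nn_integral_mono)
      fix y
      have "y \<in> ?S" if "y \<in> halfcube a' l'"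
      proof -
        have "x $ i - l' \<le> y $ i \<and> y $ i \<le> x $ i + l'" for i
        proof -
          have "a' $ i \<le> x $ i \<and> x $ i < a' $ i + l'" "a' $ i \<le> y $ i \<and> y $ i < a' $ i + l'"
            using x that by (simp_all add: halfcube_def)
          then show ?thesis by linarith
        qed
        then show ?thesis by (simp add: mem_box_cart)
      qed
      then show "ennreal (test_density e d y) * indicator (halfcube a' l') y \<le> ennreal (test_density e d y) * indicator ?S y"
        by (auto simp: indicator_def)
    qed
    also have "\<dots> = ennreal (integral ?S (test_density e d))"
      using nn_integral_cbox[OF cd d0] by (simp add: nn_integral_completion)
    finally have "(LINT y:halfcube a' l'|lborel. test_density e d y) \<le> integral ?S (test_density e d)"
      using integral_nonneg[OF integrable_ucube[OF cd], of "x - l' *\<^sub>R 1" "x + l' *\<^sub>R 1"] d0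
      by (simp add: ennreal_le_iff)
    also have "\<dots> = integral ?S ?f + integral ?S ?g"
      unfolding test_density_def[abs_def] by (rule Henstock_Kurzweil_Integration.integral_add[OF cf[THEN integrable_ucube] cg[THEN integrable_ucube]])
    also have "\<dots> \<le> l' ^ ?N * a + 2 * (r ^ ?N * (C * a))" by (rule add_mono[OF If Ig])
    also have "\<dots> = K * a * l' ^ ?N"
      by (simp add: K_def r_def power_mult_distrib algebra_simps)
    finally show "average_le (test_density e d) a' l' (K * a)" by (simp add: average_le_def)
  qed
  ultimately show ?thesis by blast
qed

text \<open>Both the integral of F and that of D - 1 arise by integrating pointwise lower bounds for
  M[\<Delta>\<eta>]. The condition C \<epsilon> \<le> l^N forces the mean of F over the whole cube
  below 1, so the dyadic construction may start at level 1.\<close>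

lemma LlnL_test_function:
  "\<exists>C>0. \<forall>(\<eta> :: real^'n::finite \<Rightarrow> real) e d q l \<epsilon>. C2_function \<eta> e d \<longrightarrow> (\<forall>y. 0 \<le> \<eta> y \<and> \<eta> y \<le> 1) \<longrightarrow> 0 < l \<longrightarrow>
     (\<forall>y. y \<notin> cbox q (\<chi> i. q $ i + l) \<longrightarrow> (\<Sum>i\<in>UNIV. d i y) = 0) \<longrightarrow>
     (\<integral>\<^sup>+x\<in>cbox q (\<chi> i. q $ i + l). maximal_fn (cbox q (\<chi> i. q $ i + l)) (\<lambda>y. \<Sum>i\<in>UNIV. d i y) x \<partial>lebesgue) \<le> ennreal \<epsilon> \<longrightarrow>
     0 < \<epsilon> \<longrightarrow> C * \<epsilon> \<le> l ^ CARD('n) \<longrightarrow>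
     (\<exists>D. D \<in> borel_measurable borel \<and> (\<forall>x. 1 \<le> D x) \<and> (\<forall>x\<in>halfcube q l. test_density e d x \<le> 2 * D x) \<and>
        set_integrable lborel (halfcube q l) (\<lambda>x. test_density e d x * (1 + ln (D x))) \<and>
        (LINT x:halfcube q l|lborel. test_density e d x * (1 + ln (D x))) \<le> C * \<epsilon>)"
  (is "\<exists>C>0. \<forall>\<eta> e d q l \<epsilon>. ?P C \<eta> e d q l \<epsilon>")
proof -
  obtain K where K: "0 < K" and avg: "\<And>\<eta> e d (a::real) (x::real^'n) a' l'. C2_function \<eta> e d \<Longrightarrow> (\<forall>y. 0 \<le> \<eta> y \<and> \<eta> y \<le> 1) \<Longrightarrow>
     0 < a \<Longrightarrow> (\<forall>s>0. integral ucube (\<lambda>z. \<bar>\<Sum>i\<in>UNIV. d i (x + s *\<^sub>R z)\<bar>) \<le> a) \<Longrightarrow>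
     0 < l' \<Longrightarrow> x \<in> halfcube a' l' \<Longrightarrow> average_le (test_density e d) a' l' (K * a)"
    using test_density_average[where 'n = 'n] by blast
  let ?N = "CARD('n)" and ?v = "2 ^ CARD('n) :: real"
  define K2 where "K2 = K * ?v"
  define C where "C = (1 + ?v) * K2"
  have K2: "0 < K2" using K by (simp add: K2_def)
  have "K2 \<le> C" using K2 by (simp add: C_def)
  then have "0 < C" using K2 by simp
  moreover have "?P C \<eta> e d q l \<epsilon>" for \<eta> :: "real^'n \<Rightarrow> real" and e d q l \<epsilon>
  proof (intro impI)
    let ?Q0 = "cbox q (\<chi> i. q $ i + l)" and ?H = "halfcube q l" and ?F = "test_density e d"
    let ?M = "maximal_fn ?Q0 (\<lambda>y. \<Sum>i\<in>UNIV. d i y)"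
    assume C2: "C2_function \<eta> e d" and \<eta>: "\<forall>y. 0 \<le> \<eta> y \<and> \<eta> y \<le> 1" and l: "0 < l"
      and zero: "\<forall>y. y \<notin> ?Q0 \<longrightarrow> (\<Sum>i\<in>UNIV. d i y) = 0"
      and M: "(\<integral>\<^sup>+x\<in>?Q0. ?M x \<partial>lebesgue) \<le> ennreal \<epsilon>"
      and \<epsilon>: "0 < \<epsilon>" "C * \<epsilon> \<le> l ^ ?N"
    interpret C2_function \<eta> e d by fact
    have cd: "continuous_on UNIV ?F" unfolding test_density_def[abs_def] by (intro continuous_intros cont_lap cont_e cont_d)
    have d0: "0 \<le> ?F y" for y by (simp add: test_density_def sum_nonneg)
    have ax: "axis_cube ?Q0" using l unfolding axis_cube_def by blast
    have HQ: "?H \<subseteq> ?Q0" by (rule halfcube_subset_cbox)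
    have le_M: "ennreal (c / K2) \<le> ?M x"
      if x: "x \<in> ?H" and c: "\<And>a. 0 < a \<Longrightarrow>
         (\<And>a' l'. 0 < l' \<Longrightarrow> x \<in> halfcube a' l' \<Longrightarrow> average_le ?F a' l' (K * a)) \<Longrightarrow> c \<le> K * a" for x c
      unfolding K2_def
    proof (rule le_maximal_fn[OF cont_lap ax _ _ K])
      show "x \<in> ?Q0" using x HQ by blast
      fix a :: real assume a: "0 < a" "\<And>s. 0 < s \<Longrightarrow> integral ucube (\<lambda>z. \<bar>lap (x + s *\<^sub>R z)\<bar>) \<le> a"
      show "c \<le> K * a"
        by (rule c[OF a(1)], rule avg[OF C2 \<eta> a(1)]) (use a(2) in auto)
    qed (use zero in blast)
    have integrate: "(LINT x:?H|lborel. g x) \<le> K2 * \<epsilon>"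
      if gm: "set_integrable lborel ?H g" and g0: "\<And>x. 0 \<le> g x" and g: "\<And>x. x \<in> ?H \<Longrightarrow> ennreal (g x / K2) \<le> ?M x" for g
    proof -
      have i: "integrable lborel (\<lambda>x. indicat_real ?H x * (g x / K2))"
        using gm unfolding set_integrable_def by (auto dest: integrable_divide[of _ _ K2] simp: mult_ac)
      have "ennreal ((LINT x:?H|lborel. g x) / K2) = ennreal (LINT x|lborel. indicat_real ?H x * (g x / K2))"
        by (simp add: set_lebesgue_integral_def)
      also have "\<dots> = (\<integral>\<^sup>+x. ennreal (indicat_real ?H x * (g x / K2)) \<partial>lborel)"
        by (rule nn_integral_eq_integral[OF i, symmetric]) (use g0 K2 in auto)
      also have "\<dots> = (\<integral>\<^sup>+x. ennreal (indicat_real ?H x * (g x / K2)) \<partial>lebesgue)"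
        by (simp add: nn_integral_completion)
      also have "\<dots> \<le> (\<integral>\<^sup>+x\<in>?Q0. ?M x \<partial>lebesgue)"
        by (rule nn_integral_mono) (use g HQ in \<open>auto simp: indicator_def\<close>)
      also have "\<dots> \<le> ennreal \<epsilon>" by (rule M)
      finally have "(LINT x:?H|lborel. g x) / K2 \<le> \<epsilon>" using \<epsilon>(1) by (simp add: ennreal_le_iff)
      then show ?thesis using K2 by (simp add: divide_le_eq mult.commute)
    qed
    let ?I = "LINT x:?H|lborel. ?F x"
    \<comment> \<open>The mean over the whole cube is a competitor at every point; integrating this
      constant recovers \<open>?I\<close>.\<close>
    have "(LINT x:?H|lborel. ?I / l ^ ?N) \<le> K2 * \<epsilon>"
    proof (rule integrate)
      show "set_integrable lborel ?H (\<lambda>x. ?I / l ^ ?N)"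
        by (rule set_integrable_halfcube[OF l]) auto
      show "0 \<le> ?I / l ^ ?N" 
        using l d0 unfolding set_lebesgue_integral_def by (intro divide_nonneg_nonneg Bochner_Integration.integral_nonneg) auto
      show "ennreal (?I / l ^ ?N / K2) \<le> ?M x" if x: "x \<in> ?H" for x
      proof (rule le_M[OF x])
        fix a :: real
        assume "\<And>a' l'. 0 < l' \<Longrightarrow> x \<in> halfcube a' l' \<Longrightarrow> average_le ?F a' l' (K * a)"
        from this[OF l x] show "?I / l ^ ?N \<le> K * a"
          using l by (simp add: average_le_def divide_le_eq)
      qed
    qed
    then have I: "?I \<le> K2 * \<epsilon>" using l by (simp add: set_integral_halfcube_const)
    also have "\<dots> \<le> C * \<epsilon>" using \<epsilon> \<open>K2 \<le> C\<close> by (intro mult_right_mono) auto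
    finally have "average_le ?F q l 1" using \<epsilon> by (simp add: average_le_def)
    then obtain D where D: "D \<in> borel_measurable borel" "\<exists>M. \<forall>x. D x \<le> M" "\<And>x. 1 \<le> D x"
      "\<And>x c. x \<in> ?H \<Longrightarrow> 1 \<le> c \<Longrightarrow> subaverages_le ?F q l x c \<Longrightarrow> D x \<le> c"
      "\<And>x. x \<in> ?H \<Longrightarrow> ?F x \<le> 2 * D x"
      "(LINT x:?H|lborel. ?F x * ln (D x)) \<le> ?v * (LINT x:?H|lborel. D x - 1)"
      using LlnL_bound[OF cd d0 l] by blast
    obtain MD where MD: "\<And>x. D x \<le> MD" using D(2) by blast
    have iD: "set_integrable lborel ?H (\<lambda>x. D x - 1)"
    proof (rule set_integrable_halfcube[OF l])
      show "\<bar>D x - 1\<bar> \<le> MD" for x using D(3)[of x] MD[of x] by linarith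
    qed (use D(1) in measurable)
    have "(LINT x:?H|lborel. D x - 1) \<le> K2 * \<epsilon>"
    proof (rule integrate[OF iD])
      show "0 \<le> D x - 1" for x using D(3)[of x] by simp
      show "ennreal ((D x - 1) / K2) \<le> ?M x" if x: "x \<in> ?H" for x
      proof (rule le_M[OF x])
        fix a :: real assume a: "0 < a"
          and av: "\<And>a' l'. 0 < l' \<Longrightarrow> x \<in> halfcube a' l' \<Longrightarrow> average_le ?F a' l' (K * a)"
        have "D x \<le> max 1 (K * a)"
        proof (rule D(4)[OF x])
          have "average_le ?F a' l' (max 1 (K * a))" if "0 < l'" "x \<in> halfcube a' l'" for a' l'
            using av[OF that] that(1) unfolding average_le_def
            by (meson max.cobounded2 mult_right_mono order_trans zero_le_power less_imp_le)
          then show "subaverages_le ?F q l x (max 1 (K * a))" by (simp add: subaverages_le_def)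
        qed simp
        \<comment> \<open>Subtracting 1 removes the floor in the maximum, so the final bound is
          proportional to \<epsilon> with no additive volume term.\<close>
        then show "D x - 1 \<le> K * a" using a K mult_pos_pos[OF K a] by linarith
      qed
    qed
    then have "?v * (LINT x:?H|lborel. D x - 1) \<le> ?v * (K2 * \<epsilon>)" by simp
    from add_mono[OF I order_trans[OF D(6) this]]
    have sum: "?I + (LINT x:?H|lborel. ?F x * ln (D x)) \<le> C * \<epsilon>"
      by (simp only: C_def distrib_right mult_1_left mult.assoc)
    obtain B where B: "\<And>x. x \<in> ?H \<Longrightarrow> \<bar>?F x\<bar> \<le> B" using F_bounded_halfcube[OF cd d0] by blast
    have i2: "set_integrable lborel ?H (\<lambda>x. ?F x * ln (D x))"
    proof (rule set_integrable_halfcube[OF l])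
      show "(\<lambda>x. ?F x * ln (D x)) \<in> borel_measurable borel"
        using D(1) F_borel[OF cd d0] by measurable
      show "\<bar>?F x * ln (D x)\<bar> \<le> B * MD" if "x \<in> ?H" for x
      proof -
        have "0 \<le> ln (D x)" "ln (D x) \<le> D x" using D(3)[of x] by (auto intro: ln_bound)
        then have "\<bar>ln (D x)\<bar> \<le> MD" using MD[of x] by linarith
        then show ?thesis unfolding abs_mult using B[OF that] by (intro mult_mono) auto
      qed
    qed
    have i1: "set_integrable lborel ?H ?F" by (rule F_set_integrable[OF cd d0 l])
    have "set_integrable lborel ?H (\<lambda>x. ?F x * (1 + ln (D x)))"
      using set_integral_add(1)[OF i1 i2] by (simp add: distrib_left)
    moreover have "(LINT x:?H|lborel. ?F x * (1 + ln (D x))) \<le> C * \<epsilon>"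
      using set_integral_add(2)[OF i1 i2] sum by (simp add: distrib_left)
    ultimately show "\<exists>D. D \<in> borel_measurable borel \<and> (\<forall>x. 1 \<le> D x) \<and> (\<forall>x\<in>?H. ?F x \<le> 2 * D x) \<and>
        set_integrable lborel ?H (\<lambda>x. ?F x * (1 + ln (D x))) \<and>
        (LINT x:?H|lborel. ?F x * (1 + ln (D x))) \<le> C * \<epsilon>"
      using D(1,3,5) by blast
  qed
  ultimately show ?thesis by blast
qed

section \<open>Removability\<close>

lemma has_derivative_partial:
  fixes f :: "real^'n::finite \<Rightarrow> real"
  assumes "f differentiable (at x)"
  shows "(f has_derivative (\<lambda>h. \<Sum>i\<in>UNIV. h $ i * partial i f x)) (at x)"
proof -
  let ?F = "frechet_derivative f (at x)"
  have F: "(f has_derivative ?F) (at x)" using assms by (simp add: frechet_derivative_works)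
  then have lin: "linear ?F" by (rule has_derivative_linear)
  have "?F h = (\<Sum>i\<in>UNIV. h $ i * partial i f x)" for h
  proof -
    have "?F h = ?F (\<Sum>i\<in>UNIV. h $ i *\<^sub>R axis i 1)"
      using basis_expansion[of h] by (simp add: scalar_mult_eq_scaleR)
    then show ?thesis
      by (simp add: linear_sum[OF lin] linear_scale[OF lin] partial_def)
  qed
  then have "?F = (\<lambda>h. \<Sum>i\<in>UNIV. h $ i * partial i f x)" by blast
  with F show ?thesis by simp
qed

lemma has_pd_partial:
  fixes f :: "real^'n::finite \<Rightarrow> real"
  assumes "f differentiable (at x)"
  shows "has_pd i f (partial i f x) x"
proof -
  have F: "(f has_derivative frechet_derivative f (at x)) (at (x + 0 *\<^sub>R axis i 1))"
    using assms by (simp add: frechet_derivative_works)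
  have lin: "linear (frechet_derivative f (at x))" using F has_derivative_linear by auto
  have "((\<lambda>t. f (x + t *\<^sub>R axis i 1)) has_derivative (\<lambda>t. frechet_derivative f (at x) (t *\<^sub>R axis i 1))) (at 0)"
    by (rule has_derivative_compose[where f = "\<lambda>t. x + t *\<^sub>R axis i 1" and f' = "\<lambda>t. t *\<^sub>R axis i 1", OF _ F])
       (auto intro!: derivative_eq_intros)
  then show ?thesis
    by (simp add: has_pd_def has_field_derivative_def linear_scale[OF lin] partial_def mult_commute_abs)
qed

text \<open>Regularity is given on \<Omega> only. Off its closed support \<eta> is zero on an open
  set, and this set together with \<Omega> covers the space, so all derivatives exist and are
  continuous globally.\<close>

lemma C2_compact_supportD:
  fixes \<eta> :: "real^'n::finite \<Rightarrow> real"
  assumes "open \<Omega>" "\<eta> \<in> C2_compact_support \<Omega>"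
  shows "C2_function \<eta> (\<lambda>i. partial i \<eta>) (\<lambda>i. partial i (partial i \<eta>))"
    "x \<notin> \<Omega> \<Longrightarrow> \<eta> x = 0" "x \<notin> \<Omega> \<Longrightarrow> partial i \<eta> x = 0" "x \<notin> \<Omega> \<Longrightarrow> partial i (partial i \<eta>) x = 0"
proof -
  define S where "S = closure {x. \<eta> x \<noteq> 0}"
  have ck: "Ck_on 2 \<eta> \<Omega>" and S: "S \<subseteq> \<Omega>"
    using assms(2) by (auto simp: C2_compact_support_def S_def)
  have oS: "open (- S)" unfolding S_def by (rule open_Compl[OF closed_closure])
  have un: "\<Omega> \<union> - S = UNIV" using S by blast
  have zero_S: "(\<forall>x. g differentiable (at x)) \<and> (\<forall>i. \<forall>x\<in>-S. partial i g x = 0)"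
    if g: "\<forall>x\<in>\<Omega>. g differentiable (at x)" "\<forall>x\<in>-S. g x = 0" for g :: "real^'n \<Rightarrow> real"
  proof -
    have d: "(g has_derivative (\<lambda>_. 0)) (at x)" if "x \<in> - S" for x
      by (rule has_derivative_transform_within_open[OF has_derivative_const oS that]) (use g(2) in auto)
    then have "g differentiable (at x)" for x
    proof (cases "x \<in> \<Omega>")
      case False
      then have "x \<in> - S" using un by blast
      then show ?thesis using d unfolding differentiable_def by blast
    qed (use g(1) in blast)
    moreover have "partial i g x = 0" if "x \<in> - S" for x i
      using frechet_derivative_at[OF d[OF that]] by (simp add: partial_def fun_eq_iff)
    ultimately show ?thesis by blast
  qed
  have \<eta>S: "\<forall>x\<in>-S. \<eta> x = 0" using closure_subset[of "{x. \<eta> x \<noteq> 0}"] by (auto simp: S_def)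
  have ck': "\<forall>x\<in>\<Omega>. \<eta> differentiable (at x)" "\<forall>x\<in>\<Omega>. partial i \<eta> differentiable (at x)"
    "continuous_on \<Omega> (partial j (partial i \<eta>))" for i j
    using ck by (simp_all add: numeral_2_eq_2)
  note z1 = zero_S[OF ck'(1) \<eta>S]
  have z2: "(\<forall>x. partial i \<eta> differentiable (at x)) \<and> (\<forall>j. \<forall>x\<in>-S. partial j (partial i \<eta>) x = 0)" for i
    using zero_S[OF ck'(2)] z1 by blast
  have c: "continuous_on UNIV (partial i (partial i \<eta>))" for i
  proof -
    have "continuous_on (- S) (partial i (partial i \<eta>))"
      by (rule continuous_on_eq[OF continuous_on_const[of _ 0]]) (use z2 in auto)
    then show ?thesis
      using continuous_on_open_Un[OF assms(1) oS ck'(3)] un by metis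
  qed
  show "C2_function \<eta> (\<lambda>i. partial i \<eta>) (\<lambda>i. partial i (partial i \<eta>))"
  proof
    show "(\<eta> has_derivative (\<lambda>h. \<Sum>i\<in>UNIV. h $ i * partial i \<eta> x)) (at x)" for x
      using z1 by (blast intro: has_derivative_partial)
    show "has_pd i (partial i \<eta>) (partial i (partial i \<eta>) x) x" for i x
      using z2 by (blast intro: has_pd_partial)
    show "continuous_on UNIV (partial i \<eta>)" for i
      using z2 by (intro differentiable_imp_continuous_on) (auto simp: differentiable_on_def)
  qed (rule c)
  show "\<eta> x = 0" "partial i \<eta> x = 0" "partial i (partial i \<eta>) x = 0" if "x \<notin> \<Omega>"
    using that S \<eta>S z1 z2 by blast+
qed

text \<open>A convex \<open>C\<^sup>2\<close> substitute for the positive part, with its first two derivatives; the first one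
  stays below \<open>1\<close>, which matters because \<open>u\<close> may be unbounded near \<open>K\<close>.\<close>

definition ramp :: "real \<Rightarrow> real" where "ramp t = max 0 t ^ 3 / (1 + max 0 t)\<^sup>2"
definition ramp1 :: "real \<Rightarrow> real" where "ramp1 t = (max 0 t)\<^sup>2 * (3 + max 0 t) / (1 + max 0 t) ^ 3"
definition ramp2 :: "real \<Rightarrow> real" where "ramp2 t = 6 * max 0 t / (1 + max 0 t) ^ 4"

lemma DERIV_ramp: "(ramp has_real_derivative ramp1 t) (at t)"
  unfolding ramp_def[abs_def] ramp1_def
proof (rule DERIV_max_0[where h = "\<lambda>s. s ^ 3 / (1 + s)\<^sup>2" and h' = "\<lambda>s. s\<^sup>2 * (3 + s) / (1 + s) ^ 3"])
  fix s :: real assume s: "0 \<le> s"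
  have "(3 * s\<^sup>2 * (1 + s)\<^sup>2 - s ^ 3 * (2 * (1 + s))) / ((1 + s)\<^sup>2 * (1 + s)\<^sup>2) = s\<^sup>2 * (3 + s) / (1 + s) ^ 3"
  proof -
    have "3 * s\<^sup>2 * (1 + s)\<^sup>2 - s ^ 3 * (2 * (1 + s)) = s\<^sup>2 * (3 + s) * (1 + s)"
      by (simp add: algebra_simps power2_eq_square power3_eq_cube)
    moreover have "X * q / (q\<^sup>2 * q\<^sup>2) = X / q ^ 3" if "q \<noteq> 0" for X q :: real
      using that by (simp add: power2_eq_square power3_eq_cube)
    ultimately show ?thesis using s by simp
  qed
  moreover have "((\<lambda>s. s ^ 3 / (1 + s)\<^sup>2) has_real_derivative
      (3 * s\<^sup>2 * (1 + s)\<^sup>2 - s ^ 3 * (2 * (1 + s))) / ((1 + s)\<^sup>2 * (1 + s)\<^sup>2)) (at s)"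
    using s by (auto intro!: derivative_eq_intros)
  ultimately show "((\<lambda>s. s ^ 3 / (1 + s)\<^sup>2) has_real_derivative s\<^sup>2 * (3 + s) / (1 + s) ^ 3) (at s)" by simp
qed auto

lemma DERIV_ramp1: "(ramp1 has_real_derivative ramp2 t) (at t)"
  unfolding ramp1_def[abs_def] ramp2_def
proof (rule DERIV_max_0[where h = "\<lambda>s. s\<^sup>2 * (3 + s) / (1 + s) ^ 3" and h' = "\<lambda>s. 6 * s / (1 + s) ^ 4"])
  fix s :: real assume s: "0 \<le> s"
  have "((2 * s * (3 + s) + s\<^sup>2) * (1 + s) ^ 3 - s\<^sup>2 * (3 + s) * (3 * (1 + s)\<^sup>2)) / ((1 + s) ^ 3 * (1 + s) ^ 3) = 6 * s / (1 + s) ^ 4"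
  proof -
    have "(2 * s * (3 + s) + s\<^sup>2) * (1 + s) ^ 3 - s\<^sup>2 * (3 + s) * (3 * (1 + s)\<^sup>2) = 6 * s * (1 + s)\<^sup>2"
      by (simp add: algebra_simps power2_eq_square power3_eq_cube)
    moreover have "X * q\<^sup>2 / (q ^ 3 * q ^ 3) = X / q ^ 4" if "q \<noteq> 0" for X q :: real
      using that by (simp add: power2_eq_square power3_eq_cube power4_eq_xxxx)
    ultimately show ?thesis using s by simp
  qed
  moreover have "((\<lambda>s. s\<^sup>2 * (3 + s) / (1 + s) ^ 3) has_real_derivative
      ((2 * s * (3 + s) + s\<^sup>2) * (1 + s) ^ 3 - s\<^sup>2 * (3 + s) * (3 * (1 + s)\<^sup>2)) / ((1 + s) ^ 3 * (1 + s) ^ 3)) (at s)"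
    using s by (auto intro!: derivative_eq_intros)
  ultimately show "((\<lambda>s. s\<^sup>2 * (3 + s) / (1 + s) ^ 3) has_real_derivative 6 * s / (1 + s) ^ 4) (at s)" by simp
qed auto

lemma continuous_on_ramp [continuous_intros]:
  "continuous_on S ramp" "continuous_on S ramp1" "continuous_on S ramp2"
  unfolding ramp_def[abs_def] ramp1_def[abs_def] ramp2_def[abs_def]
  by (intro continuous_intros; simp add: add_nonneg_eq_0_iff)+

lemma ramp_bounds: "0 \<le> ramp t" "0 \<le> ramp1 t" "ramp1 t \<le> 1" "0 \<le> ramp2 t" "0 < t \<Longrightarrow> 0 < ramp1 t"
  "t \<le> 0 \<Longrightarrow> ramp t = 0" "t \<le> 0 \<Longrightarrow> ramp1 t = 0" "t \<le> 0 \<Longrightarrow> ramp2 t = 0"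
proof -
  show "ramp1 t \<le> 1"
  proof -
    let ?s = "max 0 t"
    have "?s\<^sup>2 * (3 + ?s) \<le> (1 + ?s) ^ 3"
      by (simp add: power2_eq_square power3_eq_cube algebra_simps)
    then show ?thesis by (simp add: ramp1_def divide_le_eq)
  qed
qed (auto simp: ramp_def ramp1_def ramp2_def max_def)

text \<open>Replaces J by J' u, so that the error term carries the same weight J' as the term on the
  left that is to absorb it.\<close>

lemma ramp_le: "0 \<le> u \<Longrightarrow> t \<le> u \<Longrightarrow> ramp t \<le> ramp1 t * u"
proof -
  assume u: "0 \<le> u" "t \<le> u"
  let ?s = "max 0 t"
  have "ramp t = ?s\<^sup>2 * (1 + ?s) / (1 + ?s) ^ 3 * ?s"
    by (simp add: ramp_def power2_eq_square power3_eq_cube divide_simps add_nonneg_eq_0_iff)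
  also have "\<dots> \<le> ramp1 t * u"
    unfolding ramp1_def using u
    by (intro mult_mono divide_right_mono mult_left_mono) auto
  finally show ?thesis .
qed

text \<open>The difference is nondecreasing by 1 + t/2 \<le> exp (t/2). It lets half of the exponent
  pay for \<open>D\<close> while the other half and the factor \<open>u\<close> remain.\<close>

lemma exp_minus_one_ge:
  assumes "0 \<le> (u :: real)"
  shows "u * exp (u / 2) \<le> exp u - 1"
proof -
  let ?f = "\<lambda>t :: real. exp t - 1 - t * exp (t / 2)"
  have "?f 0 \<le> ?f u"
  proof (rule DERIV_nonneg_imp_nondecreasing[OF assms])
    fix t :: real
    have "1 + t / 2 \<le> exp (t / 2)" by (rule exp_ge_add_one_self)
    then have "(1 + t / 2) * exp (t / 2) \<le> exp (t / 2) * exp (t / 2)" by (intro mult_right_mono) auto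
    also have "\<dots> = exp t" by (simp add: mult_exp_exp)
    finally have "0 \<le> exp t - (exp (t / 2) + t * (exp (t / 2) * (1 / 2)))" by (simp add: algebra_simps)
    moreover have "(?f has_real_derivative exp t - (exp (t / 2) + t * (exp (t / 2) * (1 / 2)))) (at t)"
      by (auto intro!: derivative_eq_intros)
    ultimately show "\<exists>y. (?f has_real_derivative y) (at t) \<and> 0 \<le> y" by blast
  qed
  then show ?thesis by simp
qed

text \<open>If \<zeta>^2 exp (u/2) dominates \<open>D\<close>, the exponential absorbs everything.
  Otherwise u is at most logarithmic in \<open>D\<close> and 1/\<zeta>, and the spare factor \<zeta>
  bounds \<zeta> ln (1/\<zeta>) by 1.\<close>

lemma exp_LlnL_duality:
  fixes \<zeta> u F D :: real
  assumes "0 \<le> \<zeta>" "\<zeta> \<le> 1" "0 \<le> u" "0 \<le> F" "1 \<le> D" "F \<le> 2 * D"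
  shows "u * (9 * \<zeta> * F) \<le> \<zeta> ^ 3 * (exp u - 1) / 2 + 108 * (F * (1 + ln D))"
proof (cases "\<zeta> = 0")
  case True
  then show ?thesis using assms by simp
next
  case False
  then have \<zeta>: "0 < \<zeta>" using assms by simp
  have lnD: "0 \<le> ln D" using assms by simp
  have eu: "0 \<le> exp u - 1" using assms by simp
  show ?thesis
  proof (cases "exp 4 * D \<le> \<zeta>\<^sup>2 * exp (u / 2)")
    case True
    \<comment> \<open>36 collects the factor 9, the 2 of F \<le> 2 D, and the 2 from retaining only
      half of the exponential term.\<close>
    have e4: "36 \<le> exp (4 :: real)"
    proof -
      have "(5/2 :: real) \<le> exp 1" using exp_lower_Taylor_quadratic[of 1] by simp
      then have "(5/2) ^ 4 \<le> exp (1 :: real) ^ 4" by (intro power_mono) auto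
      then have "625 / 16 \<le> exp (4 :: real)" by (simp add: power_divide flip: exp_of_nat_mult)
      then show ?thesis by linarith
    qed
    have "36 * D \<le> exp 4 * D" using e4 assms by (intro mult_right_mono) auto
    with True have D: "36 * D \<le> \<zeta>\<^sup>2 * exp (u / 2)" by linarith
    have "u * (9 * \<zeta> * F) \<le> u * (9 * \<zeta> * (2 * D))"
      using assms by (intro mult_left_mono) auto
    also have "\<dots> = u * \<zeta> * (36 * D) / 2" by simp
    also have "\<dots> \<le> u * \<zeta> * (\<zeta>\<^sup>2 * exp (u / 2)) / 2"
      using assms D by (intro divide_right_mono mult_left_mono) auto
    also have "\<dots> = \<zeta> ^ 3 * (u * exp (u / 2)) / 2" by (simp add: power2_eq_square power3_eq_cube)
    also have "\<dots> \<le> \<zeta> ^ 3 * (exp u - 1) / 2"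
      using assms exp_minus_one_ge by (intro divide_right_mono mult_left_mono) auto
    also have "\<dots> \<le> \<zeta> ^ 3 * (exp u - 1) / 2 + 108 * (F * (1 + ln D))" using assms lnD by simp
    finally show ?thesis .
  next
    case False
    then have "exp (u / 2) \<le> exp 4 * D / \<zeta>\<^sup>2" using \<zeta> by (simp add: field_simps)
    then have "u / 2 \<le> ln (exp 4 * D / \<zeta>\<^sup>2)" using \<zeta> assms by (subst ln_ge_iff) auto
    also have "\<dots> = 4 + ln D - 2 * ln \<zeta>"
      using \<zeta> assms by (simp add: ln_div ln_mult ln_realpow)
    finally have u: "u \<le> 8 + 2 * ln D - 4 * ln \<zeta>" by simp
    have "\<zeta> * - ln \<zeta> \<le> 1"
    proof -
      have "ln (1 / \<zeta>) \<le> 1 / \<zeta>" using \<zeta> by (intro ln_bound) simp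
      then have "- ln \<zeta> \<le> 1 / \<zeta>" using \<zeta> by (simp add: ln_div)
      then have "\<zeta> * - ln \<zeta> \<le> \<zeta> * (1 / \<zeta>)" using \<zeta> by (intro mult_left_mono) auto
      then show ?thesis using \<zeta> by simp
    qed
    moreover have "\<zeta> * ln D \<le> ln D" using assms lnD by (simp add: mult_left_le_one_le)
    moreover have "\<zeta> * u \<le> \<zeta> * (8 + 2 * ln D - 4 * ln \<zeta>)" using u \<zeta> by (intro mult_left_mono) auto
    then have "\<zeta> * u \<le> 8 * \<zeta> + 2 * (\<zeta> * ln D) + 4 * (\<zeta> * - ln \<zeta>)" by (simp add: algebra_simps)
    \<comment> \<open>12 = 8 + 4, the 4 coming from \<zeta> ln (1/\<zeta>) \<le> 1; multiplied by 9
      this gives the constant 108.\<close>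
    ultimately have "\<zeta> * u \<le> 12 * (1 + ln D)" using assms lnD unfolding distrib_left by linarith
    then have "9 * F * (\<zeta> * u) \<le> 9 * F * (12 * (1 + ln D))" using assms by (intro mult_left_mono) auto
    moreover have "0 \<le> \<zeta> ^ 3 * (exp u - 1) / 2" using \<zeta> eu by simp
    moreover have "u * (9 * \<zeta> * F) = 9 * F * (\<zeta> * u)" "9 * F * (12 * (1 + ln D)) = 108 * (F * (1 + ln D))"
      by simp_all
    ultimately show ?thesis by linarith
  qed
qed

text \<open>Connects the dyadic estimates, stated for Bochner integrals on half-open cubes, with the
  divergence identities for closed boxes.\<close>

lemma LINT_halfcube_eq_integral:
  fixes g :: "real^'n::finite \<Rightarrow> real"
  assumes "continuous_on UNIV g" "\<And>x. x \<notin> box q (\<chi> i. q $ i + l) \<Longrightarrow> g x = 0"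
  shows "set_integrable lborel (halfcube q l) g"
    "(LINT x:halfcube q l|lborel. g x) = integral (cbox q (\<chi> i. q $ i + l)) g"
proof -
  let ?Q = "cbox q (\<chi> i. q $ i + l)"
  have "indicat_real (halfcube q l) x *\<^sub>R g x = indicat_real ?Q x *\<^sub>R g x" for x
  proof (cases "x \<in> box q (\<chi> i. q $ i + l)")
    case True
    then have "x \<in> halfcube q l" by (auto simp: halfcube_def mem_box_cart) (meson order.strict_implies_order)
    moreover have "x \<in> ?Q" using True box_subset_cbox by blast
    ultimately show ?thesis by simp
  qed (simp add: assms(2))
  then have eq: "(\<lambda>x. indicat_real (halfcube q l) x *\<^sub>R g x) = (\<lambda>x. indicat_real ?Q x *\<^sub>R g x)" by blast
  have Q: "set_integrable lborel ?Q g"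
    unfolding set_integrable_def
    by (rule borel_integrable_compact) (auto intro: continuous_on_subset[OF assms(1)])
  then show "set_integrable lborel (halfcube q l) g" unfolding set_integrable_def eq .
  show "(LINT x:halfcube q l|lborel. g x) = integral ?Q g"
    using set_borel_integral_eq_integral(2)[OF Q] unfolding set_lebesgue_integral_def eq .
qed

text \<open>The Laplacian of |x|^2 is 2 N, so Green's identity for \<eta> and |x|^2 expresses the
  integral of \<eta> by that of |x|^2 \<Delta>\<eta>.\<close>

lemma (in C2_function) integral_le_integral_lap:
  assumes zero: "\<And>x. x \<notin> cbox a b \<Longrightarrow> \<eta> x = 0" "\<And>x i. x \<notin> cbox a b \<Longrightarrow> e i x = 0"
    and R: "\<And>x. x \<in> cbox a b \<Longrightarrow> x \<bullet> x \<le> R"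
  shows "2 * real CARD('n) * integral (cbox a b) \<eta> \<le> R * integral (cbox a b) (\<lambda>x. \<bar>lap x\<bar>)"
proof -
  let ?G' = "\<lambda>i x. (d i x * (x \<bullet> x) + (2 * x $ i) * e i x) - ((2 * 1) * \<eta> x + e i x * (2 * x $ i))"
  have pdn: "has_pd i (\<lambda>x. x \<bullet> x) (2 * x $ i) x" for i and x :: "real^'n"
    unfolding has_pd_def
    by (auto intro!: derivative_eq_intros simp: inner_add_left inner_add_right inner_axis inner_commute)
  have pdc: "has_pd i (\<lambda>x. x $ i) 1 x" for i and x :: "real^'n"
    using has_pd_component[of i i x] by simp
  have c: "continuous_on UNIV (?G' i)" for i
    by (intro continuous_intros cont_e cont_d cont_\<eta>)
  have "integral (cbox a b) (?G' i) = 0" for i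
    by (rule integral_pd_eq_0[where i = i and G = "\<lambda>x. e i x * (x \<bullet> x) - (2 * x $ i) * \<eta> x"],
        intro has_pd_diff has_pd_mult has_pd_cmult pd_e pd_\<eta> pdn pdc)
       (auto intro!: continuous_intros cont_e cont_d cont_\<eta> simp: zero)
  then have z: "(\<Sum>i\<in>UNIV. integral (cbox a b) (?G' i)) = 0" by (simp only: sum.neutral_const)
  have "integral (cbox a b) (\<lambda>x. \<Sum>i\<in>UNIV. ?G' i x) = (\<Sum>i\<in>UNIV. integral (cbox a b) (?G' i))"
    by (rule Henstock_Kurzweil_Integration.integral_sum, simp, rule integrable_ucube, rule c)
  then have "integral (cbox a b) (\<lambda>x. \<Sum>i\<in>UNIV. ?G' i x) = 0" unfolding z .
  also have "(\<lambda>x. \<Sum>i\<in>UNIV. ?G' i x) = (\<lambda>x. lap x * (x \<bullet> x) - 2 * real CARD('n) * \<eta> x)"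
    by (rule ext) (simp add: algebra_simps sum_subtractf sum_distrib_left)
  finally have "integral (cbox a b) (\<lambda>x. lap x * (x \<bullet> x)) - 2 * real CARD('n) * integral (cbox a b) \<eta> = 0"
    by (subst (asm) Henstock_Kurzweil_Integration.integral_diff)
       (auto intro!: integrable_ucube continuous_intros cont_lap cont_\<eta>)
  moreover have "integral (cbox a b) (\<lambda>x. lap x * (x \<bullet> x)) \<le> integral (cbox a b) (\<lambda>x. R * \<bar>lap x\<bar>)"
  proof (rule integral_le)
    fix x assume x: "x \<in> cbox a b"
    have "lap x * (x \<bullet> x) \<le> \<bar>lap x\<bar> * (x \<bullet> x)" by (intro mult_right_mono) auto
    also have "\<dots> \<le> \<bar>lap x\<bar> * R" using R[OF x] by (intro mult_left_mono) auto
    finally show "lap x * (x \<bullet> x) \<le> R * \<bar>lap x\<bar>" by (simp add: mult.commute)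
  qed (intro integrable_ucube continuous_intros cont_lap)+
  ultimately show ?thesis by simp
qed

section \<open>Testing the equation\<close>

lemma Ck_on_2D:
  fixes u :: "real^'n::finite \<Rightarrow> real"
  assumes "Ck_on 2 u W"
  shows "\<And>x i. x \<in> W \<Longrightarrow> has_pd i u (partial i u x) x"
    "\<And>x i. x \<in> W \<Longrightarrow> has_pd i (partial i u) (partial i (partial i u) x) x"
    "continuous_on W u" "\<And>i. continuous_on W (partial i u)" "\<And>i. continuous_on W (partial i (partial i u))"
proof -
  have ck: "\<forall>x\<in>W. u differentiable (at x)" "\<forall>x\<in>W. partial i u differentiable (at x)"
    "continuous_on W (partial j (partial i u))" for i j
    using assms by (simp_all add: numeral_2_eq_2)
  show "has_pd i u (partial i u x) x" "has_pd i (partial i u) (partial i (partial i u) x) x" if "x \<in> W" for x i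
    using ck that by (blast intro: has_pd_partial)+
  have "u differentiable_on W" "partial i u differentiable_on W" for i
    unfolding differentiable_on_def using ck(1,2) differentiable_at_withinI by blast+
  then show "continuous_on W u" "continuous_on W (partial i u)" for i
    using differentiable_imp_continuous_on by blast+
  show "continuous_on W (partial i (partial i u))" for i by (rule ck(3))
qed

text \<open>With \<open>\<zeta> = 1 - \<eta>\<close> and \<open>J = ramp (u - \<epsilon>)\<close>, the field \<open>V = \<zeta>\<^sup>3 \<nabla>J - J \<nabla>\<zeta>\<^sup>3\<close> is \<open>C\<^sup>1\<close> with compact support in
  \<open>\<Omega> - K\<close>: \<open>\<zeta>\<close> vanishes near \<open>K\<close>, and \<open>J\<close> vanishes near the boundary of \<open>\<Omega>\<close>. Its divergence \<open>P\<close>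
  integrates to zero.\<close>

lemma removable_test_estimate:
  fixes \<Omega> K :: "(real^'n::finite) set" and u :: "real^'n \<Rightarrow> real"
  assumes \<Omega>: "open \<Omega>" "closure \<Omega> \<subseteq> cbox q (\<chi> i. q $ i + l)" and K: "compact K" "K \<subseteq> \<Omega>"
    and u: "continuous_on (closure \<Omega> - K) u" "Ck_on 2 u (\<Omega> - K)" "\<And>x. x \<in> closure \<Omega> - K \<Longrightarrow> 0 \<le> u x"
      "\<And>x. x \<in> \<Omega> - K \<Longrightarrow> - laplacian u x + exp (u x) - 1 = 0" "\<And>x. x \<in> frontier \<Omega> \<Longrightarrow> u x = 0"
    and \<eta>: "\<eta> \<in> C2_compact_support \<Omega>" "\<And>x. 0 \<le> \<eta> x" "\<And>x. \<eta> x \<le> 1"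
    and U: "open U" "K \<subseteq> U" "\<And>x. x \<in> U \<Longrightarrow> \<eta> x = 1"
    and \<epsilon>: "0 < \<epsilon>" and B: "compact B" "B \<subseteq> \<Omega> - K" and c: "0 < c"
      "\<And>x. x \<in> B \<Longrightarrow> c \<le> ramp1 (u x - \<epsilon>) * (exp (u x) - 1)"
    and D: "\<And>x. x \<in> halfcube q l \<Longrightarrow> 1 \<le> D x"
      "\<And>x. x \<in> halfcube q l \<Longrightarrow> test_density (\<lambda>i. partial i \<eta>) (\<lambda>i. partial i (partial i \<eta>)) x \<le> 2 * D x"
      "set_integrable lborel (halfcube q l) (\<lambda>x. test_density (\<lambda>i. partial i \<eta>) (\<lambda>i. partial i (partial i \<eta>)) x * (1 + ln (D x)))"
  shows "measure lborel B \<le> 216 / c * (LINT x:halfcube q l|lborel.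
      test_density (\<lambda>i. partial i \<eta>) (\<lambda>i. partial i (partial i \<eta>)) x * (1 + ln (D x)))
    + 3 * integral (cbox q (\<chi> i. q $ i + l)) \<eta>"
proof -
  let ?W = "\<Omega> - K" and ?Q = "cbox q (\<chi> i. q $ i + l)" and ?H = "halfcube q l"
  define e where "e = (\<lambda>i. partial i \<eta>)"
  define d where "d = (\<lambda>i. partial i (partial i \<eta>))"
  define u1 where "u1 i = partial i u" for i
  define u2 where "u2 i = partial i (u1 i)" for i
  let ?F = "test_density e d"
  interpret C2_function \<eta> e d
    unfolding e_def d_def by (rule C2_compact_supportD(1)[OF \<Omega>(1) \<eta>(1)])
  have oW: "open ?W" using \<Omega>(1) K(1) by (intro open_Diff compact_imp_closed)
  note uD = Ck_on_2D[OF u(2), folded u1_def, folded u2_def]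
  have Wcl: "?W \<subseteq> closure \<Omega> - K" using closure_subset by blast
  have \<Omega>box: "\<Omega> \<subseteq> box q (\<chi> i. q $ i + l)"
    using interior_maximal[OF order_trans[OF closure_subset \<Omega>(2)] \<Omega>(1)] by (simp add: interior_cbox)
  have boxH: "box q (\<chi> i. q $ i + l) \<subseteq> ?H"
    by (auto simp: halfcube_def mem_box_cart) (meson order.strict_implies_order)

  \<comment> \<open>A closed set carrying \<open>V\<close>: off it, within \<Omega> - K, either
    \<zeta> vanishes or u < \<epsilon>. The boundary values of u keep it inside \<Omega>, and
    removing U keeps it off K.\<close>
  define T where "T = {x \<in> closure \<Omega> - U. \<epsilon> \<le> u x}"
  have contU: "continuous_on (closure \<Omega> - U) u"
    by (rule continuous_on_subset[OF u(1)]) (use U in blast)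
  have "closed T"
    unfolding T_def
    by (intro continuous_closed_preimage_constant continuous_on_closed_Collect_le) (auto intro!: continuous_on_const contU closed_Diff U(1))
  have TW: "T \<subseteq> ?W"
  proof
    fix x assume "x \<in> T"
    then have x: "x \<in> closure \<Omega>" "x \<notin> U" "\<epsilon> \<le> u x" by (auto simp: T_def)
    have "x \<notin> frontier \<Omega>" using u(5)[of x] x \<epsilon> by auto
    then show "x \<in> ?W" using x U(2) interior_open[OF \<Omega>(1)] unfolding frontier_def by blast
  qed
  have un: "?W \<union> - T = UNIV" using TW by blast
  have oT: "open (- T)" by (rule open_Compl[OF \<open>closed T\<close>])

  define \<zeta> where "\<zeta> x = 1 - \<eta> x" for x
  define s where "s x = u x - \<epsilon>" for x
  define J1 where "J1 i x = ramp1 (s x) * u1 i x" for i x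
  define J2 where "J2 i x = (ramp2 (s x) * u1 i x) * u1 i x + u2 i x * ramp1 (s x)" for i x
  define p1 where "p1 i x = 3 * (\<zeta> x)\<^sup>2 * (0 - e i x)" for i x
  define p2 where "p2 i x = (6 * \<zeta> x * (0 - e i x)) * (0 - e i x) + (0 - d i x) * (3 * (\<zeta> x)\<^sup>2)" for i x
  \<comment> \<open>The case distinction is essential because \<open>u\<close> is an arbitrary total
    function: on K and outside the closure of \<Omega> its values mean nothing.\<close>
  define V where "V i x = (if x \<in> ?W then \<zeta> x ^ 3 * J1 i x - ramp (s x) * p1 i x else 0)" for i x
  define P where "P i x = (if x \<in> ?W then \<zeta> x ^ 3 * J2 i x - ramp (s x) * p2 i x else 0)" for i x
  have \<zeta>01: "0 \<le> \<zeta> x" "\<zeta> x \<le> 1" for x using \<eta>(2,3)[of x] by (simp_all add: \<zeta>_def)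

  have zeroT: "V i x = 0 \<and> P i x = 0" if "x \<in> - T" for i x
  proof (cases "x \<in> ?W")
    case True
    then have "x \<in> U \<or> s x \<le> 0" using that Wcl by (auto simp: T_def s_def)
    then show ?thesis
    proof
      assume "x \<in> U"
      then have "\<zeta> x = 0" by (simp add: \<zeta>_def U(3))
      then show ?thesis by (simp add: V_def P_def p1_def p2_def)
    next
      assume "s x \<le> 0"
      then show ?thesis by (simp add: V_def P_def J1_def J2_def ramp_bounds)
    qed
  next
    case False
    then show ?thesis by (simp only: V_def P_def if_False simp_thms)
  qed
  have pdV: "has_pd i (V i) (P i x) x" for i x
  proof (cases "x \<in> ?W")
    case True
    have ps: "has_pd i s (u1 i y) y" if "y \<in> ?W" for y
      using has_pd_diff[OF uD(1)[OF that] has_pd_const[of i \<epsilon>]] by (simp add: s_def[abs_def])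
    have pz: "has_pd i \<zeta> (0 - e i y) y" for y
      unfolding \<zeta>_def[abs_def] by (rule has_pd_diff[OF has_pd_const pd_\<eta>])
    have pJ: "has_pd i (\<lambda>y. ramp (s y)) (J1 i x) x"
      unfolding J1_def by (rule has_pd_compose[OF ps[OF True] DERIV_ramp])
    have pJ1: "has_pd i (J1 i) (J2 i x) x"
      unfolding J1_def[abs_def] J2_def
      by (rule has_pd_mult[OF has_pd_compose[OF ps[OF True] DERIV_ramp1] uD(2)[OF True]])
    have pp: "has_pd i (\<lambda>y. \<zeta> y ^ 3) (p1 i x) x"
      unfolding p1_def by (rule has_pd_compose[OF pz]) (auto intro!: derivative_eq_intros)
    have pp1: "has_pd i (p1 i) (p2 i x) x"
      unfolding p1_def[abs_def] p2_def
    proof (rule has_pd_mult)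
      show "has_pd i (\<lambda>x. 3 * (\<zeta> x)\<^sup>2) (6 * \<zeta> x * (0 - e i x)) x"
        by (rule has_pd_compose[OF pz]) (auto intro!: derivative_eq_intros)
      show "has_pd i (\<lambda>x. 0 - e i x) (0 - d i x) x"
        by (rule has_pd_diff[OF has_pd_const pd_e])
    qed
    have "has_pd i (\<lambda>y. \<zeta> y ^ 3 * J1 i y - ramp (s y) * p1 i y)
        ((p1 i x * J1 i x + J2 i x * \<zeta> x ^ 3) - (J1 i x * p1 i x + p2 i x * ramp (s x))) x"
      by (intro has_pd_diff has_pd_mult pp pJ1 pJ pp1)
    \<comment> \<open>The products of first derivatives cancel by antisymmetry, so \<open>P\<close>
      contains only the two second-order terms.\<close>
    also have "(p1 i x * J1 i x + J2 i x * \<zeta> x ^ 3) - (J1 i x * p1 i x + p2 i x * ramp (s x)) = P i x"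
      using True by (simp add: P_def mult.commute)
    finally have "has_pd i (\<lambda>y. \<zeta> y ^ 3 * J1 i y - ramp (s y) * p1 i y) (P i x) x" .
    then show ?thesis
      by (rule has_pd_cong_open[OF oW True, rotated]) (simp add: V_def)
  next
    case False
    then have x: "x \<in> - T" using un by blast
    have "has_pd i (V i) 0 x"
      by (rule has_pd_cong_open[OF oT x _ has_pd_const[of i 0]]) (use zeroT in simp)
    then show ?thesis using zeroT[OF x] by simp
  qed
  have cV: "continuous_on UNIV (V i)" "continuous_on UNIV (P i)" for i
  proof -
    have cs: "continuous_on ?W s" unfolding s_def[abs_def] by (intro continuous_intros uD(3))
    have ce: "continuous_on ?W (e i)" "continuous_on ?W (d i)" "continuous_on ?W \<zeta>"
      unfolding \<zeta>_def[abs_def]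
      by (rule continuous_on_subset[OF cont_e] continuous_on_subset[OF cont_d]
          continuous_on_diff[OF continuous_on_const continuous_on_subset[OF cont_\<eta>]], simp)+
    note cc = continuous_on_compose2[OF continuous_on_ramp(1)[of UNIV] cs] continuous_on_compose2[OF continuous_on_ramp(2)[of UNIV] cs]
      continuous_on_compose2[OF continuous_on_ramp(3)[of UNIV] cs]
    have "continuous_on ?W (\<lambda>x. \<zeta> x ^ 3 * J1 i x - ramp (s x) * p1 i x)"
      unfolding J1_def p1_def by (intro continuous_intros cc ce uD(4,5)) simp_all
    then have "continuous_on ?W (V i)" by (rule continuous_on_eq) (simp add: V_def)
    moreover have "continuous_on (- T) (V i)"
      by (rule continuous_on_eq[OF continuous_on_const[of _ 0]]) (use zeroT in simp)
    ultimately show "continuous_on UNIV (V i)"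
      using continuous_on_open_Un[OF oW oT] un by metis
    have "continuous_on ?W (\<lambda>x. \<zeta> x ^ 3 * J2 i x - ramp (s x) * p2 i x)"
      unfolding J2_def p2_def by (intro continuous_intros cc ce uD(4,5)) simp_all
    then have "continuous_on ?W (P i)" by (rule continuous_on_eq) (simp add: P_def)
    moreover have "continuous_on (- T) (P i)"
      by (rule continuous_on_eq[OF continuous_on_const[of _ 0]]) (use zeroT in simp)
    ultimately show "continuous_on UNIV (P i)"
      using continuous_on_open_Un[OF oW oT] un by metis
  qed
  let ?P = "\<lambda>x. \<Sum>i\<in>UNIV. P i x"
  have cP: "continuous_on UNIV ?P" by (intro continuous_intros cV)
  have "integral ?Q (P i) = 0" for i
  proof (rule integral_pd_eq_0[OF pdV cV])
    fix x assume "x \<notin> ?Q"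
    then have "x \<notin> ?W" using closure_subset \<Omega>(2) by blast
    then show "V i x = 0" by (simp only: V_def if_False)
  qed
  then have z: "(\<Sum>i\<in>UNIV. integral ?Q (P i)) = 0" by (simp only: sum.neutral_const)
  have "integral ?Q ?P = (\<Sum>i\<in>UNIV. integral ?Q (P i))"
    by (rule Henstock_Kurzweil_Integration.integral_sum, simp, rule integrable_ucube, rule cV)
  then have IP: "integral ?Q ?P = 0" unfolding z .
  have P0: "?P x = 0" if "x \<notin> box q (\<chi> i. q $ i + l)" for x
  proof -
    have "x \<notin> ?W" using that \<Omega>box by blast
    then show ?thesis by (simp only: P_def if_False sum.neutral_const)
  qed
  have LP: "set_integrable lborel ?H ?P" "(LINT x:?H|lborel. ?P x) = 0"
    by (rule LINT_halfcube_eq_integral(1)[OF cP], erule P0)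
       (rule trans[OF LINT_halfcube_eq_integral(2)[OF cP] IP], erule P0)
  have \<eta>0: "\<eta> x = 0" if "x \<notin> box q (\<chi> i. q $ i + l)" for x
    using that \<Omega>box C2_compact_supportD(2)[OF \<Omega>(1) \<eta>(1)] by blast
  have L\<eta>: "set_integrable lborel ?H \<eta>" "(LINT x:?H|lborel. \<eta> x) = integral ?Q \<eta>"
    using LINT_halfcube_eq_integral[OF cont_\<eta> \<eta>0] by blast+

  let ?G = "\<lambda>x. ?F x * (1 + ln (D x))"
  have G0: "0 \<le> ?G x" if "x \<in> ?H" for x
    using D(1)[OF that] by (intro mult_nonneg_nonneg) (auto simp: test_density_def intro!: add_nonneg_nonneg sum_nonneg)
  have P_ge: "\<zeta> x ^ 3 * (ramp1 (s x) * (exp (u x) - 1)) / 2 - 108 * ?G x \<le> ?P x" if x: "x \<in> ?W" for x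
  proof -
    have xH: "x \<in> ?H" using x \<Omega>box boxH by blast
    have ux: "0 \<le> u x" using x Wcl u(3) by blast
    have lu: "(\<Sum>i\<in>UNIV. u2 i x) = exp (u x) - 1"
      using u(4)[OF x] by (simp add: laplacian_def u2_def u1_def)
    have F0: "0 \<le> ?F x" by (simp add: test_density_def sum_nonneg)
    \<comment> \<open>The equation replaces the Laplacian of u, and convexity of the ramp gives the
      gradient term the favourable sign.\<close>
    have "(\<Sum>i\<in>UNIV. J2 i x) = ramp2 (s x) * (\<Sum>i\<in>UNIV. (u1 i x)\<^sup>2) + ramp1 (s x) * (exp (u x) - 1)"
      unfolding lu[symmetric] by (simp add: J2_def sum.distrib sum_distrib_left power2_eq_square mult_ac)
    moreover have "0 \<le> ramp2 (s x) * (\<Sum>i\<in>UNIV. (u1 i x)\<^sup>2)"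
      by (intro mult_nonneg_nonneg ramp_bounds sum_nonneg) simp
    ultimately have "ramp1 (s x) * (exp (u x) - 1) \<le> (\<Sum>i\<in>UNIV. J2 i x)" by linarith
    then have 1: "\<zeta> x ^ 3 * (ramp1 (s x) * (exp (u x) - 1)) \<le> \<zeta> x ^ 3 * (\<Sum>i\<in>UNIV. J2 i x)"
      using \<zeta>01 by (intro mult_left_mono) auto
    have "(\<Sum>i\<in>UNIV. p2 i x) = 6 * \<zeta> x * (\<Sum>i\<in>UNIV. (e i x)\<^sup>2) + 3 * (\<zeta> x)\<^sup>2 * - lap x"
      by (simp add: p2_def sum.distrib sum_subtractf sum_negf sum_distrib_left power2_eq_square mult_ac)
    also have "\<dots> \<le> 9 * \<zeta> x * (\<Sum>i\<in>UNIV. (e i x)\<^sup>2) + 9 * \<zeta> x * \<bar>lap x\<bar>"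
    proof (rule add_mono)
      show "6 * \<zeta> x * (\<Sum>i\<in>UNIV. (e i x)\<^sup>2) \<le> 9 * \<zeta> x * (\<Sum>i\<in>UNIV. (e i x)\<^sup>2)"
        using \<zeta>01 by (intro mult_right_mono sum_nonneg) auto
      have "3 * (\<zeta> x)\<^sup>2 * - lap x \<le> 3 * (\<zeta> x)\<^sup>2 * \<bar>lap x\<bar>" by (intro mult_left_mono) auto
      also have "\<dots> \<le> 9 * \<zeta> x * \<bar>lap x\<bar>"
      proof (rule mult_right_mono)
        have "(\<zeta> x)\<^sup>2 \<le> \<zeta> x" using \<zeta>01[of x] by (simp add: power2_eq_square mult_left_le)
        then show "3 * (\<zeta> x)\<^sup>2 \<le> 9 * \<zeta> x" using \<zeta>01[of x] by linarith
      qed simp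
      finally show "3 * (\<zeta> x)\<^sup>2 * - lap x \<le> 9 * \<zeta> x * \<bar>lap x\<bar>" .
    qed
    also have "\<dots> = 9 * \<zeta> x * ?F x" by (simp add: test_density_def distrib_left)
    finally have "ramp (s x) * (\<Sum>i\<in>UNIV. p2 i x) \<le> ramp (s x) * (9 * \<zeta> x * ?F x)"
      by (intro mult_left_mono ramp_bounds)
    also have "\<dots> \<le> ramp1 (s x) * u x * (9 * \<zeta> x * ?F x)"
      using \<zeta>01[of x] F0 \<epsilon> ux by (intro mult_right_mono ramp_le) (auto simp: s_def)
    also have "\<dots> = ramp1 (s x) * (u x * (9 * \<zeta> x * ?F x))" by simp
    also have "\<dots> \<le> ramp1 (s x) * (\<zeta> x ^ 3 * (exp (u x) - 1) / 2 + 108 * ?G x)"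
      using \<zeta>01[of x] ux F0 D(1,2)[OF xH] unfolding e_def[symmetric] d_def[symmetric]
      by (intro mult_left_mono exp_LlnL_duality ramp_bounds) auto
    \<comment> \<open>The slope of the ramp stays on the absorbed term but is bounded by 1 in the
      error, which becomes independent of u.\<close>
    also have "\<dots> \<le> \<zeta> x ^ 3 * (ramp1 (s x) * (exp (u x) - 1)) / 2 + 108 * ?G x"
    proof -
      have "ramp1 (s x) * (108 * ?G x) \<le> 1 * (108 * ?G x)"
        using G0[OF xH] by (intro mult_right_mono ramp_bounds) auto
      then show ?thesis by (simp add: distrib_left mult_ac)
    qed
    finally have 2: "ramp (s x) * (\<Sum>i\<in>UNIV. p2 i x) \<le> \<zeta> x ^ 3 * (ramp1 (s x) * (exp (u x) - 1)) / 2 + 108 * ?G x" .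
    have "?P x = \<zeta> x ^ 3 * (\<Sum>i\<in>UNIV. J2 i x) - ramp (s x) * (\<Sum>i\<in>UNIV. p2 i x)"
      using x by (simp add: P_def sum_subtractf sum_distrib_left)
    then show ?thesis using 1 2 by linarith
  qed
  \<comment> \<open>On B the weight is at least \<open>c\<close>, so \<zeta>^3 is controlled by
    \<open>P\<close> and the error; the defect 1 - \<zeta>^3 is at most 3 \<eta>, as 1 - (1 - t)^3
    \<le> 3 t on [0, 1].\<close>
  have ineq: "indicat_real B x \<le> 2 / c * ?P x + (216 / c * ?G x + 3 * \<eta> x)" if xH: "x \<in> ?H" for x
  proof (cases "x \<in> ?W")
    case True
    let ?A = "ramp1 (s x) * (exp (u x) - 1)"
    have ux: "0 \<le> u x" using True Wcl u(3) by blast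
    have A0: "0 \<le> \<zeta> x ^ 3 * ?A" using \<zeta>01[of x] ux by (intro mult_nonneg_nonneg ramp_bounds) auto
    have PG: "\<zeta> x ^ 3 * ?A / c \<le> 2 / c * ?P x + 216 / c * ?G x"
    proof -
      have "\<zeta> x ^ 3 * ?A \<le> 2 * ?P x + 216 * ?G x" using P_ge[OF True] by linarith
      then have "\<zeta> x ^ 3 * ?A / c \<le> (2 * ?P x + 216 * ?G x) / c" using c(1) by (intro divide_right_mono) auto
      then show ?thesis by (simp add: add_divide_distrib)
    qed
    show ?thesis
    proof (cases "x \<in> B")
      case True
      have "1 \<le> \<zeta> x ^ 3 + 3 * \<eta> x"
      proof -
        have "\<zeta> x ^ 3 + 3 * \<eta> x - 1 = (\<eta> x)\<^sup>2 * (3 - \<eta> x)"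
          by (simp add: \<zeta>_def power2_eq_square power3_eq_cube algebra_simps)
        moreover have "0 \<le> (\<eta> x)\<^sup>2 * (3 - \<eta> x)" using \<eta>(3)[of x] by simp
        ultimately show ?thesis by linarith
      qed
      moreover have "\<zeta> x ^ 3 \<le> \<zeta> x ^ 3 * ?A / c"
      proof -
        have "\<zeta> x ^ 3 * c \<le> \<zeta> x ^ 3 * ?A"
          using c(2)[OF True] \<zeta>01[of x] unfolding s_def by (intro mult_left_mono) auto
        then show ?thesis using c(1) by (simp add: pos_le_divide_eq)
      qed
      ultimately show ?thesis using PG True by simp
    next
      case False
      have "0 \<le> \<zeta> x ^ 3 * ?A / c" using A0 c(1) by (intro divide_nonneg_pos)
      then show ?thesis using PG \<eta>(2)[of x] False by simp
    qed
  next
    case False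
    have "x \<notin> B" using False B(2) by blast
    moreover have "?P x = 0" using False by (simp only: P_def if_False sum.neutral_const)
    moreover have "0 \<le> 216 / c * ?G x"
      by (rule mult_nonneg_nonneg[OF _ G0[OF xH]]) (use c(1) in simp)
    ultimately show ?thesis using \<eta>(2)[of x] by simp
  qed
  have BH: "B \<subseteq> ?H" using B(2) \<Omega>box boxH by blast
  have iG: "set_integrable lborel ?H ?G" using D(3) by (simp add: e_def d_def)
  have iB: "set_integrable lborel ?H (indicat_real B)"
  proof -
    have "integrable lborel (indicat_real B)"
      by (rule integrable_real_indicator[OF _ emeasure_compact_finite[OF B(1)]]) (simp add: borel_compact B(1))
    then show ?thesis
      unfolding set_integrable_def using BH
      by (subst Bochner_Integration.integrable_cong[where g = "indicat_real B"]) (auto simp: indicator_def)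
  qed
  have i: "set_integrable lborel ?H (\<lambda>x. 2 / c * ?P x)" "set_integrable lborel ?H (\<lambda>x. 216 / c * ?G x)"
    "set_integrable lborel ?H (\<lambda>x. 3 * \<eta> x)"
    by (rule set_integrable_mult_right, rule LP(1) iG L\<eta>(1))+
  have "measure lborel B = (LINT x:?H|lborel. indicat_real B x)"
  proof -
    have "(LINT x:?H|lborel. indicat_real B x) = (LINT x|lborel. indicat_real B x)"
      unfolding set_lebesgue_integral_def
      by (rule Bochner_Integration.integral_cong) (use BH in \<open>auto simp: indicator_def\<close>)
    then show ?thesis using B(1) by (simp add: borel_compact)
  qed
  also have "\<dots> \<le> (LINT x:?H|lborel. 2 / c * ?P x + (216 / c * ?G x + 3 * \<eta> x))"
    by (rule set_integral_mono[OF iB set_integral_add(1)[OF i(1) set_integral_add(1)[OF i(2,3)]]]) (rule ineq)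
  also have "\<dots> = 2 / c * (LINT x:?H|lborel. ?P x) + (216 / c * (LINT x:?H|lborel. ?G x) + 3 * (LINT x:?H|lborel. \<eta> x))"
    unfolding set_integral_add(2)[OF i(1) set_integral_add(1)[OF i(2,3)]] set_integral_add(2)[OF i(2,3)]
    by (simp only: set_integral_mult_right)
  finally show ?thesis unfolding LP(2) L\<eta>(2) by (simp add: e_def d_def)
qed

theorem theoremE:
  fixes \<Omega> K Q0 :: "(real^'n::finite) set" and u :: "real^'n \<Rightarrow> real"
  assumes "open \<Omega>" and "connected \<Omega>" and "\<Omega> \<noteq> {}" and "bounded \<Omega>"
    and "smooth_boundary \<Omega>"
    and "axis_cube Q0" and "closure \<Omega> \<subseteq> Q0"
    and "compact K" and "K \<subseteq> \<Omega>"
    and "cap_LlnL Q0 \<Omega> K = 0"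
    and "continuous_on (closure \<Omega> - K) u" and "Ck_on 2 u (\<Omega> - K)"
    and "\<forall>x\<in>closure \<Omega> - K. u x \<ge> 0"
    and "\<forall>x\<in>\<Omega> - K. - laplacian u x + exp (u x) - 1 = 0"
    and "\<forall>x\<in>frontier \<Omega>. u x = 0"
  shows "\<forall>x\<in>closure \<Omega> - K. u x = 0"
proof (rule ccontr)
  assume "\<not> ?thesis"
  then obtain x0 where x0: "x0 \<in> closure \<Omega> - K" "u x0 \<noteq> 0" by blast
  have "x0 \<notin> frontier \<Omega>" using assms(15) x0(2) by blast
  then have x0W: "x0 \<in> \<Omega> - K" using x0(1) interior_open[OF assms(1)] unfolding frontier_def by blast
  have pos: "0 < u x0" using x0 assms(13) by (simp add: less_le)
  \<comment> \<open>Half of the positive value leaves a whole ball around x0 on which u >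
    \<epsilon>.\<close>
  define \<epsilon> where "\<epsilon> = u x0 / 2"
  have \<epsilon>: "0 < \<epsilon>" using pos by (simp add: \<epsilon>_def)
  obtain q l where l: "0 < l" and Q0: "Q0 = cbox q (\<chi> i. q $ i + l)"
    using assms(6) unfolding axis_cube_def by blast
  have oW: "open (\<Omega> - K)" using assms(1,8) by (intro open_Diff compact_imp_closed)
  note cu = Ck_on_2D(3)[OF assms(12)]
  have "open ((\<Omega> - K) \<inter> u -` {\<epsilon><..})"
    by (rule continuous_open_preimage[OF cu oW]) simp
  moreover have "x0 \<in> (\<Omega> - K) \<inter> u -` {\<epsilon><..}" using x0W pos by (simp add: \<epsilon>_def)
  ultimately obtain \<rho> where \<rho>: "0 < \<rho>" "cball x0 \<rho> \<subseteq> (\<Omega> - K) \<inter> u -` {\<epsilon><..}"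
    using open_contains_cball by metis
  let ?B = "cball x0 \<rho>"
  let ?m = "measure lborel ?B"
  have m: "0 < ?m" using content_cball_pos[OF \<rho>(1)] .
  have "continuous_on ?B (\<lambda>x. ramp1 (u x - \<epsilon>) * (exp (u x) - 1))"
    using continuous_on_subset[OF cu, of ?B] \<rho>(2)
    by (intro continuous_intros continuous_on_compose2[OF continuous_on_ramp(2)[of UNIV]]) auto
  moreover have "?B \<noteq> {}" using \<rho>(1) by simp
  ultimately have "\<exists>y\<in>?B. \<forall>x\<in>?B. ramp1 (u y - \<epsilon>) * (exp (u y) - 1) \<le> ramp1 (u x - \<epsilon>) * (exp (u x) - 1)"
    using continuous_attains_inf[OF compact_cball] by blast
  then obtain y where y: "y \<in> ?B"
    "\<And>x. x \<in> ?B \<Longrightarrow> ramp1 (u y - \<epsilon>) * (exp (u y) - 1) \<le> ramp1 (u x - \<epsilon>) * (exp (u x) - 1)"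
    by blast
  \<comment> \<open>The minimum of the weight on the ball, positive because u > \<epsilon> there. It
    is fixed before any test function is chosen.\<close>
  define c where "c = ramp1 (u y - \<epsilon>) * (exp (u y) - 1)"
  have "\<epsilon> < u y" using y(1) \<rho>(2) by auto
  then have c: "0 < c" unfolding c_def using \<epsilon> by (intro mult_pos_pos ramp_bounds(5)) auto

  obtain C where C: "0 < C" and test: "\<And>\<eta> e d (q :: real^'n) l \<epsilon>. C2_function \<eta> e d \<Longrightarrow> (\<forall>y. 0 \<le> \<eta> y \<and> \<eta> y \<le> 1) \<Longrightarrow> 0 < l \<Longrightarrow>
     (\<forall>y. y \<notin> cbox q (\<chi> i. q $ i + l) \<longrightarrow> (\<Sum>i\<in>UNIV. d i y) = 0) \<Longrightarrow>
     (\<integral>\<^sup>+x\<in>cbox q (\<chi> i. q $ i + l). maximal_fn (cbox q (\<chi> i. q $ i + l)) (\<lambda>y. \<Sum>i\<in>UNIV. d i y) x \<partial>lebesgue) \<le> ennreal \<epsilon> \<Longrightarrow>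
     0 < \<epsilon> \<Longrightarrow> C * \<epsilon> \<le> l ^ CARD('n) \<Longrightarrow>
     (\<exists>D. D \<in> borel_measurable borel \<and> (\<forall>x. 1 \<le> D x) \<and> (\<forall>x\<in>halfcube q l. test_density e d x \<le> 2 * D x) \<and>
        set_integrable lborel (halfcube q l) (\<lambda>x. test_density e d x * (1 + ln (D x))) \<and>
        (LINT x:halfcube q l|lborel. test_density e d x * (1 + ln (D x))) \<le> C * \<epsilon>)"
    using LlnL_test_function[where 'n = 'n] by blast
  obtain R where R: "0 \<le> R" "\<And>x. x \<in> Q0 \<Longrightarrow> x \<bullet> x \<le> R"
  proof -
    have "compact ((\<lambda>x. x \<bullet> x) ` Q0)"
      unfolding Q0 by (intro compact_continuous_image continuous_intros) simp
    then obtain R where "\<forall>y\<in>(\<lambda>x. x \<bullet> x) ` Q0. \<bar>y\<bar> \<le> R"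
      by (auto dest!: compact_imp_bounded simp: bounded_iff)
    then have "\<And>x. x \<in> Q0 \<Longrightarrow> x \<bullet> x \<le> \<bar>R\<bar>" by fastforce
    then show ?thesis using that[of "\<bar>R\<bar>"] by simp
  qed
  \<comment> \<open>The ball and all the constants are independent of \<delta>, while zero capacity
    supplies a test function for each small \<delta>.\<close>
  have bound: "?m \<le> (216 / c + 3 * R) * (C * \<delta>)" if \<delta>: "0 < \<delta>" "C * \<delta> \<le> l ^ CARD('n)" for \<delta>
  proof -
    have "cap_LlnL Q0 \<Omega> K < ennreal \<delta>" using assms(10) \<delta> by simp
    then obtain \<eta> U where \<eta>: "\<eta> \<in> C2_compact_support \<Omega>" "\<forall>x. 0 \<le> \<eta> x \<and> \<eta> x \<le> 1"
      and U: "open U" "K \<subseteq> U" "\<forall>x\<in>U. \<eta> x = 1"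
      and M: "(\<integral>\<^sup>+x\<in>Q0. maximal_fn Q0 (\<lambda>y. if y \<in> \<Omega> then laplacian \<eta> y else 0) x \<partial>lebesgue) < ennreal \<delta>"
      unfolding cap_LlnL_def INF_less_iff by blast
    let ?e = "\<lambda>i. partial i \<eta>" and ?d = "\<lambda>i. partial i (partial i \<eta>)"
    note zero = C2_compact_supportD(2-4)[OF assms(1) \<eta>(1)]
    interpret C2_function \<eta> ?e ?d by (rule C2_compact_supportD(1)[OF assms(1) \<eta>(1)])
    have \<Omega>Q: "\<Omega> \<subseteq> Q0" using closure_subset assms(7) by blast
    have lap_eq: "(\<lambda>y. if y \<in> \<Omega> then laplacian \<eta> y else 0) = (\<lambda>y. lap y)"
      by (rule ext) (simp add: laplacian_def zero)
    have M': "(\<integral>\<^sup>+x\<in>Q0. maximal_fn Q0 (\<lambda>y. lap y) x \<partial>lebesgue) \<le> ennreal \<delta>"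
      using less_imp_le[OF M] unfolding lap_eq .
    have z: "\<forall>y. y \<notin> Q0 \<longrightarrow> lap y = 0" using zero(3) \<Omega>Q by (auto intro!: sum.neutral)
    have "\<exists>D. D \<in> borel_measurable borel \<and> (\<forall>x. 1 \<le> D x) \<and> (\<forall>x\<in>halfcube q l. test_density ?e ?d x \<le> 2 * D x) \<and>
        set_integrable lborel (halfcube q l) (\<lambda>x. test_density ?e ?d x * (1 + ln (D x))) \<and>
        (LINT x:halfcube q l|lborel. test_density ?e ?d x * (1 + ln (D x))) \<le> C * \<delta>"
      by (rule test[OF C2_function_axioms \<eta>(2) l z[unfolded Q0] M'[unfolded Q0] \<delta>])
    then obtain D where D: "\<forall>x. 1 \<le> D x" "\<forall>x\<in>halfcube q l. test_density ?e ?d x \<le> 2 * D x"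
        "set_integrable lborel (halfcube q l) (\<lambda>x. test_density ?e ?d x * (1 + ln (D x)))"
        "(LINT x:halfcube q l|lborel. test_density ?e ?d x * (1 + ln (D x))) \<le> C * \<delta>"
      by blast
    let ?G = "LINT x:halfcube q l|lborel. test_density ?e ?d x * (1 + ln (D x))"
    have "?m \<le> 216 / c * ?G + 3 * integral (cbox q (\<chi> i. q $ i + l)) \<eta>"
    proof (rule removable_test_estimate[OF assms(1) _ assms(8,9,11,12) _ _ _ \<eta>(1) _ _ U(1,2) _ \<epsilon> compact_cball _ c _ _ _ D(3)])
      show "closure \<Omega> \<subseteq> cbox q (\<chi> i. q $ i + l)" using assms(7) Q0 by simp
      show "c \<le> ramp1 (u x - \<epsilon>) * (exp (u x) - 1)" if "x \<in> ?B" for x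
        using y(2)[OF that] by (simp add: c_def)
      show "?B \<subseteq> \<Omega> - K" using \<rho>(2) by blast
    qed (use assms(13-15) \<eta>(2) U(3) D(1,2) in blast)+
    also have "216 / c * ?G \<le> 216 / c * (C * \<delta>)" using D(4) c by (intro mult_left_mono) auto
    also have "integral (cbox q (\<chi> i. q $ i + l)) \<eta> \<le> R * (C * \<delta>)"
    proof -
      let ?Q = "cbox q (\<chi> i. q $ i + l)"
      have cl: "continuous_on UNIV (\<lambda>x. \<bar>lap x\<bar>)" by (intro continuous_intros cont_lap)
      have "\<Omega> \<subseteq> box q (\<chi> i. q $ i + l)"
        using interior_maximal[OF \<Omega>Q assms(1)] by (simp add: Q0 interior_cbox)
      then have l0: "\<bar>lap x\<bar> = 0" if "x \<notin> box q (\<chi> i. q $ i + l)" for x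
        using that zero(3) by (auto intro!: sum.neutral)
      note L = LINT_halfcube_eq_integral[OF cl l0]
      have "integral ?Q (\<lambda>x. \<bar>lap x\<bar>) = (LINT x:halfcube q l|lborel. \<bar>lap x\<bar>)"
        by (rule L(2)[symmetric])
      also have "\<dots> \<le> ?G"
      proof (rule set_integral_mono[OF L(1) D(3)])
        fix x
        have "0 \<le> ln (D x)" using D(1) by simp
        moreover have F: "\<bar>lap x\<bar> \<le> test_density ?e ?d x" by (simp add: test_density_def sum_nonneg)
        ultimately have "\<bar>lap x\<bar> * 1 \<le> test_density ?e ?d x * (1 + ln (D x))"
          by (intro mult_mono) (auto simp: test_density_def sum_nonneg)
        then show "\<bar>lap x\<bar> \<le> test_density ?e ?d x * (1 + ln (D x))" by simp
      qed
      finally have "integral ?Q (\<lambda>x. \<bar>lap x\<bar>) \<le> ?G" .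
      then have "R * integral ?Q (\<lambda>x. \<bar>lap x\<bar>) \<le> R * (C * \<delta>)"
        using D(4) R(1) by (intro mult_left_mono) auto
      moreover have "2 * real CARD('n) * integral ?Q \<eta> \<le> R * integral ?Q (\<lambda>x. \<bar>lap x\<bar>)"
        by (rule integral_le_integral_lap) (use zero(1,2) \<Omega>Q R(2) Q0 in auto)
      moreover have "1 * integral ?Q \<eta> \<le> 2 * real CARD('n) * integral ?Q \<eta>"
      proof (rule mult_right_mono)
        have "1 \<le> real CARD('n)" using zero_less_card_finite[where 'a = 'n] by linarith
        then show "1 \<le> 2 * real CARD('n)" by linarith
        show "0 \<le> integral ?Q \<eta>" by (intro integral_nonneg integrable_ucube cont_\<eta>) (use \<eta>(2) in auto)
      qed
      ultimately show ?thesis by linarith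
    qed
    finally show ?thesis by (simp add: distrib_right)
  qed
  define A where "A = (216 / c + 3 * R) * C"
  have A: "0 < A" unfolding A_def using c R(1) C by (intro mult_pos_pos add_pos_nonneg) auto
  \<comment> \<open>The first entry meets the smallness condition of the L ln L estimate; the second
    makes the bound half the volume of the ball.\<close>
  define \<delta> where "\<delta> = min (l ^ CARD('n) / C) (?m / (2 * A))"
  have "0 < \<delta>" using l C m A by (simp add: \<delta>_def)
  moreover have "C * \<delta> \<le> l ^ CARD('n)"
  proof -
    have "C * \<delta> \<le> C * (l ^ CARD('n) / C)" using C by (intro mult_left_mono) (auto simp: \<delta>_def)
    then show ?thesis using C by simp
  qed
  ultimately have "?m \<le> A * \<delta>" using bound[of \<delta>] by (simp add: A_def mult.assoc)
  also have "\<dots> \<le> A * (?m / (2 * A))" using A by (intro mult_left_mono) (auto simp: \<delta>_def)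
  also have "\<dots> = ?m / 2" using A by simp
  finally show False using m by simp
qed

end
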